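(* Let $1<p\le 2\le q<\infty$ with $p<q$. If $R\in L(\ell_p,\ell_q)$ is not finitely strictly singular, then $\mathcal J^{\ell_2}\subseteq\mathcal J^R$.
   Context: $L(X,Y)$ is the space of bounded linear operators from $X$ to $Y$, and $L(X)=L(X,X)$. An ideal in $L(\ell_p,\ell_q)$ is a linear subspace $\mathcal J\subseteq L(\ell_p,\ell_q)$ such that $ATB\in\mathcal J$ whenever $A\in L(\ell_q)$, $T\in\mathcal J$, $B\in L(\ell_p)$; closed means closed in operator norm. $\mathcal J^R$ is the smallest closed ideal of $L(\ell_p,\ell_q)$ containing $R$. $\mathcal J^{\ell_2}$ is the operator-norm closure of the set of all $S\in L(\ell_p,\ell_q)$ of the form $S=AB$ with $B\in L(\ell_p,\ell_2)$, $A\in L(\ell_2,\ell_q)$. An operator $S\colon X\to Y$ is finitely strictly singular (FSS) if for every $\varepsilon>0$ there is $n\in\mathbb N$ such that $\inf_{x\in E,\|x\|=1}\|Sx\|<\varepsilon$ for every $n$-dimensional subspace $E$ of $X$. *)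

theory Defs
  imports "HOL-Analysis.Analysis" "HOL-Library.Function_Algebras"
begin

text \<open>
  The scalar field is a type of sort \<open>{real_normed_field, euclidean_space}\<close>. Both
  \<^typ>\<open>real\<close> and \<^typ>\<open>complex\<close> are instances, and by Mazur's theorem they are the only ones up
  to isometric isomorphism of fields, so that everything below covers exactly the real
  and the complex case.
\<close>

section \<open>The sequence spaces\<close>

definition lp_space :: "real \<Rightarrow> (nat \<Rightarrow> 'k::{real_normed_field, euclidean_space}) set" where
  "lp_space p = {x. summable (\<lambda>n. norm (x n) powr p)}"

definition lp_norm :: "real \<Rightarrow> (nat \<Rightarrow> 'k::{real_normed_field, euclidean_space}) \<Rightarrow> real" where
  "lp_norm p x = (\<Sum>n. norm (x n) powr p) powr (1 / p)"

definition seq_scale :: "'k::{real_normed_field, euclidean_space} \<Rightarrow> (nat \<Rightarrow> 'k) \<Rightarrow> nat \<Rightarrow> 'k" where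
  "seq_scale c x = (\<lambda>n. c * x n)"

interpretation seq: vector_space seq_scale
  by unfold_locales (auto simp: seq_scale_def fun_eq_iff algebra_simps)

section \<open>Bounded operators\<close>

text \<open>
  An operator between sequence spaces is represented by a total function on sequences
  that vanishes outside its domain. This makes the representation unique, and
  pointwise operations and plain composition of functions are the operations on operators.
\<close>

definition lp_ops ::
    "real \<Rightarrow> real \<Rightarrow> ((nat \<Rightarrow> 'k::{real_normed_field, euclidean_space}) \<Rightarrow> nat \<Rightarrow> 'k) set" where
  "lp_ops p q = {T.
     (\<forall>x\<in>lp_space p. T x \<in> lp_space q) \<and>
     (\<forall>x. x \<notin> lp_space p \<longrightarrow> T x = 0) \<and>
     (\<forall>x\<in>lp_space p. \<forall>y\<in>lp_space p. T (x + y) = T x + T y) \<and>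
     (\<forall>c. \<forall>x\<in>lp_space p. T (seq_scale c x) = seq_scale c (T x)) \<and>
     (\<exists>C. \<forall>x\<in>lp_space p. lp_norm q (T x) \<le> C * lp_norm p x)}"

definition op_norm ::
    "real \<Rightarrow> real \<Rightarrow> ((nat \<Rightarrow> 'k::{real_normed_field, euclidean_space}) \<Rightarrow> nat \<Rightarrow> 'k) \<Rightarrow> real" where
  "op_norm p q T = (SUP x\<in>{x \<in> lp_space p. lp_norm p x \<le> 1}. lp_norm q (T x))"

definition op_scale ::
    "'k::{real_normed_field, euclidean_space} \<Rightarrow> ((nat \<Rightarrow> 'k) \<Rightarrow> nat \<Rightarrow> 'k) \<Rightarrow> (nat \<Rightarrow> 'k) \<Rightarrow> nat \<Rightarrow> 'k" where
  "op_scale c T = (\<lambda>x. seq_scale c (T x))"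

interpretation ops: vector_space op_scale
  by unfold_locales (auto simp: op_scale_def seq_scale_def fun_eq_iff algebra_simps)

definition op_closure ::
    "real \<Rightarrow> real \<Rightarrow> ((nat \<Rightarrow> 'k::{real_normed_field, euclidean_space}) \<Rightarrow> nat \<Rightarrow> 'k) set
      \<Rightarrow> ((nat \<Rightarrow> 'k) \<Rightarrow> nat \<Rightarrow> 'k) set" where
  "op_closure p q J = {T \<in> lp_ops p q. \<forall>e>0. \<exists>S\<in>J. op_norm p q (T - S) < e}"

text \<open>
  The dimension \<open>n\<close> is required to be positive: the infimum over the unit sphere of the zero
  space is not meaningful in \<^typ>\<open>real\<close> (conventionally it is infinite). Since \<open>seq.dim\<close> is
  \<open>0\<close> for infinite-dimensional spaces, \<open>E\<close> below is genuinely \<open>n\<close>-dimensional.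
\<close>

definition finitely_strictly_singular ::
    "real \<Rightarrow> real \<Rightarrow> ((nat \<Rightarrow> 'k::{real_normed_field, euclidean_space}) \<Rightarrow> nat \<Rightarrow> 'k) \<Rightarrow> bool" where
  "finitely_strictly_singular p q S \<longleftrightarrow>
     (\<forall>e>0. \<exists>n>0. \<forall>E. E \<subseteq> lp_space p \<and> seq.subspace E \<and> seq.dim E = n \<longrightarrow>
        (INF x\<in>{x \<in> E. lp_norm p x = 1}. lp_norm q (S x)) < e)"

section \<open>Ideals of operators\<close>

definition op_ideal ::
    "real \<Rightarrow> real \<Rightarrow> ((nat \<Rightarrow> 'k::{real_normed_field, euclidean_space}) \<Rightarrow> nat \<Rightarrow> 'k) set \<Rightarrow> bool" where
  "op_ideal p q J \<longleftrightarrow> J \<subseteq> lp_ops p q \<and> ops.subspace J \<and>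
     (\<forall>A\<in>lp_ops q q. \<forall>T\<in>J. \<forall>B\<in>lp_ops p p. A \<circ> T \<circ> B \<in> J)"

definition closed_op_ideal ::
    "real \<Rightarrow> real \<Rightarrow> ((nat \<Rightarrow> 'k::{real_normed_field, euclidean_space}) \<Rightarrow> nat \<Rightarrow> 'k) set \<Rightarrow> bool" where
  "closed_op_ideal p q J \<longleftrightarrow> op_ideal p q J \<and> op_closure p q J \<subseteq> J"

definition generated_ideal ::
    "real \<Rightarrow> real \<Rightarrow> ((nat \<Rightarrow> 'k::{real_normed_field, euclidean_space}) \<Rightarrow> nat \<Rightarrow> 'k)
      \<Rightarrow> ((nat \<Rightarrow> 'k) \<Rightarrow> nat \<Rightarrow> 'k) set" where
  "generated_ideal p q R = \<Inter>{J. closed_op_ideal p q J \<and> R \<in> J}"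

definition l2_ideal ::
    "real \<Rightarrow> real \<Rightarrow> ((nat \<Rightarrow> 'k::{real_normed_field, euclidean_space}) \<Rightarrow> nat \<Rightarrow> 'k) set" where
  "l2_ideal p q = op_closure p q {S \<in> lp_ops p q. \<exists>A\<in>lp_ops 2 q. \<exists>B\<in>lp_ops p 2. S = A \<circ> B}"

end

theory Submission imports Defs begin

text \<open>
  It suffices to show that every operator \<open>A \<circ> B\<close> through \<open>\<ell>\<^sub>2\<close> is a norm limit of operators
  \<open>U \<circ> R \<circ> V\<close> with \<open>V\<close> bounded on \<open>\<ell>\<^sub>p\<close> and \<open>U\<close> bounded on \<open>\<ell>\<^sub>q\<close>: a closed ideal that
  contains \<open>R\<close> then contains all such \<open>A \<circ> B\<close>, and hence their closure. There is a local and a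
  global step.

  Local step (\<open>Hilbert_copies\<close>). As \<open>R\<close> is not finitely strictly singular, there is a constant by
  which it is bounded below on spaces \<open>E\<close> of every finite dimension. The inverse of \<open>R\<close> on
  \<open>R(E)\<close> goes from a subspace of \<open>\<ell>\<^sub>q\<close>, which has type 2, to \<open>\<ell>\<^sub>p\<close>, which has cotype 2. By
  Maurey's extension theorem it factors through a Hilbert space by way of an operator that is defined
  on all of \<open>\<ell>\<^sub>q\<close>, with a constant independent of \<open>E\<close>. So the identity of \<open>\<ell>\<^sub>2\<^sup>M\<close> equals
  \<open>\<alpha> \<circ> R \<circ> \<beta>\<close> with norms bounded independently of \<open>M\<close>. In sequence spaces the extension is
  a change of weights (\<open>Maurey_weights\<close>). The Khintchine inequalities turn the lower bound into an inequality between
  square functions, which says that a certain convex set of nonnegative vectors stays away from \<open>0\<close> in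
  \<open>\<ell>\<^bsub>q/2\<^esub>\<close>; the supporting functional at its point of smallest norm is the weight
  (\<open>supporting_weights\<close>). Orthonormalisation in the weighted inner product yields \<open>\<alpha>\<close> and \<open>\<beta>\<close>.
  Intersecting \<open>E\<close> with a subspace of finite codimension and truncating places both of them
  on a finite interval of coordinates beyond any prescribed one.

  Global step (\<open>factorization_through_l2_approximation\<close>). Because \<open>1 < p\<close>, both the rows and the
  columns of the matrix of a bounded operator have small tails. So \<open>S = A \<circ> B\<close> agrees, up to a small
  error, with a sum of blocks \<open>Q\<^sub>i \<circ> A \<circ> B \<circ> P\<^sub>i\<close>, where the \<open>P\<^sub>i\<close> project onto consecutive
  intervals and \<open>Q\<^sub>i\<close> onto the interval of \<open>P\<^sub>i\<close> together with its two neighbours. Up to a small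
  error, \<open>B \<circ> P\<^sub>i\<close> takes values in some \<open>\<ell>\<^sub>2\<^sup>M\<close>, where the identity may be replaced by
  \<open>\<alpha>\<^sub>i \<circ> R \<circ> \<beta>\<^sub>i\<close>. With \<open>V = \<Sum> \<beta>\<^sub>i \<circ> B \<circ> P\<^sub>i\<close> and \<open>U = \<Sum> Q\<^sub>i \<circ> A \<circ> \<alpha>\<^sub>i\<close> the diagonal part of
  \<open>U \<circ> R \<circ> V\<close> is the wanted sum, and the off-diagonal part is small if the copies are placed
  sufficiently far apart. These sums are bounded since their blocks live on disjoint
  intervals on one side and on intervals with at most threefold overlap on the other.
\<close>

section \<open>Convexity of powers\<close>

lemma powr_convex_comb:
  fixes x y r t :: real
  assumes "1 \<le> r" "0 \<le> x" "0 \<le> y" "0 \<le> t" "t \<le> 1"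
  shows "((1 - t) * x + t * y) powr r \<le> (1 - t) * x powr r + t * y powr r"
proof -
  have scale: "(s * z) powr r \<le> s * z powr r" if "0 \<le> s" "s \<le> 1" "0 \<le> z" for s z :: real
  proof (cases "s = 0")
    case False
    have "s powr r \<le> s powr 1"
      using that False assms by (intro powr_mono') auto
    then show ?thesis
      using that by (simp add: powr_mult mult_right_mono)
  qed auto
  consider "x = 0" | "y = 0" | "x > 0" "y > 0"
    using assms by linarith
  then show ?thesis
  proof cases
    case 3
    then show ?thesis
      using convex_onD[OF powr_convex[OF \<open>1 \<le> r\<close>], of t x y] assms by simp
  next
    case 1
    then show ?thesis
      using scale[of t y] assms by simp
  next
    case 2
    then show ?thesis
      using scale[of "1 - t" x] assms by simp
  qed
qed

text \<open>
  The inverse of a convex power is a concave one.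
\<close>

lemma powr_concave_comb:
  fixes x y s t :: real
  assumes "0 < s" "s \<le> 1" "0 \<le> x" "0 \<le> y" "0 \<le> t" "t \<le> 1"
  shows "(1 - t) * x powr s + t * y powr s \<le> ((1 - t) * x + t * y) powr s"
proof -
  let ?m = "(1 - t) * x powr s + t * y powr s"
  have "?m powr (1 / s) \<le> (1 - t) * x + t * y"
    using powr_convex_comb[of "1 / s" "x powr s" "y powr s" t] assms
    by (simp only: powr_powr) simp
  then have "(?m powr (1 / s)) powr s \<le> ((1 - t) * x + t * y) powr s"
    using assms by (intro powr_mono2) auto
  moreover have "0 \<le> ?m"
    using assms by simp
  then have "(?m powr (1 / s)) powr s = ?m"
    using assms(1) by (simp only: powr_powr) simp
  ultimately show ?thesis
    by (simp only:)
qed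

lemma powr_le_powr_iff:
  fixes a b p :: real
  assumes "0 < p" "0 \<le> a" "0 \<le> b"
  shows "a powr p \<le> b powr p \<longleftrightarrow> a \<le> b"
  using assms powr_mono2[of p a b] powr_less_mono2[of p b a] by linarith

section \<open>The sequence spaces\<close>

lemma lp_norm_nonneg [simp]: "0 \<le> lp_norm p x"
  by (simp add: lp_norm_def)

lemma lp_norm_powr:
  assumes "0 < p" "x \<in> lp_space p"
  shows "lp_norm p x powr p = (\<Sum>n. norm (x n) powr p)"
proof -
  have "0 \<le> (\<Sum>n. norm (x n) powr p)"
    using assms by (intro suminf_nonneg) (auto simp: lp_space_def)
  then show ?thesis
    using assms by (simp add: lp_norm_def powr_powr)
qed

lemma lp_sum_le:
  assumes "0 < p" "x \<in> lp_space p" "finite F"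
  shows "(\<Sum>i\<in>F. norm (x i) powr p) \<le> lp_norm p x powr p"
  using assms by (auto simp: lp_norm_powr lp_space_def intro!: sum_le_suminf)

lemma lp_norm_component_le:
  assumes "0 < p" "x \<in> lp_space p"
  shows "norm (x i) \<le> lp_norm p x"
  using lp_sum_le[OF assms, of "{i}"] assms(1) by (simp add: powr_le_powr_iff)

text \<open>
  This is how membership in \<open>\<ell>\<^sub>p\<close> and norm bounds are obtained below: all estimates are made for
  finite partial sums.
\<close>

lemma lp_bounded_sums:
  assumes "0 < p" "0 \<le> c" "\<And>n. (\<Sum>i<n. norm (x i) powr p) \<le> c powr p"
  shows "x \<in> lp_space p" "lp_norm p x \<le> c"
proof -
  show x: "x \<in> lp_space p"
    unfolding lp_space_def mem_Collect_eq
    by (rule bounded_imp_summable[where B="c powr p"])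
       (use assms(3)[of "Suc _"] in \<open>auto simp: lessThan_Suc_atMost\<close>)
  then have "lp_norm p x powr p \<le> c powr p"
    using assms by (auto simp: lp_norm_powr lp_space_def intro!: suminf_le_const)
  then show "lp_norm p x \<le> c"
    using assms by (simp add: powr_le_powr_iff)
qed

lemma lp_zero [simp]: "0 \<in> lp_space p" "lp_norm p 0 = 0"
  by (auto simp: lp_space_def lp_norm_def)

lemma lp_norm_eq_0:
  assumes "0 < p" "x \<in> lp_space p" "lp_norm p x = 0"
  shows "x = 0"
  using lp_norm_component_le[OF assms(1,2)] assms(3) by (auto simp: fun_eq_iff)

lemma lp_scale:
  assumes "0 < p" "x \<in> lp_space p"
  shows "seq_scale c x \<in> lp_space p" "lp_norm p (seq_scale c x) = norm c * lp_norm p x"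
proof -
  have s: "summable (\<lambda>n. norm (x n) powr p)"
    using assms by (simp add: lp_space_def)
  then show "seq_scale c x \<in> lp_space p"
    by (simp add: lp_space_def seq_scale_def norm_mult powr_mult summable_mult)
  have "(\<Sum>n. norm (seq_scale c x n) powr p) = norm c powr p * (\<Sum>n. norm (x n) powr p)"
    using s by (simp add: seq_scale_def norm_mult powr_mult suminf_mult)
  moreover have "0 \<le> (\<Sum>n. norm (x n) powr p)"
    using s by (intro suminf_nonneg) auto
  ultimately show "lp_norm p (seq_scale c x) = norm c * lp_norm p x"
    using assms by (simp add: lp_norm_def powr_mult powr_powr)
qed

text \<open>
  Convexity of the power function, applied to the convex combination
  \<open>(a / (a + b)) (u / a) + (b / (a + b)) (v / b)\<close>, gives the triangle inequality for the bounds
  \<open>a\<close> and \<open>b\<close>.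
\<close>

lemma Minkowski_sum:
  fixes u v :: "nat \<Rightarrow> real"
  assumes "1 \<le> p" "0 < a" "0 < b" "\<And>i. 0 \<le> u i" "\<And>i. 0 \<le> v i"
    and "(\<Sum>i\<in>F. u i powr p) \<le> a powr p" "(\<Sum>i\<in>F. v i powr p) \<le> b powr p"
  shows "(\<Sum>i\<in>F. (u i + v i) powr p) \<le> (a + b) powr p"
proof -
  define t where "t = b / (a + b)"
  have t: "0 \<le> t" "t \<le> 1" "1 - t = a / (a + b)"
    using assms by (auto simp: t_def field_simps)
  have "(u i + v i) powr p \<le> (a + b) powr p * ((1 - t) * (u i powr p / a powr p) + t * (v i powr p / b powr p))"
    for i
  proof -
    have "u i + v i = (a + b) * ((1 - t) * (u i / a) + t * (v i / b))"
    proof -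
      have "(a + b) * (1 - t) = a" "(a + b) * t = b"
        using assms(2,3) unfolding t(3) by (auto simp: t_def)
      then have "(a + b) * ((1 - t) * (u i / a) + t * (v i / b)) = a * (u i / a) + b * (v i / b)"
        by (simp only: distrib_left mult.assoc[symmetric])
      then show ?thesis
        using assms(2,3) by simp
    qed
    then have "(u i + v i) powr p = (a + b) powr p * ((1 - t) * (u i / a) + t * (v i / b)) powr p"
      using assms t by (simp add: powr_mult)
    also have "\<dots> \<le> (a + b) powr p * ((1 - t) * (u i / a) powr p + t * (v i / b) powr p)"
      using assms t by (intro mult_left_mono powr_convex_comb) auto
    finally show ?thesis
      using assms by (simp add: powr_divide)
  qed
  then have "(\<Sum>i\<in>F. (u i + v i) powr p) \<le>
      (\<Sum>i\<in>F. (a + b) powr p * ((1 - t) * (u i powr p / a powr p) + t * (v i powr p / b powr p)))"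
    by (intro sum_mono)
  also have "\<dots> = (a + b) powr p * ((1 - t) * ((\<Sum>i\<in>F. u i powr p) / a powr p)
      + t * ((\<Sum>i\<in>F. v i powr p) / b powr p))"
    by (simp add: sum_distrib_left sum.distrib sum_divide_distrib distrib_left)
  also have "\<dots> \<le> (a + b) powr p * ((1 - t) * 1 + t * 1)"
    using assms t by (intro mult_left_mono add_mono) auto
  finally show ?thesis by simp
qed

lemma lp_add:
  assumes "1 \<le> p" "x \<in> lp_space p" "y \<in> lp_space p"
  shows "x + y \<in> lp_space p" "lp_norm p (x + y) \<le> lp_norm p x + lp_norm p y"
proof -
  have p: "0 < p" using assms by simp
  consider "x = 0" | "y = 0" | "0 < lp_norm p x" "0 < lp_norm p y"
    using lp_norm_eq_0[OF p] assms lp_norm_nonneg by (metis order_le_less)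
  then have "x + y \<in> lp_space p \<and> lp_norm p (x + y) \<le> lp_norm p x + lp_norm p y"
  proof cases
    case 3
    have "(\<Sum>i<n. norm ((x + y) i) powr p) \<le> (lp_norm p x + lp_norm p y) powr p" for n
    proof -
      have "(\<Sum>i<n. norm ((x + y) i) powr p) \<le> (\<Sum>i<n. (norm (x i) + norm (y i)) powr p)"
        using p by (intro sum_mono powr_mono2) (auto simp: norm_triangle_ineq)
      also have "\<dots> \<le> (lp_norm p x + lp_norm p y) powr p"
        using 3 assms p by (intro Minkowski_sum lp_sum_le) auto
      finally show ?thesis .
    qed
    with 3 p show ?thesis
      using lp_bounded_sums[of p "lp_norm p x + lp_norm p y" "x + y"] by auto
  qed (use assms in auto)
  then show "x + y \<in> lp_space p" "lp_norm p (x + y) \<le> lp_norm p x + lp_norm p y"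
    by auto
qed

lemma minus_eq_seq_scale: "x - y = x + seq_scale (-1) y"
  by (simp add: fun_eq_iff seq_scale_def)

lemma lp_diff:
  assumes "1 \<le> p" "x \<in> lp_space p" "y \<in> lp_space p"
  shows "x - y \<in> lp_space p" "lp_norm p (x - y) \<le> lp_norm p x + lp_norm p y"
proof -
  have y: "seq_scale (-1) y \<in> lp_space p" "lp_norm p (seq_scale (-1) y) = lp_norm p y"
    using lp_scale[of p y "-1"] assms by auto
  show "x - y \<in> lp_space p" "lp_norm p (x - y) \<le> lp_norm p x + lp_norm p y"
    unfolding minus_eq_seq_scale using lp_add[OF assms(1,2) y(1)] unfolding y(2) by auto
qed

lemma lp_sum:
  assumes "1 \<le> p" "\<And>i. i \<in> A \<Longrightarrow> x i \<in> lp_space p"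
  shows "sum x A \<in> lp_space p \<and> lp_norm p (sum x A) \<le> (\<Sum>i\<in>A. lp_norm p (x i))"
  using assms(2)
proof (induction A rule: infinite_finite_induct)
  case (insert a A)
  then have IH: "sum x A \<in> lp_space p" "lp_norm p (sum x A) \<le> (\<Sum>i\<in>A. lp_norm p (x i))"
    and a: "x a \<in> lp_space p"
    by auto
  have e: "sum x (insert a A) = x a + sum x A"
    "(\<Sum>i\<in>insert a A. lp_norm p (x i)) = lp_norm p (x a) + (\<Sum>i\<in>A. lp_norm p (x i))"
    using insert.hyps by (rule sum.insert)+
  show ?case
    unfolding e using lp_add[OF assms(1) a IH(1)] IH(2) by (intro conjI) linarith+
next
  case (infinite A)
  show ?case
    unfolding sum.infinite[OF infinite(1)] by (simp only: lp_zero) simp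
next
  case empty
  show ?case
    unfolding sum.empty by (simp only: lp_zero) simp
qed

lemma sum_fun_apply: "sum f A i = (\<Sum>a\<in>A. f a i)"
  by (induction A rule: infinite_finite_induct) auto

definition cut :: "nat set \<Rightarrow> (nat \<Rightarrow> 'k::zero) \<Rightarrow> nat \<Rightarrow> 'k" where
  "cut A x = (\<lambda>n. if n \<in> A then x n else 0)"

lemma cut_linear [simp]:
  fixes x y :: "nat \<Rightarrow> 'k::{real_normed_field, euclidean_space}"
  shows "cut A (x + y) = cut A x + cut A y"
    and "cut A (x - y) = cut A x - cut A y"
    and "cut A (seq_scale c x) = seq_scale c (cut A x)"
    and "cut A (0 :: nat \<Rightarrow> 'k) = 0"
  by (auto simp: cut_def fun_eq_iff seq_scale_def)

lemma cut_sum: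
  fixes x :: "'i \<Rightarrow> nat \<Rightarrow> 'k::{real_normed_field, euclidean_space}"
  shows "cut A (sum x I) = (\<Sum>i\<in>I. cut A (x i))"
  by (simp add: cut_def fun_eq_iff sum_fun_apply)

lemma cut_cut [simp]: "cut A (cut B x) = cut (A \<inter> B) x"
  by (auto simp: cut_def)

lemma norm_le_lp:
  assumes "0 < p" "y \<in> lp_space p" "\<And>i. norm (x i) \<le> norm (y i)"
  shows "x \<in> lp_space p" "lp_norm p x \<le> lp_norm p y"
proof -
  have *: "(\<Sum>i<n. norm (x i) powr p) \<le> lp_norm p y powr p" for n
  proof -
    have "(\<Sum>i<n. norm (x i) powr p) \<le> (\<Sum>i<n. norm (y i) powr p)"
      using assms by (intro sum_mono powr_mono2) auto
    also have "\<dots> \<le> lp_norm p y powr p"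
      using assms by (intro lp_sum_le) auto
    finally show ?thesis .
  qed
  show "x \<in> lp_space p" "lp_norm p x \<le> lp_norm p y"
    using lp_bounded_sums[OF assms(1) lp_norm_nonneg *] by auto
qed

lemma lp_cut:
  assumes "0 < p" "x \<in> lp_space p"
  shows "cut A x \<in> lp_space p" "lp_norm p (cut A x) \<le> lp_norm p x"
  using norm_le_lp[OF assms, of "cut A x"] by (auto simp: cut_def)

lemma lp_cut_mono:
  assumes "0 < p" "x \<in> lp_space p" "A \<subseteq> B"
  shows "lp_norm p (cut A x) \<le> lp_norm p (cut B x)"
  using lp_cut(2)[OF assms(1) lp_cut(1)[OF assms(1,2), of B], of A] assms(3)
  by (simp add: Int_absorb2)

lemma lp_finite_support:
  assumes "0 < p" "finite A" "\<And>i. i \<notin> A \<Longrightarrow> x i = 0"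
  shows "x \<in> lp_space p" "lp_norm p x powr p = (\<Sum>i\<in>A. norm (x i) powr p)"
proof -
  show "x \<in> lp_space p"
    unfolding lp_space_def mem_Collect_eq
    using assms by (intro summable_finite[of A]) auto
  then show "lp_norm p x powr p = (\<Sum>i\<in>A. norm (x i) powr p)"
    using assms by (simp add: lp_norm_powr suminf_finite[of A])
qed

lemma lp_cut_finite:
  assumes "0 < p" "finite A"
  shows "cut A x \<in> lp_space p" "lp_norm p (cut A x) powr p = (\<Sum>i\<in>A. norm (x i) powr p)"
  using lp_finite_support[OF assms, of "cut A x"] by (auto simp: cut_def)

lemma lp_tail_tendsto_0:
  assumes "0 < p" "x \<in> lp_space p"
  shows "(\<lambda>n. lp_norm p (cut {n..} x)) \<longlonglongrightarrow> 0"
proof -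
  have s: "summable (\<lambda>n. norm (x n) powr p)"
    using assms by (simp add: lp_space_def)
  have "lp_norm p (cut {n..} x) = (\<Sum>i. norm (x (i + n)) powr p) powr (1 / p)" for n
  proof -
    have "cut {n..} x \<in> lp_space p"
      using assms by (rule lp_cut)
    then have "(\<Sum>i. norm (cut {n..} x i) powr p) =
        (\<Sum>i. norm (cut {n..} x (i + n)) powr p) + (\<Sum>i<n. norm (cut {n..} x i) powr p)"
      by (intro suminf_split_initial_segment) (simp add: lp_space_def)
    then show ?thesis
      by (simp add: lp_norm_def cut_def)
  qed
  moreover have "(\<lambda>n. (\<Sum>i. norm (x (i + n)) powr p) powr (1 / p)) \<longlonglongrightarrow> 0 powr (1 / p)"
    using assms s by (intro tendsto_powr2 tendsto_const suminf_exist_split2 always_eventually)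
       (auto intro!: suminf_nonneg simp: summable_iff_shift[of "\<lambda>n. norm (x n) powr p"])
  ultimately show ?thesis by simp
qed

text \<open>
  Fatou for sequences: every finite partial sum passes to the limit.
\<close>

lemma lp_norm_pointwise_limit:
  assumes "0 < p" "0 \<le> D" "\<And>k. y k \<in> lp_space p" "\<And>k. lp_norm p (y k) \<le> D"
    and "\<And>i. (\<lambda>k. y k i) \<longlonglongrightarrow> z i"
  shows "z \<in> lp_space p" "lp_norm p z \<le> D"
proof -
  have *: "(\<Sum>i<n. norm (z i) powr p) \<le> D powr p" for n
  proof (rule LIMSEQ_le_const2)
    show "(\<lambda>k. \<Sum>i<n. norm (y k i) powr p) \<longlonglongrightarrow> (\<Sum>i<n. norm (z i) powr p)"
      using assms by (intro tendsto_sum tendsto_powr2 tendsto_norm tendsto_const always_eventually) auto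
    have "(\<Sum>i<n. norm (y k i) powr p) \<le> D powr p" for k
      using lp_sum_le[OF assms(1) assms(3), of "{..<n}" k]
        powr_mono2[OF _ lp_norm_nonneg assms(4)[of k], of p] assms(1) by simp
    then show "\<exists>N. \<forall>k\<ge>N. (\<Sum>i<n. norm (y k i) powr p) \<le> D powr p"
      by blast
  qed
  show "z \<in> lp_space p" "lp_norm p z \<le> D"
    using lp_bounded_sums[OF assms(1,2) *] by auto
qed

section \<open>Bounded operators between the sequence spaces\<close>

lemma lp_opsI:
  assumes "\<And>x. x \<in> lp_space p \<Longrightarrow> T x \<in> lp_space q"
    and "\<And>x. x \<notin> lp_space p \<Longrightarrow> T x = 0"
    and "\<And>x y. x \<in> lp_space p \<Longrightarrow> y \<in> lp_space p \<Longrightarrow> T (x + y) = T x + T y"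
    and "\<And>c x. x \<in> lp_space p \<Longrightarrow> T (seq_scale c x) = seq_scale c (T x)"
    and "\<And>x. x \<in> lp_space p \<Longrightarrow> lp_norm q (T x) \<le> C * lp_norm p x"
  shows "T \<in> lp_ops p q"
  using assms unfolding lp_ops_def by blast

lemma lp_opsD:
  assumes "T \<in> lp_ops p q"
  shows "x \<in> lp_space p \<Longrightarrow> T x \<in> lp_space q"
    and "x \<notin> lp_space p \<Longrightarrow> T x = 0"
    and "x \<in> lp_space p \<Longrightarrow> y \<in> lp_space p \<Longrightarrow> T (x + y) = T x + T y"
    and "x \<in> lp_space p \<Longrightarrow> T (seq_scale c x) = seq_scale c (T x)"
  using assms unfolding lp_ops_def by blast+

lemma lp_ops_bound:
  assumes "T \<in> lp_ops p q"
  obtains C where "0 < C" "\<And>x. x \<in> lp_space p \<Longrightarrow> lp_norm q (T x) \<le> C * lp_norm p x"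
proof -
  obtain C where C: "\<And>x. x \<in> lp_space p \<Longrightarrow> lp_norm q (T x) \<le> C * lp_norm p x"
    using assms unfolding lp_ops_def by blast
  show ?thesis
  proof (rule that[of "max C 1"])
    show "lp_norm q (T x) \<le> max C 1 * lp_norm p x" if "x \<in> lp_space p" for x
      using C[OF that] mult_right_mono[of C "max C 1" "lp_norm p x"] by simp
  qed simp
qed

lemma lp_ops_diff:
  assumes "T \<in> lp_ops p q" "1 \<le> p" "x \<in> lp_space p" "y \<in> lp_space p"
  shows "T (x - y) = T x - T y"
proof -
  have y: "seq_scale (-1) y \<in> lp_space p"
    using lp_scale[of p y "-1"] assms by auto
  show ?thesis
    unfolding minus_eq_seq_scale
    using lp_opsD(3)[OF assms(1,3) y] lp_opsD(4)[OF assms(1,4), of "-1"] by metis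
qed

lemma lp_ops_zero:
  assumes "T \<in> lp_ops p q"
  shows "T 0 = 0"
  using lp_opsD(4)[OF assms lp_zero(1), of 0] by (simp add: seq_scale_def zero_fun_def)

lemma lp_ops_sum:
  assumes "T \<in> lp_ops p q" "1 \<le> p" "\<And>i. i \<in> A \<Longrightarrow> x i \<in> lp_space p"
  shows "T (sum x A) = (\<Sum>i\<in>A. T (x i))"
  using assms(3)
proof (induction A rule: infinite_finite_induct)
  case (insert a A)
  have "sum x A \<in> lp_space p"
    using lp_sum[OF assms(2)] insert.prems by blast
  then have "T (x a + sum x A) = T (x a) + T (sum x A)"
    using insert.prems by (intro lp_opsD(3)[OF assms(1)]) auto
  moreover have "T (sum x A) = (\<Sum>i\<in>A. T (x i))"
    using insert by blast
  ultimately show ?case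
    unfolding sum.insert[OF insert.hyps] by (rule trans[OF _ arg_cong])
next
  case empty
  show ?case
    unfolding sum.empty by (rule lp_ops_zero[OF assms(1)])
next
  case (infinite A)
  show ?case
    unfolding sum.infinite[OF infinite(1)] by (rule lp_ops_zero[OF assms(1)])
qed

lemma lp_ops_comp:
  assumes "S \<in> lp_ops q r" "T \<in> lp_ops p q"
  shows "S \<circ> T \<in> lp_ops p r"
proof -
  obtain C where C: "0 < C" "\<And>x. x \<in> lp_space q \<Longrightarrow> lp_norm r (S x) \<le> C * lp_norm q x"
    using lp_ops_bound[OF assms(1)] by blast
  obtain D where D: "\<And>x. x \<in> lp_space p \<Longrightarrow> lp_norm q (T x) \<le> D * lp_norm p x"
    using lp_ops_bound[OF assms(2)] by blast
  show ?thesis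
  proof (rule lp_opsI[where C="C * D"])
    fix x :: "nat \<Rightarrow> 'a" assume x: "x \<in> lp_space p"
    have "lp_norm r (S (T x)) \<le> C * lp_norm q (T x)"
      using C(2) lp_opsD(1)[OF assms(2) x] by blast
    also have "\<dots> \<le> C * (D * lp_norm p x)"
      using C(1) D[OF x] by (intro mult_left_mono) auto
    finally show "lp_norm r ((S \<circ> T) x) \<le> C * D * lp_norm p x"
      by simp
  qed (use lp_opsD[OF assms(1)] lp_opsD[OF assms(2)] lp_ops_zero[OF assms(1)] in auto)
qed

lemma op_norm_le:
  assumes "0 \<le> c" "\<And>x. x \<in> lp_space p \<Longrightarrow> lp_norm q (T x) \<le> c * lp_norm p x"
  shows "op_norm p q T \<le> c"
  unfolding op_norm_def
proof (rule cSUP_least)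
  show "{x \<in> lp_space p. lp_norm p x \<le> 1} \<noteq> {}"
    using lp_zero[of p] by (metis (mono_tags, lifting) empty_iff mem_Collect_eq zero_le_one)
  show "lp_norm q (T x) \<le> c" if "x \<in> {x \<in> lp_space p. lp_norm p x \<le> 1}" for x
    using assms(2)[of x] that mult_left_mono[of "lp_norm p x" 1 c] assms(1) by simp
qed

lemma cut_split:
  fixes x :: "nat \<Rightarrow> 'k::{real_normed_field, euclidean_space}"
  assumes "A \<inter> B = {}"
  shows "cut (A \<union> B) x = cut A x + cut B x"
  using assms by (auto simp: cut_def fun_eq_iff)

lemma cut_UNIV: "cut UNIV x = x"
  by (simp add: cut_def)

lemma lessThan_Un_atLeast: "{..<n} \<union> {n..} = (UNIV :: nat set)" "{..<n} \<inter> {n..} = ({} :: nat set)"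
  by auto

lemma cut_lessThan_atLeast:
  fixes x :: "nat \<Rightarrow> 'k::{real_normed_field, euclidean_space}"
  shows "x = cut {..<n} x + cut {n..} x"
  using cut_split[of "{..<n}" "{n..}" x] by (simp add: lessThan_Un_atLeast cut_UNIV)

text \<open>
  Finitely supported sequences are dense, so an estimate for them carries over by continuity.
\<close>

lemma lp_ops_dense_bound:
  assumes T: "T \<in> lp_ops p q" and "1 \<le> p" "1 \<le> q" "0 \<le> c"
    and fin: "\<And>x n. x \<in> lp_space p \<Longrightarrow> lp_norm q (T (cut {..<n} x)) \<le> c * lp_norm p x"
    and x: "x \<in> lp_space p"
  shows "lp_norm q (T x) \<le> c * lp_norm p x"
proof -
  obtain C where C: "0 < C" "\<And>x. x \<in> lp_space p \<Longrightarrow> lp_norm q (T x) \<le> C * lp_norm p x"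
    using lp_ops_bound[OF T] by blast
  have p: "0 < p" using assms by simp
  have "lp_norm q (T x) \<le> c * lp_norm p x + C * lp_norm p (cut {n..} x)" for n
  proof -
    have l: "cut {..<n} x \<in> lp_space p" "cut {n..} x \<in> lp_space p"
      using lp_cut(1)[OF p x] by auto
    have "T x = T (cut {..<n} x) + T (cut {n..} x)"
      using lp_opsD(3)[OF T l] cut_lessThan_atLeast[of x n] by simp
    then have "lp_norm q (T x) \<le> lp_norm q (T (cut {..<n} x)) + lp_norm q (T (cut {n..} x))"
      using lp_add(2)[OF \<open>1 \<le> q\<close> lp_opsD(1)[OF T l(1)] lp_opsD(1)[OF T l(2)]] by simp
    then show ?thesis
      using fin[OF x, of n] C(2)[OF l(2)] by linarith
  qed
  moreover have "(\<lambda>n. c * lp_norm p x + C * lp_norm p (cut {n..} x)) \<longlonglongrightarrow> c * lp_norm p x + C * 0"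
    by (intro tendsto_intros lp_tail_tendsto_0 p x)
  ultimately show ?thesis
    by (intro LIMSEQ_le_const[of "\<lambda>n. c * lp_norm p x + C * lp_norm p (cut {n..} x)"]) auto
qed

definition unit_seq :: "nat \<Rightarrow> nat \<Rightarrow> 'k::{real_normed_field, euclidean_space}" where
  "unit_seq i = (\<lambda>n. if n = i then 1 else 0)"

lemma unit_seq_lp [simp]: "0 < p \<Longrightarrow> unit_seq i \<in> lp_space p"
  by (rule lp_finite_support(1)[of p "{i}"]) (auto simp: unit_seq_def)

lemma cut_eq_sum:
  assumes "finite A"
  shows "cut A x = (\<Sum>i\<in>A. seq_scale (x i) (unit_seq i))"
  using assms by (auto simp: fun_eq_iff sum_fun_apply cut_def seq_scale_def unit_seq_def if_distrib
      cong: if_cong)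

lemma lp_ops_cut:
  assumes "T \<in> lp_ops p q" "1 \<le> p" "finite A"
  shows "T (cut A x) = (\<Sum>i\<in>A. seq_scale (x i) (T (unit_seq i)))"
proof -
  have u: "unit_seq i \<in> lp_space p" for i
    using assms by simp
  then show ?thesis
    unfolding cut_eq_sum[OF assms(3)]
    using assms lp_scale(1)[OF _ u] lp_opsD(4)[OF assms(1) u]
    by (subst lp_ops_sum[OF assms(1,2)]) auto
qed

text \<open>
  On finitely many coordinates \<open>T\<close> is determined by finitely many columns, each of which has a
  small tail in \<open>\<ell>\<^sub>q\<close>.
\<close>

lemma column_tail_small:
  assumes T: "T \<in> lp_ops p q" and "1 \<le> p" "1 \<le> q" "0 < e"
  shows "\<exists>m. \<forall>m'\<ge>m. \<forall>x\<in>lp_space p. lp_norm q (cut {m'..} (T (cut {..<n} x))) \<le> e * lp_norm p x"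
proof -
  have pq: "0 < p" "0 < q" using assms by auto
  have Tu: "T (unit_seq i) \<in> lp_space q" for i
    using lp_opsD(1)[OF T] pq by simp
  have "(\<lambda>m. \<Sum>i<n. lp_norm q (cut {m..} (T (unit_seq i)))) \<longlonglongrightarrow> (\<Sum>i<n. 0)"
    by (intro tendsto_sum lp_tail_tendsto_0 pq Tu)
  then have "eventually (\<lambda>m. (\<Sum>i<n. lp_norm q (cut {m..} (T (unit_seq i)))) < e) sequentially"
    using \<open>0 < e\<close> by (intro order_tendstoD(2)[of _ 0]) auto
  then obtain m where m: "\<And>m'. m' \<ge> m \<Longrightarrow> (\<Sum>i<n. lp_norm q (cut {m'..} (T (unit_seq i)))) < e"
    unfolding eventually_sequentially by blast
  have "lp_norm q (cut {m'..} (T (cut {..<n} x))) \<le> e * lp_norm p x"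
    if "m' \<ge> m" "x \<in> lp_space p" for m' x
  proof -
    have l: "seq_scale (x i) (cut {m'..} (T (unit_seq i))) \<in> lp_space q"
      "lp_norm q (seq_scale (x i) (cut {m'..} (T (unit_seq i)))) = norm (x i) * lp_norm q (cut {m'..} (T (unit_seq i)))"
      for i
      using lp_scale[OF pq(2) lp_cut(1)[OF pq(2) Tu]] by auto
    have "cut {m'..} (T (cut {..<n} x)) = (\<Sum>i<n. seq_scale (x i) (cut {m'..} (T (unit_seq i))))"
      using lp_ops_cut[OF T \<open>1 \<le> p\<close>, of "{..<n}" x] by (simp add: cut_sum)
    then have "lp_norm q (cut {m'..} (T (cut {..<n} x))) \<le>
        (\<Sum>i<n. norm (x i) * lp_norm q (cut {m'..} (T (unit_seq i))))"
      using lp_sum[OF \<open>1 \<le> q\<close>, of "{..<n}" "\<lambda>i. seq_scale (x i) (cut {m'..} (T (unit_seq i)))"] l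
      by simp
    also have "\<dots> \<le> (\<Sum>i<n. lp_norm p x * lp_norm q (cut {m'..} (T (unit_seq i))))"
      using lp_norm_component_le[OF pq(1) that(2)] by (intro sum_mono mult_right_mono) auto
    also have "\<dots> = lp_norm p x * (\<Sum>i<n. lp_norm q (cut {m'..} (T (unit_seq i))))"
      by (simp add: sum_distrib_left)
    also have "\<dots> \<le> lp_norm p x * e"
      using m[OF that(1)] by (intro mult_left_mono) auto
    finally show ?thesis by (simp add: mult.commute)
  qed
  then show ?thesis by blast
qed

lemma Holder_sum:
  fixes f x :: "nat \<Rightarrow> 'k::real_normed_field"
  assumes "1 < p" "1 / p + 1 / p' = 1" "1 < p'" "0 < e" "0 \<le> c"
    and "(\<Sum>i\<in>F. norm (f i) powr p') \<le> e powr p'" "(\<Sum>i\<in>F. norm (x i) powr p) \<le> c powr p" "finite F"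
  shows "norm (\<Sum>i\<in>F. x i * f i) \<le> e * c"
proof (cases "c = 0")
  case True
  then have "(\<Sum>i\<in>F. norm (x i) powr p) = 0"
    using assms by (simp add: sum_nonneg order_antisym)
  then have "\<forall>i\<in>F. x i = 0"
    using \<open>finite F\<close> by (subst (asm) sum_nonneg_eq_0_iff) auto
  then show ?thesis
    using True by simp
next
  case False
  then have c: "0 < c" using assms by simp
  have "norm (x i * f i) \<le> e * c * ((norm (f i) powr p' / e powr p') / p' + (norm (x i) powr p / c powr p) / p)" for i
  proof -
    have "norm (f i) / e * (norm (x i) / c) \<le> (norm (f i) / e) powr p' / p' + (norm (x i) / c) powr p / p"
      using assms c by (intro Youngs_inequality) auto
    then have "(e * c) * (norm (f i) / e * (norm (x i) / c)) \<le>
        (e * c) * ((norm (f i) powr p' / e powr p') / p' + (norm (x i) powr p / c powr p) / p)"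
      using assms c by (intro mult_left_mono) (auto simp: powr_divide)
    then show ?thesis
      using assms c by (simp add: norm_mult mult.commute)
  qed
  then have "(\<Sum>i\<in>F. norm (x i * f i)) \<le>
      (\<Sum>i\<in>F. e * c * ((norm (f i) powr p' / e powr p') / p' + (norm (x i) powr p / c powr p) / p))"
    by (intro sum_mono)
  also have "\<dots> = e * c * ((\<Sum>i\<in>F. norm (f i) powr p') / e powr p' / p' + (\<Sum>i\<in>F. norm (x i) powr p) / c powr p / p)"
    by (simp only: sum_distrib_left[symmetric] sum.distrib sum_divide_distrib[symmetric])
  also have "\<dots> \<le> e * c * (1 / p' + 1 / p)"
    using assms c by (intro mult_left_mono add_mono divide_right_mono) auto
  finally have "(\<Sum>i\<in>F. norm (x i * f i)) \<le> e * c"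
    using assms by (simp add: add.commute)
  then show ?thesis
    using norm_sum[of "\<lambda>i. x i * f i" F] by linarith
qed

text \<open>
  Half of the duality between \<open>\<ell>\<^sub>p\<close> and its conjugate space: testing a coordinate functional on
  the sequence that is extremal in Hoelder's inequality bounds its coefficients.
\<close>

lemma functional_coefficients_summable:
  assumes T: "T \<in> lp_ops p q" and "1 < p" "0 < q" and p': "1 / p + 1 / p' = 1"
  shows "summable (\<lambda>i. norm (T (unit_seq i) l) powr p')"
proof -
  have p: "0 < p" "1 \<le> p" using assms by auto
  have p'1: "1 < p'"
  proof -
    have "1 / p < 1" "0 < 1 / p" using \<open>1 < p\<close> by auto
    then have "0 < 1 / p'" "1 / p' < 1" using p' by linarith+
    then show ?thesis by (simp add: divide_less_eq split: if_splits)
  qed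
  have pp: "(p' - 1) * p = p'"
  proof -
    have "p + p' = p * p'" using p' p p'1 by (simp add: field_simps)
    then show ?thesis by (simp add: algebra_simps)
  qed
  obtain C where C: "0 < C" "\<And>x. x \<in> lp_space p \<Longrightarrow> lp_norm q (T x) \<le> C * lp_norm p x"
    using lp_ops_bound[OF T] by blast
  define f where "f = (\<lambda>i. T (unit_seq i) l)"
  have *: "(\<Sum>i<n. norm (f i) powr p') \<le> C powr p'" for n
  proof -
    define s where "s = (\<Sum>i<n. norm (f i) powr p')"
    have s0: "0 \<le> s" by (simp add: s_def sum_nonneg)
    \<comment> \<open>Dividing by \<open>f i\<close> rather than multiplying by its conjugate; for \<open>f i = 0\<close> both are \<open>0\<close>.\<close>
    define x where "x = (\<lambda>i. of_real (norm (f i) powr p') / f i)"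
    have "norm (x i) powr p = norm (f i) powr p'" for i
    proof (cases "f i = 0")
      case False
      then have "norm (x i) = norm (f i) powr (p' - 1)"
        by (simp add: x_def norm_divide powr_diff)
      then show ?thesis by (simp add: powr_powr pp)
    qed (use p p'1 in \<open>simp add: x_def\<close>)
    then have nx: "lp_norm p (cut {..<n} x) powr p = s" "cut {..<n} x \<in> lp_space p"
      using lp_cut_finite[of p "{..<n}" x] p by (auto simp: s_def)
    have "T (cut {..<n} x) l = (\<Sum>i<n. x i * f i)"
      using lp_ops_cut[OF T p(2), of "{..<n}" x] by (simp add: sum_fun_apply seq_scale_def f_def)
    also have "\<dots> = of_real s"
      unfolding s_def of_real_sum by (intro sum.cong) (use p'1 in \<open>auto simp: x_def\<close>)
    finally have "s \<le> lp_norm q (T (cut {..<n} x))"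
      using lp_norm_component_le[OF \<open>0 < q\<close> lp_opsD(1)[OF T nx(2)], of l] s0 by simp
    also have "\<dots> \<le> C * lp_norm p (cut {..<n} x)"
      using C nx(2) by blast
    finally have "s \<le> C * lp_norm p (cut {..<n} x)" .
    moreover have "lp_norm p (cut {..<n} x) = s powr (1 / p)"
      using p unfolding nx(1)[symmetric] by (simp add: powr_powr)
    ultimately have le: "s \<le> C * s powr (1 / p)" by simp
    show ?thesis
    proof (cases "s = 0")
      case False
      then have s: "0 < s" using s0 by simp
      have "1 / p' = 1 - 1 / p" using p' by linarith
      then have "s powr (1 / p') = s / s powr (1 / p)"
        using s by (simp add: powr_diff)
      also have "\<dots> \<le> C"
        using le s by (simp add: divide_le_eq)
      finally have "(s powr (1 / p')) powr p' \<le> C powr p'"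
        using p'1 by (intro powr_mono2) auto
      then show ?thesis
        using s p'1 by (simp add: powr_powr s_def)
    qed (simp add: s_def)
  qed
  then show ?thesis
    unfolding f_def
    by (intro bounded_imp_summable[where B="C powr p'"])
       (use *[of "Suc _"] in \<open>auto simp: lessThan_Suc_atMost f_def\<close>)
qed

text \<open>
  This is where \<open>1 < p\<close> enters: the coefficients of the functional are summable with the conjugate
  exponent, so that Hoelder's inequality makes the functional small on sequences supported far
  out. For \<open>p = 1\<close> the summation functional is a counterexample.
\<close>

lemma functional_tail_small:
  assumes T: "T \<in> lp_ops p q" and "1 < p" "0 < q" "0 < e"
  shows "\<exists>m. \<forall>m'\<ge>m. \<forall>x\<in>lp_space p. norm (T (cut {m'..} x) l) \<le> e * lp_norm p x"
proof -
  have p: "0 < p" "1 \<le> p" using assms by auto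
  define p' where "p' = p / (p - 1)"
  have p': "1 / p + 1 / p' = 1" "1 < p'"
    using \<open>1 < p\<close> by (auto simp: p'_def field_simps)
  obtain C where C: "0 < C" "\<And>x. x \<in> lp_space p \<Longrightarrow> lp_norm q (T x) \<le> C * lp_norm p x"
    using lp_ops_bound[OF T] by blast
  define f where "f = (\<lambda>i. T (unit_seq i) l)"
  have "summable (\<lambda>i. norm (f i) powr p')"
    unfolding f_def using T assms p' by (intro functional_coefficients_summable) auto
  then obtain m where m: "\<And>a b. a \<ge> m \<Longrightarrow> norm (\<Sum>i\<in>{a..<b}. norm (f i) powr p') < e powr p'"
    using \<open>0 < e\<close> unfolding summable_Cauchy by (metis powr_gt_zero less_numeral_extra(3))
  have "norm (T (cut {m'..} x) l) \<le> e * lp_norm p x" if m': "m' \<ge> m" and x: "x \<in> lp_space p" for m' x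
  proof -
    have "norm (T (cut {m'..} x) l) \<le> e * lp_norm p x + C * lp_norm p (cut {n..} x)" if "n \<ge> m'" for n
    proof -
      have l: "cut {m'..<n} x \<in> lp_space p" "cut {n..} x \<in> lp_space p"
        using lp_cut(1)[OF p(1) x] by auto
      have "cut {m'..} x = cut {m'..<n} x + cut {n..} x"
        using cut_split[of "{m'..<n}" "{n..}" x] that by (simp add: ivl_disj_un ivl_disj_int)
      then have split: "T (cut {m'..} x) l = T (cut {m'..<n} x) l + T (cut {n..} x) l"
        using lp_opsD(3)[OF T l] by simp
      have "norm (T (cut {m'..<n} x) l) \<le> e * lp_norm p x"
      proof -
        have "T (cut {m'..<n} x) l = (\<Sum>i\<in>{m'..<n}. x i * f i)"
          using lp_ops_cut[OF T p(2), of "{m'..<n}" x] by (simp add: sum_fun_apply seq_scale_def f_def)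
        moreover have "norm (\<Sum>i\<in>{m'..<n}. x i * f i) \<le> e * lp_norm p x"
          using assms p' m[OF m', of n] lp_sum_le[OF p(1) x, of "{m'..<n}"]
          by (intro Holder_sum[of p p']) auto
        ultimately show ?thesis by simp
      qed
      moreover have "norm (T (cut {n..} x) l) \<le> C * lp_norm p (cut {n..} x)"
        using lp_norm_component_le[OF \<open>0 < q\<close> lp_opsD(1)[OF T l(2)], of l] C(2)[OF l(2)] by linarith
      ultimately show ?thesis
        unfolding split by (rule norm_triangle_le[OF add_mono])
    qed
    moreover have "(\<lambda>n. e * lp_norm p x + C * lp_norm p (cut {n..} x)) \<longlonglongrightarrow> e * lp_norm p x + C * 0"
      by (intro tendsto_intros lp_tail_tendsto_0 p x)
    ultimately show ?thesis
      by (intro LIMSEQ_le_const[of "\<lambda>n. e * lp_norm p x + C * lp_norm p (cut {n..} x)"]) auto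
  qed
  then show ?thesis by blast
qed

lemma lp_norm_lessThan_le_sum:
  fixes y :: "nat \<Rightarrow> 'k::{real_normed_field, euclidean_space}"
  assumes "1 \<le> q"
  shows "lp_norm q (cut {..<n} y) \<le> (\<Sum>l<n. norm (y l))"
proof -
  have q: "0 < q" using assms by simp
  have "lp_norm q (unit_seq l :: nat \<Rightarrow> 'k) = 1" for l
  proof -
    have "lp_norm q (unit_seq l :: nat \<Rightarrow> 'k) powr q = 1"
      using lp_finite_support(2)[of q "{l}" "unit_seq l :: nat \<Rightarrow> 'k"] q by (simp add: unit_seq_def)
    then have "lp_norm q (unit_seq l :: nat \<Rightarrow> 'k) powr q = 1 powr q"
      by simp
    then show ?thesis
      using q by (metis lp_norm_nonneg order_antisym order_refl powr_le_powr_iff zero_le_one)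
  qed
  then have "lp_norm q (seq_scale (y l) (unit_seq l)) = norm (y l)" for l
    using lp_scale(2)[OF q unit_seq_lp[OF q], of "y l" l] by simp
  moreover have "seq_scale (y l) (unit_seq l) \<in> lp_space q" for l
    using lp_scale(1)[OF q unit_seq_lp[OF q]] .
  ultimately show ?thesis
    using lp_sum[OF assms, of "{..<n}" "\<lambda>l. seq_scale (y l) (unit_seq l)"]
    unfolding cut_eq_sum[OF finite_lessThan] by presburger
qed

lemma row_tail_small:
  assumes T: "T \<in> lp_ops p q" and "1 < p" "1 \<le> q" "0 < e"
  shows "\<exists>m. \<forall>m'\<ge>m. \<forall>x\<in>lp_space p. lp_norm q (cut {..<n} (T (cut {m'..} x))) \<le> e * lp_norm p x"
proof -
  have "\<exists>m. \<forall>m'\<ge>m. \<forall>x\<in>lp_space p. norm (T (cut {m'..} x) l) \<le> e / (real n + 1) * lp_norm p x" for l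
    using assms by (intro functional_tail_small[OF T]) auto
  then obtain m where m: "\<And>l m' x. m' \<ge> m l \<Longrightarrow> x \<in> lp_space p \<Longrightarrow>
      norm (T (cut {m'..} x) l) \<le> e / (real n + 1) * lp_norm p x"
    by metis
  have "lp_norm q (cut {..<n} (T (cut {m'..} x))) \<le> e * lp_norm p x"
    if "m' \<ge> (\<Sum>l<n. m l)" "x \<in> lp_space p" for m' x
  proof -
    have "lp_norm q (cut {..<n} (T (cut {m'..} x))) \<le> (\<Sum>l<n. norm (T (cut {m'..} x) l))"
      by (rule lp_norm_lessThan_le_sum[OF \<open>1 \<le> q\<close>])
    also have "\<dots> \<le> (\<Sum>l<n. e / (real n + 1) * lp_norm p x)"
    proof (rule sum_mono)
      fix l assume l: "l \<in> {..<n}"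
      have "m l \<le> (\<Sum>l<n. m l)"
        using l by (intro member_le_sum) auto
      then show "norm (T (cut {m'..} x) l) \<le> e / (real n + 1) * lp_norm p x"
        using that by (intro m) auto
    qed
    also have "\<dots> = real n / (real n + 1) * (e * lp_norm p x)"
      by (simp add: field_simps)
    also have "\<dots> \<le> 1 * (e * lp_norm p x)"
      using \<open>0 < e\<close> by (intro mult_right_mono) auto
    finally show ?thesis by simp
  qed
  then show ?thesis by blast
qed

section \<open>Conjugation and orthonormalisation\<close>

text \<open>
  Conjugation on a scalar field of which only the Euclidean norm is known: the reflection in the
  real axis.
\<close>

definition conjg :: "'k::{real_normed_field, euclidean_space} \<Rightarrow> 'k" where
  "conjg x = of_real (2 * inner x 1) - x"

text \<open>
  Polarisation: the norm is multiplicative.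
\<close>

lemma inner_mult_mult:
  fixes a x y :: "'k::{real_normed_field, euclidean_space}"
  shows "inner (a * x) (a * y) = (norm a)\<^sup>2 * inner x y"
proof -
  have "inner u v = ((norm (u + v))\<^sup>2 - (norm u)\<^sup>2 - (norm v)\<^sup>2) / 2" for u v :: 'k
    by (simp add: power2_norm_eq_inner inner_add_left inner_add_right inner_commute)
  note polar = this
  have "inner (a * x) (a * y) = ((norm (a * (x + y)))\<^sup>2 - (norm (a * x))\<^sup>2 - (norm (a * y))\<^sup>2) / 2"
    unfolding polar[of "a * x"] distrib_left ..
  also have "\<dots> = (norm a)\<^sup>2 * (((norm (x + y))\<^sup>2 - (norm x)\<^sup>2 - (norm y)\<^sup>2) / 2)"
    unfolding norm_mult power_mult_distrib by (simp only: right_diff_distrib times_divide_eq_right)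
  finally show ?thesis
    unfolding polar[of x] .
qed

text \<open>
  In coordinates, \<open>x\<close> satisfies its characteristic equation \<open>x\<^sup>2 - 2 \<langle>x, 1\<rangle> x + \<parallel>x\<parallel>\<^sup>2 = 0\<close>. That
  the left-hand side has norm \<open>0\<close> follows by expanding the square of its norm, since
  multiplication by a scalar is a multiple of an isometry; the only inner product not given by
  this, \<open>\<langle>x\<^sup>2, 1\<rangle>\<close>, is found from \<open>\<parallel>(x - 1)\<^sup>2\<parallel> = \<parallel>x - 1\<parallel>\<^sup>2\<close>.
\<close>

lemma mult_conjg:
  fixes x :: "'k::{real_normed_field, euclidean_space}"
  shows "x * conjg x = of_real ((norm x)\<^sup>2)"
proof -
  define c where "c = inner x 1"
  define n where "n = inner x x"
  define t where "t = inner (x * x) 1"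
  have one: "inner (1::'k) 1 = 1"
    by (metis norm_one one_power2 power2_norm_eq_inner)
  have nx: "(norm x)\<^sup>2 = n"
    by (simp add: n_def power2_norm_eq_inner)
  have xxx: "inner (x * x) x = n * c" "inner (x * x) (x * x) = n\<^sup>2"
    using inner_mult_mult[of x x 1] inner_mult_mult[of x x x] nx
    by (auto simp: c_def n_def power2_eq_square)
  note expand = inner_add_left inner_add_right inner_diff_left inner_diff_right
    inner_scaleR_left inner_scaleR_right
  have c': "inner 1 x = c" and t': "inner 1 (x * x) = t" and xxx': "inner x (x * x) = n * c"
    using xxx by (auto simp: c_def t_def inner_commute)
  have "(norm ((x - 1) * (x - 1)))\<^sup>2 = ((norm (x - 1))\<^sup>2)\<^sup>2"
    by (simp add: norm_mult power_mult_distrib power2_eq_square)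
  also have "(norm (x - 1))\<^sup>2 = n - 2 * c + 1"
    unfolding power2_norm_eq_inner by (simp add: expand one c' flip: c_def n_def)
  also have "(x - 1) * (x - 1) = x * x - 2 *\<^sub>R x + 1"
    by (simp add: algebra_simps scaleR_2)
  also have "(norm (x * x - 2 *\<^sub>R x + 1))\<^sup>2 = n\<^sup>2 + 4 * n + 1 - 4 * (n * c) + 2 * t - 4 * c"
    unfolding power2_norm_eq_inner
    by (simp add: expand one c' t' xxx xxx' flip: c_def n_def t_def)
  finally have t: "t = 2 * c\<^sup>2 - n"
    by (simp add: power2_eq_square algebra_simps)
  have "(norm (x * x - (2 * c) *\<^sub>R x + n *\<^sub>R 1))\<^sup>2 = 0"
    unfolding power2_norm_eq_inner
    by (simp add: expand one c' t' xxx xxx' t power2_eq_square algebra_simps flip: c_def n_def t_def)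
  then have "x * x - (2 * c) *\<^sub>R x + n *\<^sub>R 1 = 0"
    by simp
  then show ?thesis
    by (simp add: conjg_def nx algebra_simps of_real_def flip: c_def)
qed

lemma conjg_add: "conjg (x + y) = conjg x + conjg y"
  by (simp add: conjg_def inner_add_left)

lemma conjg_zero [simp]: "conjg 0 = 0"
  by (simp add: conjg_def)

lemma conjg_sum: "conjg (sum f A) = (\<Sum>i\<in>A. conjg (f i))"
  by (induction A rule: infinite_finite_induct) (auto simp: conjg_add)

lemma conjg_conjg [simp]: "conjg (conjg (x :: 'k::{real_normed_field, euclidean_space})) = x"
proof -
  have "inner (1::'k) 1 = 1"
    by (metis norm_one one_power2 power2_norm_eq_inner)
  then have "inner (conjg x) 1 = inner x 1"
    by (simp add: conjg_def inner_diff_left of_real_def)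
  then show ?thesis
    by (simp add: conjg_def)
qed

lemma conjg_of_real [simp]: "conjg (of_real r :: 'k::{real_normed_field, euclidean_space}) = of_real r"
proof -
  have "inner (1::'k) 1 = 1"
    by (metis norm_one one_power2 power2_norm_eq_inner)
  then show ?thesis
    by (simp add: conjg_def of_real_def flip: scaleR_left.diff)
qed

lemma conjg_mult: "conjg (x * y) = conjg x * conjg y"
proof (cases "x * y = 0")
  case False
  have "(x * y) * conjg (x * y) = (x * y) * (conjg x * conjg y)"
  proof -
    have "(x * y) * (conjg x * conjg y) = (x * conjg x) * (y * conjg y)"
      by (simp add: mult_ac)
    then show ?thesis
      unfolding mult_conjg by (simp add: norm_mult power_mult_distrib)
  qed
  then show ?thesis
    using False by (metis mult_cancel_left)
qed auto

text \<open>
  This notion of large dimension applies to infinite-dimensional spaces as well, and it drops by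
  at most one on the kernel of a functional.
\<close>

definition dim_at_least :: "nat \<Rightarrow> (nat \<Rightarrow> 'k::{real_normed_field, euclidean_space}) set \<Rightarrow> bool" where
  "dim_at_least n E \<longleftrightarrow> (\<forall>W. finite W \<and> card W < n \<longrightarrow> \<not> E \<subseteq> seq.span W)"

lemma dim_at_least_dim: "dim_at_least (seq.dim E) E"
  unfolding dim_at_least_def
proof (intro allI impI notI)
  fix W assume "finite W \<and> card W < seq.dim E" "E \<subseteq> seq.span W"
  then show False
    using seq.dim_le_card[of E W] by linarith
qed

text \<open>
  If the kernel were spanned by fewer than \<open>m\<close> vectors, one more vector would be enough to span
  \<open>E\<close>.
\<close>

lemma dim_at_least_kernel:
  fixes f :: "(nat \<Rightarrow> 'k::{real_normed_field, euclidean_space}) \<Rightarrow> 'k"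
  assumes E: "seq.subspace E" and dim: "dim_at_least (Suc m) E"
    and add: "\<And>x y. x \<in> E \<Longrightarrow> y \<in> E \<Longrightarrow> f (x + y) = f x + f y"
    and scale: "\<And>c x. x \<in> E \<Longrightarrow> f (seq_scale c x) = c * f x"
  shows "seq.subspace {x \<in> E. f x = 0}" "dim_at_least m {x \<in> E. f x = 0}"
proof -
  show "seq.subspace {x \<in> E. f x = 0}"
  proof (rule seq.subspaceI)
    have "seq_scale 0 0 = (0 :: nat \<Rightarrow> 'k)"
      by (simp add: seq_scale_def fun_eq_iff)
    then have "f 0 = 0"
      using scale[OF seq.subspace_0[OF E], of 0] by simp
    then show "0 \<in> {x \<in> E. f x = 0}"
      using seq.subspace_0[OF E] by blast
    show "x + y \<in> {x \<in> E. f x = 0}" if "x \<in> {x \<in> E. f x = 0}" "y \<in> {x \<in> E. f x = 0}" for x y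
      using that seq.subspace_add[OF E, of x y] add[of x y] by simp
    show "seq_scale c x \<in> {x \<in> E. f x = 0}" if "x \<in> {x \<in> E. f x = 0}" for c x
      using that seq.subspace_scale[OF E, of x c] scale[of x c] by simp
  qed
  show "dim_at_least m {x \<in> E. f x = 0}"
    unfolding dim_at_least_def
  proof (intro allI impI notI)
    fix W assume W: "finite W \<and> card W < m" "{x \<in> E. f x = 0} \<subseteq> seq.span W"
    show False
    proof (cases "\<exists>v\<in>E. f v \<noteq> 0")
      case True
      then obtain v where v: "v \<in> E" "f v \<noteq> 0" by blast
      have "E \<subseteq> seq.span (insert v W)"
      proof
        fix x assume x: "x \<in> E"
        define y where "y = x + seq_scale (- (f x / f v)) v"
        have vE: "seq_scale (- (f x / f v)) v \<in> E"
          using seq.subspace_scale[OF E] v by blast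
        have "y \<in> E" "f y = 0"
          unfolding y_def using seq.subspace_add[OF E x vE] v
        by (simp_all only: add[OF x vE] scale[OF v(1)]) (simp add: scale[OF v(1)])
        then have y: "y \<in> seq.span (insert v W)"
          using W(2) seq.span_mono[of W "insert v W"] by blast
        have v': "seq_scale (f x / f v) v \<in> seq.span (insert v W)"
          by (intro seq.span_scale seq.span_base) auto
        have "y + seq_scale (f x / f v) v = x"
          by (simp add: y_def fun_eq_iff seq_scale_def)
        then show "x \<in> seq.span (insert v W)"
          using seq.span_add[OF y v'] by (rule back_subst[where P="\<lambda>x. x \<in> seq.span (insert v W)", rotated])
      qed
      moreover have "finite (insert v W)" "card (insert v W) < Suc m"
        using W(1) by (auto simp: card_insert_if)
      ultimately show False
        using dim unfolding dim_at_least_def by blast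
    next
      case False
      then have "E \<subseteq> seq.span W" using W by blast
      then show False
        using dim W(1) less_SucI[of "card W" m] unfolding dim_at_least_def by blast
    qed
  qed
qed

lemma dim_at_least_kernels:
  fixes g :: "(nat \<Rightarrow> 'k::{real_normed_field, euclidean_space}) \<Rightarrow> nat \<Rightarrow> 'k"
  assumes E: "seq.subspace E" and dim: "dim_at_least (m + N) E"
    and add: "\<And>x y. x \<in> E \<Longrightarrow> y \<in> E \<Longrightarrow> g (x + y) = g x + g y"
    and scale: "\<And>c x. x \<in> E \<Longrightarrow> g (seq_scale c x) = seq_scale c (g x)"
  shows "seq.subspace {x \<in> E. \<forall>l<N. g x l = 0} \<and> dim_at_least m {x \<in> E. \<forall>l<N. g x l = 0}"
  using dim
proof (induction N arbitrary: m)
  case 0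
  then show ?case using E by simp
next
  case (Suc N)
  let ?F = "{x \<in> E. \<forall>l<N. g x l = 0}"
  have F: "seq.subspace ?F" "dim_at_least (Suc m) ?F"
    using Suc.IH[of "Suc m"] Suc.prems by auto
  have "{x \<in> E. \<forall>l<Suc N. g x l = 0} = {x \<in> ?F. g x N = 0}"
    using less_Suc_eq by auto
  moreover have "g (seq_scale c x) N = c * g x N" if "x \<in> ?F" for c x
    using that scale[of x c] by (simp add: seq_scale_def)
  ultimately show ?case
    using dim_at_least_kernel[OF F, of "\<lambda>x. g x N"] add by simp
qed

lemma sum_scale_in_subspace:
  assumes "seq.subspace E" "\<And>i. i \<in> A \<Longrightarrow> f i \<in> E"
  shows "(\<Sum>i\<in>A. seq_scale (c i) (f i)) \<in> E"
  using assms by (intro seq.subspace_sum seq.subspace_scale) auto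

lemma dim_at_least_obtain:
  fixes f :: "nat \<Rightarrow> nat \<Rightarrow> 'k::{real_normed_field, euclidean_space}"
  assumes E: "seq.subspace E" and "dim_at_least n E" "m < n" "\<And>i. i < m \<Longrightarrow> f i \<in> E"
  obtains v where "v \<in> E" "\<And>c. v - (\<Sum>i<m. seq_scale (c i) (f i)) \<in> E - {0}"
proof -
  have "card (f ` {..<m}) < n"
    using card_image_le[of "{..<m}" f] assms(3) by simp
  then have "\<not> E \<subseteq> seq.span (f ` {..<m})"
    using assms(2) unfolding dim_at_least_def by blast
  then obtain v where v: "v \<in> E" "v \<notin> seq.span (f ` {..<m})" by blast
  have "v - (\<Sum>i<m. seq_scale (c i) (f i)) \<in> E - {0}" for c
  proof -
    have "(\<Sum>i<m. seq_scale (c i) (f i)) \<in> seq.span (f ` {..<m})"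
      by (intro sum_scale_in_subspace seq.subspace_span seq.span_base) auto
    then have "v \<noteq> (\<Sum>i<m. seq_scale (c i) (f i))" using v(2) by blast
    moreover have "(\<Sum>i<m. seq_scale (c i) (f i)) \<in> E"
      using assms(4) by (intro sum_scale_in_subspace E) auto
    ultimately show ?thesis
      using seq.subspace_diff[OF E v(1)] by simp
  qed
  then show ?thesis using v(1) that by blast
qed

lemma sum_Kronecker:
  fixes c g :: "nat \<Rightarrow> 'a::ring_1"
  assumes "j < m" "\<And>i. i < m \<Longrightarrow> g i = (if i = j then 1 else 0)"
  shows "(\<Sum>i<m. c i * g i) = c j"
proof -
  have "(\<Sum>i<m. c i * g i) = (\<Sum>i<m. if i = j then c i else 0)"
    using assms by (intro sum.cong) auto
  then show ?thesis
    using assms by simp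
qed

text \<open>
  A reduced echelon form, built one vector at a time. Its use is that the coefficients of a vector
  in this system are coordinates of that vector, and hence bounded by its norm.
\<close>

lemma echelon_system:
  fixes E :: "(nat \<Rightarrow> 'k::{real_normed_field, euclidean_space}) set"
  assumes E: "seq.subspace E" and dim: "dim_at_least n E"
  shows "\<exists>x k. \<forall>i<n. x i \<in> E \<and> (\<forall>j<n. x i (k j) = (if i = j then 1 else 0))"
proof -
  have "m \<le> n \<Longrightarrow> \<exists>x k. \<forall>i<m. x i \<in> E \<and> (\<forall>j<m. x i (k j) = (if i = j then 1 else 0))" for m
  proof (induction m)
    case (Suc m)
    then obtain x k where x: "\<And>i. i < m \<Longrightarrow> x i \<in> E"
      and xk: "\<And>i j. i < m \<Longrightarrow> j < m \<Longrightarrow> x i (k j) = (if i = j then 1 else 0)"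
      by auto
    from Suc.prems have "m < n" by simp
    from dim_at_least_obtain[OF E dim this, of x] x obtain v where
      v: "v \<in> E" "\<And>c. v - (\<Sum>i<m. seq_scale (c i) (x i)) \<in> E - {0}" by blast
    define w where "w = v - (\<Sum>i<m. seq_scale (v (k i)) (x i))"
    have w: "w \<in> E" "w \<noteq> 0" using v(2)[of "\<lambda>i. v (k i)"] by (auto simp: w_def)
    have wk: "w (k j) = 0" if "j < m" for j
      using sum_Kronecker[OF that, of "\<lambda>i. x i (k j)" "\<lambda>i. v (k i)"] that xk
      by (simp add: w_def sum_fun_apply seq_scale_def)
    obtain l where l: "w l \<noteq> 0" using w(2) by (auto simp: fun_eq_iff)
    define u where "u = seq_scale (1 / w l) w"
    have u: "u \<in> E" "u l = 1" "\<And>j. j < m \<Longrightarrow> u (k j) = 0"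
      using seq.subspace_scale[OF E w(1), of "1 / w l"] l wk unfolding u_def
      by (simp_all) (simp_all add: seq_scale_def)
    define x' where "x' = (\<lambda>i. if i = m then u else x i - seq_scale (x i l) u)"
    define k' where "k' = k(m := l)"
    have "\<forall>i<Suc m. x' i \<in> E \<and> (\<forall>j<Suc m. x' i (k' j) = (if i = j then 1 else 0))"
      using u x xk seq.subspace_diff[OF E] seq.subspace_scale[OF E]
      by (auto simp: x'_def k'_def seq_scale_def less_Suc_eq)
    then show ?case by blast
  qed simp
  then show ?thesis by blast
qed

text \<open>
  The form \<open>\<phi>\<close> has only to be an inner product on \<open>E\<close>; below it is a weighted form pulled back
  along an operator.
\<close>

lemma Gram_Schmidt:
  fixes E :: "(nat \<Rightarrow> 'k::{real_normed_field, euclidean_space}) set"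
    and \<phi> :: "(nat \<Rightarrow> 'k) \<Rightarrow> (nat \<Rightarrow> 'k) \<Rightarrow> 'k"
  assumes E: "seq.subspace E" and dim: "dim_at_least n E"
    and add: "\<And>x y z. x \<in> E \<Longrightarrow> y \<in> E \<Longrightarrow> z \<in> E \<Longrightarrow> \<phi> (x + y) z = \<phi> x z + \<phi> y z"
    and scale: "\<And>c x z. x \<in> E \<Longrightarrow> z \<in> E \<Longrightarrow> \<phi> (seq_scale c x) z = c * \<phi> x z"
    and herm: "\<And>x z. x \<in> E \<Longrightarrow> z \<in> E \<Longrightarrow> \<phi> z x = conjg (\<phi> x z)"
    and pos: "\<And>x. x \<in> E \<Longrightarrow> x \<noteq> 0 \<Longrightarrow> \<exists>r>0. \<phi> x x = of_real r"
  shows "\<exists>f. \<forall>i<n. f i \<in> E \<and> (\<forall>j<n. \<phi> (f i) (f j) = (if i = j then 1 else 0))"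
proof -
  have zero: "\<phi> 0 z = 0" if "z \<in> E" for z
    using scale[OF seq.subspace_0[OF E] that, of 0] by (simp add: seq_scale_def zero_fun_def)
  have sum: "\<phi> (\<Sum>i\<in>A. seq_scale (c i) (g i)) z = (\<Sum>i\<in>A. c i * \<phi> (g i) z)"
    if "finite A" "\<And>i. i \<in> A \<Longrightarrow> g i \<in> E" "z \<in> E" for A :: "nat set" and c g z
    using that(1,2)
  proof (induction A)
    case (insert a A)
    have "\<phi> (seq_scale (c a) (g a) + (\<Sum>i\<in>A. seq_scale (c i) (g i))) z
        = \<phi> (seq_scale (c a) (g a)) z + \<phi> (\<Sum>i\<in>A. seq_scale (c i) (g i)) z"
      using insert.prems that(3)
      by (intro add sum_scale_in_subspace[OF E] seq.subspace_scale[OF E]) auto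
    also have "\<dots> = c a * \<phi> (g a) z + (\<Sum>i\<in>A. c i * \<phi> (g i) z)"
      using insert scale that(3) by auto
    finally show ?case
      unfolding sum.insert[OF insert.hyps] .
  next
    case empty
    show ?case unfolding sum.empty by (rule zero[OF that(3)])
  qed
  have "m \<le> n \<Longrightarrow> \<exists>f. \<forall>i<m. f i \<in> E \<and> (\<forall>j<m. \<phi> (f i) (f j) = (if i = j then 1 else 0))" for m
  proof (induction m)
    case (Suc m)
    then obtain f where f: "\<And>i. i < m \<Longrightarrow> f i \<in> E"
      and ff: "\<And>i j. i < m \<Longrightarrow> j < m \<Longrightarrow> \<phi> (f i) (f j) = (if i = j then 1 else 0)"
      by auto
    from Suc.prems have "m < n" by simp
    from dim_at_least_obtain[OF E dim this, of f] f obtain v where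
      v: "v \<in> E" "\<And>c. v - (\<Sum>i<m. seq_scale (c i) (f i)) \<in> E - {0}" by blast
    define s where "s = (\<Sum>i<m. seq_scale (- \<phi> v (f i)) (f i))"
    define w where "w = v + s"
    have sE: "s \<in> E" unfolding s_def using f by (intro sum_scale_in_subspace[OF E]) auto
    have "w = v - (\<Sum>i<m. seq_scale (\<phi> v (f i)) (f i))"
      by (simp add: w_def s_def fun_eq_iff sum_fun_apply seq_scale_def sum_negf)
    then have w: "w \<in> E" "w \<noteq> 0" using v(2)[of "\<lambda>i. \<phi> v (f i)"] by auto
    have wf: "\<phi> w (f j) = 0" if j: "j < m" for j
    proof -
      have "\<phi> s (f j) = (\<Sum>i<m. - \<phi> v (f i) * \<phi> (f i) (f j))"
        unfolding s_def using f j by (intro sum) auto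
      also have "\<dots> = - \<phi> v (f j)"
        using sum_Kronecker[OF j, of "\<lambda>i. \<phi> (f i) (f j)" "\<lambda>i. - \<phi> v (f i)"] j ff by simp
      finally show ?thesis
        using add[OF v(1) sE f[OF j]] by (simp add: w_def)
    qed
    obtain r where r: "r > 0" "\<phi> w w = of_real r" using pos[OF w] by blast
    define u where "u = seq_scale (of_real (1 / sqrt r)) w"
    have uE: "u \<in> E" using seq.subspace_scale[OF E w(1)] by (simp add: u_def)
    have uf: "\<phi> u (f j) = 0" "\<phi> (f j) u = 0" if "j < m" for j
    proof -
      show *: "\<phi> u (f j) = 0"
        using scale[OF w(1) f[OF that]] wf[OF that] by (simp add: u_def)
      show "\<phi> (f j) u = 0"
        using herm[OF uE f[OF that]] * by simp
    qed
    have "\<phi> u u = of_real (1 / sqrt r) * \<phi> w u"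
      unfolding u_def by (rule scale[OF w(1) uE[unfolded u_def]])
    also have "\<phi> w u = conjg (of_real (1 / sqrt r) * \<phi> w w)"
      using herm[OF uE w(1)] scale[OF w(1) w(1)] by (simp add: u_def)
    also have "\<dots> = of_real (1 / sqrt r) * of_real r"
      unfolding r(2) by (simp add: conjg_mult del: of_real_mult of_real_divide flip: of_real_mult)
    also have "of_real (1 / sqrt r) * (of_real (1 / sqrt r) * of_real r) = (of_real (1 / sqrt r * (1 / sqrt r * r)) :: 'k)"
      by (simp only: of_real_mult)
    also have "1 / sqrt r * (1 / sqrt r * r) = 1"
      using r(1) by (simp add: field_simps)
    finally have uu: "\<phi> u u = 1" by simp
    have "\<forall>i<Suc m. (f(m := u)) i \<in> E \<and> (\<forall>j<Suc m. \<phi> ((f(m := u)) i) ((f(m := u)) j) = (if i = j then 1 else 0))"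
      using uu uE uf f ff by (auto simp: less_Suc_eq)
    then show ?case by blast
  qed simp
  then show ?thesis by blast
qed

section \<open>Rademacher averages and the Khintchine inequalities\<close>

text \<open>
  The average of \<open>F\<close> over all signed sums of the entries of a list, one sign at a time. The
  recursion lets every moment estimate be an induction over the list.
\<close>

primrec rad :: "'v::ab_group_add list \<Rightarrow> ('v \<Rightarrow> real) \<Rightarrow> real" where
  "rad [] F = F 0"
| "rad (x # xs) F = (rad xs (\<lambda>s. F (s + x)) + rad xs (\<lambda>s. F (s - x))) / 2"

definition add_subgroup :: "'v::ab_group_add set \<Rightarrow> bool" where
  "add_subgroup E \<longleftrightarrow> 0 \<in> E \<and> (\<forall>x\<in>E. \<forall>y\<in>E. x + y \<in> E \<and> x - y \<in> E)"

lemma rad_mono: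
  assumes "add_subgroup E" "set xs \<subseteq> E" "\<And>s. s \<in> E \<Longrightarrow> F s \<le> G s"
  shows "rad xs F \<le> rad xs G"
  using assms(2,3)
proof (induction xs arbitrary: F G)
  case (Cons x xs)
  then have "rad xs (\<lambda>s. F (s + x)) \<le> rad xs (\<lambda>s. G (s + x))"
    "rad xs (\<lambda>s. F (s - x)) \<le> rad xs (\<lambda>s. G (s - x))"
    using assms(1) by (auto simp: add_subgroup_def)
  then show ?case by simp
qed (use assms(1) in \<open>auto simp: add_subgroup_def\<close>)

lemma rad_mono_UNIV:
  assumes "\<And>s. F s \<le> G s"
  shows "rad xs F \<le> rad xs G"
  using assms by (intro rad_mono[of UNIV]) (auto simp: add_subgroup_def)

lemma rad_const [simp]: "rad xs (\<lambda>_. c) = c"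
  by (induction xs) auto

lemma rad_nonneg: "(\<And>s. 0 \<le> F s) \<Longrightarrow> 0 \<le> rad xs F"
  using rad_mono_UNIV[of "\<lambda>_. 0" F xs] by simp

lemma rad_add: "rad xs (\<lambda>s. F s + G s) = rad xs F + rad xs G"
proof (induction xs arbitrary: F G)
  case (Cons x xs)
  show ?case
    using Cons[of "\<lambda>s. F (s + x)" "\<lambda>s. G (s + x)"] Cons[of "\<lambda>s. F (s - x)" "\<lambda>s. G (s - x)"]
    by (simp add: add_divide_distrib)
qed simp

lemma rad_cmult: "rad xs (\<lambda>s. c * F s) = c * rad xs F"
  by (induction xs arbitrary: F) (auto simp: algebra_simps)

lemma rad_sum: "rad xs (\<lambda>s. \<Sum>i\<in>I. F i s) = (\<Sum>i\<in>I. rad xs (F i))"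
  by (induction I rule: infinite_finite_induct) (auto simp: rad_add)

text \<open>
  Averages commute with additive maps. In particular the average over sequences of a function of
  one coordinate is an average over scalars.
\<close>

lemma rad_map:
  assumes "add_subgroup E" "set xs \<subseteq> E" "L 0 = 0"
    and "\<And>x y. x \<in> E \<Longrightarrow> y \<in> E \<Longrightarrow> L (x + y) = L x + L y"
    and "\<And>x y. x \<in> E \<Longrightarrow> y \<in> E \<Longrightarrow> L (x - y) = L x - L y"
  shows "rad (map L xs) F = rad xs (\<lambda>s. F (L s))"
  using assms(2)
proof (induction xs arbitrary: F)
  case Nil
  then show ?case using assms(3) by simp
next
  case (Cons x xs)
  have cong: "rad xs G = rad xs H" if "\<And>s. s \<in> E \<Longrightarrow> G s = H s" for G H
    using that Cons.prems by (intro order_antisym rad_mono[OF assms(1)]) auto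
  have "rad (map L xs) (\<lambda>s. F (s + L x)) = rad xs (\<lambda>s. F (L s + L x))"
    "rad (map L xs) (\<lambda>s. F (s - L x)) = rad xs (\<lambda>s. F (L s - L x))"
    using Cons by auto
  moreover have "rad xs (\<lambda>s. F (L s + L x)) = rad xs (\<lambda>s. F (L (s + x)))"
    "rad xs (\<lambda>s. F (L s - L x)) = rad xs (\<lambda>s. F (L (s - x)))"
    using Cons.prems assms(4,5) by (auto intro!: cong)
  ultimately show ?case by simp
qed

text \<open>
  Jensen's inequality for the concave function \<open>t powr \<theta>\<close>, one sign at a time.
\<close>

lemma rad_powr_le:
  assumes "0 < \<theta>" "\<theta> \<le> 1" "\<And>s. 0 \<le> F s"
  shows "rad xs (\<lambda>s. F s powr \<theta>) \<le> rad xs F powr \<theta>"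
  using assms(3)
proof (induction xs arbitrary: F)
  case (Cons x xs)
  define a where "a = rad xs (\<lambda>s. F (s + x))"
  define b where "b = rad xs (\<lambda>s. F (s - x))"
  have nonneg: "0 \<le> a" "0 \<le> b" using Cons.prems by (auto simp: a_def b_def intro: rad_nonneg)
  have "rad (x # xs) (\<lambda>s. F s powr \<theta>) \<le> (a powr \<theta> + b powr \<theta>) / 2"
    using Cons.IH[of "\<lambda>s. F (s + x)"] Cons.IH[of "\<lambda>s. F (s - x)"] Cons.prems
    by (simp add: a_def b_def)
  also have "\<dots> \<le> ((a + b) / 2) powr \<theta>"
    using powr_concave_comb[OF assms(1,2) nonneg, of "1/2"] by (simp add: add_divide_distrib)
  finally show ?case by (simp add: a_def b_def)
qed simp

definition sqsum :: "'v::real_normed_vector list \<Rightarrow> real" where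
  "sqsum xs = (\<Sum>x\<leftarrow>xs. (norm x)\<^sup>2)"

lemma sqsum_simps [simp]:
  "sqsum [] = 0" "sqsum (x # xs) = (norm x)\<^sup>2 + sqsum xs" "sqsum (xs @ ys) = sqsum xs + sqsum ys"
  by (auto simp: sqsum_def)

lemma sqsum_nonneg [simp]: "0 \<le> sqsum xs"
  by (induction xs) auto

lemma rad_second_moment:
  fixes xs :: "'v::real_inner list"
  shows "rad xs (\<lambda>s. (norm s)\<^sup>2) = sqsum xs"
proof (induction xs)
  case (Cons x xs)
  have "rad (x # xs) (\<lambda>s. (norm s)\<^sup>2) = rad xs (\<lambda>s. (1/2) * ((norm (s + x))\<^sup>2 + (norm (s - x))\<^sup>2))"
    unfolding rad_cmult rad_add by simp
  also have "\<dots> = rad xs (\<lambda>s. (norm s)\<^sup>2 + (norm x)\<^sup>2)"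
    by (simp add: power2_norm_eq_inner algebra_simps inner_commute)
  finally show ?case
    using Cons by (simp add: rad_add)
qed simp

text \<open>
  Averaging over the last sign, \<open>\<parallel>s + x\<parallel>\<^sup>4\<close> becomes \<open>(\<parallel>s\<parallel>\<^sup>2 + \<parallel>x\<parallel>\<^sup>2)\<^sup>2 + 4 \<langle>s, x\<rangle>\<^sup>2\<close>.
\<close>

lemma rad_fourth_moment:
  fixes xs :: "'v::real_inner list"
  shows "rad xs (\<lambda>s. (norm s)^4) \<le> 3 * (sqsum xs)\<^sup>2"
proof (induction xs)
  case (Cons x xs)
  have *: "(1/2) * ((norm (s + x))^4 + (norm (s - x))^4) \<le> (norm s)^4 + 6 * (norm x)\<^sup>2 * (norm s)\<^sup>2 + (norm x)^4"
    for s
  proof -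
    define u where "u = (norm s)\<^sup>2 + (norm x)\<^sup>2"
    define w where "w = inner s x"
    have "(norm (s + x))\<^sup>2 = u + 2 * w" "(norm (s - x))\<^sup>2 = u - 2 * w"
      by (auto simp: u_def w_def power2_norm_eq_inner algebra_simps inner_commute)
    then have "(norm (s + x))^4 = (u + 2 * w)\<^sup>2" "(norm (s - x))^4 = (u - 2 * w)\<^sup>2"
      by (metis mult_2 numeral_Bit0 power_add power2_eq_square)+
    then have "(1/2) * ((norm (s + x))^4 + (norm (s - x))^4) = u\<^sup>2 + 4 * w\<^sup>2"
      by (simp add: power2_eq_square algebra_simps)
    also have "w\<^sup>2 \<le> (norm s)\<^sup>2 * (norm x)\<^sup>2"
      using power_mono[OF Cauchy_Schwarz_ineq2[of s x], of 2] by (simp add: w_def power_mult_distrib)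
    finally show ?thesis
      by (simp add: u_def power2_eq_square power4_eq_xxxx algebra_simps)
  qed
  have "rad (x # xs) (\<lambda>s. (norm s)^4) = rad xs (\<lambda>s. (1/2) * ((norm (s + x))^4 + (norm (s - x))^4))"
    unfolding rad_cmult rad_add by simp
  also have "\<dots> \<le> rad xs (\<lambda>s. (norm s)^4 + 6 * (norm x)\<^sup>2 * (norm s)\<^sup>2 + (norm x)^4)"
    by (rule rad_mono_UNIV[OF *])
  also have "\<dots> = rad xs (\<lambda>s. (norm s)^4) + 6 * (norm x)\<^sup>2 * sqsum xs + (norm x)^4"
    by (simp add: rad_add rad_cmult rad_second_moment)
  also have "\<dots> \<le> 3 * (sqsum xs)\<^sup>2 + 6 * (norm x)\<^sup>2 * sqsum xs + 3 * (norm x)^4"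
    using Cons zero_le_power[OF norm_ge_zero, of x 4] by linarith
  also have "\<dots> = 3 * (sqsum (x # xs))\<^sup>2"
    by (simp add: power2_eq_square power4_eq_xxxx algebra_simps)
  finally show ?case .
qed simp

text \<open>
  Beyond \<open>t = 1\<close> the left-hand side is at most \<open>1\<close>, since \<open>(t\<^sup>2 / 2 - 1)\<^sup>2 \<ge> 0\<close>.
\<close>

lemma powr_ge_quartic:
  fixes t p :: real
  assumes "0 \<le> t" "0 < p" "p \<le> 2"
  shows "t\<^sup>2 - t^4 / 4 \<le> t powr p"
proof (cases "t \<le> 1")
  case True
  have "t\<^sup>2 - t^4 / 4 \<le> t powr 2"
    using assms by (simp add: powr_numeral)
  also have "\<dots> \<le> t powr p"
    using assms True by (intro powr_mono') auto
  finally show ?thesis .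
next
  case False
  have "0 \<le> (t\<^sup>2 / 2 - 1)\<^sup>2" by simp
  then have "t\<^sup>2 - t^4 / 4 \<le> 1"
    by (simp add: power2_eq_square power4_eq_xxxx algebra_simps)
  also have "1 \<le> t powr p"
    using assms False by (simp add: ge_one_powr_ge_zero)
  finally show ?thesis .
qed

text \<open>
  Averaging the previous inequality at \<open>t = \<parallel>s\<parallel> / \<sigma>\<close>, where \<open>\<sigma>\<^sup>2\<close> is the second moment, yields at
  least \<open>1 - 3 / 4\<close>.
\<close>

lemma Khintchine_lower:
  fixes xs :: "'v::real_inner list"
  assumes "0 < p" "p \<le> 2"
  shows "sqsum xs powr (p / 2) \<le> 4 * rad xs (\<lambda>s. norm s powr p)"
proof (cases "sqsum xs = 0")
  case True
  then show ?thesis using rad_nonneg[of "\<lambda>s. norm s powr p" xs] by simp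
next
  case False
  then have pos: "0 < sqsum xs" using sqsum_nonneg[of xs] by linarith
  define \<sigma> where "\<sigma> = sqrt (sqsum xs)"
  have \<sigma>: "0 < \<sigma>" "\<sigma>\<^sup>2 = sqsum xs" using pos by (auto simp: \<sigma>_def)
  have "\<sigma> powr p = sqsum xs powr (p / 2)"
    using pos by (simp add: \<sigma>_def powr_half_sqrt[symmetric] powr_powr)
  have *: "(1 / \<sigma>\<^sup>2) * (norm s)\<^sup>2 + (- 1 / (4 * \<sigma>^4)) * (norm s)^4 \<le> (1 / \<sigma> powr p) * norm s powr p" for s :: 'v
    using powr_ge_quartic[of "norm s / \<sigma>" p] assms \<sigma>
    by (simp add: power_divide powr_divide)
  have "1 / 4 = (1 / \<sigma>\<^sup>2) * sqsum xs + (- 1 / (4 * \<sigma>^4)) * (3 * (sqsum xs)\<^sup>2)"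
    unfolding \<sigma>(2)[symmetric] using \<sigma>(1) by (simp add: field_simps power2_eq_square power4_eq_xxxx)
  also have "\<dots> \<le> (1 / \<sigma>\<^sup>2) * rad xs (\<lambda>s. (norm s)\<^sup>2) + (- 1 / (4 * \<sigma>^4)) * rad xs (\<lambda>s. (norm s)^4)"
    unfolding rad_second_moment
    using rad_fourth_moment[of xs] \<sigma>(1) by (intro add_mono order_refl mult_left_mono_neg) auto
  also have "\<dots> = rad xs (\<lambda>s. (1 / \<sigma>\<^sup>2) * (norm s)\<^sup>2 + (- 1 / (4 * \<sigma>^4)) * (norm s)^4)"
    by (simp only: rad_add rad_cmult)
  also have "\<dots> \<le> (1 / \<sigma> powr p) * rad xs (\<lambda>s. norm s powr p)"
    unfolding rad_cmult[symmetric] by (rule rad_mono_UNIV[OF *])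
  finally have "\<sigma> powr p \<le> 4 * rad xs (\<lambda>s. norm s powr p)"
    using \<sigma>(1) by (simp add: field_simps)
  then show ?thesis
    using \<open>\<sigma> powr p = sqsum xs powr (p / 2)\<close> by simp
qed

lemma cosh_le_exp_square: "(exp x + exp (- x)) / 2 \<le> exp (x\<^sup>2)" for x :: real
proof -
  have main: "(exp y + exp (- y)) / 2 \<le> exp (y\<^sup>2)" if "0 \<le> y" for y :: real
  proof (cases "y \<le> 1")
    case True
    have "exp y \<le> 1 + y + y\<^sup>2"
      using that True by (rule exp_bound)
    moreover have "exp (- y) \<le> 1 - y + y\<^sup>2"
    proof -
      have "1 \<le> (1 + y) * (1 - y + y\<^sup>2)"
        using that by (simp add: algebra_simps power2_eq_square)
      also have "\<dots> \<le> exp y * (1 - y + y\<^sup>2)"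
        using that True exp_ge_add_one_self[of y] by (intro mult_right_mono) auto
      finally show ?thesis
        by (simp add: exp_minus field_simps)
    qed
    ultimately have "(exp y + exp (- y)) / 2 \<le> ((1 + y + y\<^sup>2) + (1 - y + y\<^sup>2)) / 2"
      by (intro divide_right_mono add_mono) auto
    also have "\<dots> = 1 + y\<^sup>2" by simp
    also have "\<dots> \<le> exp (y\<^sup>2)" by (rule exp_ge_add_one_self)
    finally show ?thesis .
  next
    case False
    then have "y * 1 \<le> y * y" by (intro mult_left_mono) auto
    then have "exp y \<le> exp (y\<^sup>2)" by (simp add: power2_eq_square)
    moreover have "exp (- y) \<le> exp y" using that by simp
    ultimately have "exp y + exp (- y) \<le> exp (y\<^sup>2) + exp (y\<^sup>2)" by (meson add_mono order_trans)
    then show ?thesis by simp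
  qed
  show ?thesis
    using main[of "\<bar>x\<bar>"] by (cases "0 \<le> x") (auto simp: add.commute)
qed

text \<open>
  The exponential moment of a sum of independent signs is a product of hyperbolic cosines.
\<close>

lemma rad_exp_le:
  fixes xs :: "real list"
  shows "rad xs (\<lambda>s. exp (c * s)) \<le> exp (c\<^sup>2 * sqsum xs)"
proof (induction xs)
  case (Cons x xs)
  have "exp (c * (s + x)) = exp (c * x) * exp (c * s)"
    "exp (c * (s - x)) = exp (- (c * x)) * exp (c * s)" for s
    by (auto simp: distrib_left right_diff_distrib exp_add[symmetric])
  then have "rad (x # xs) (\<lambda>s. exp (c * s)) = (exp (c * x) + exp (- (c * x))) / 2 * rad xs (\<lambda>s. exp (c * s))"
    by (simp add: rad_cmult add_divide_distrib distrib_right)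
  also have "\<dots> \<le> exp ((c * x)\<^sup>2) * exp (c\<^sup>2 * sqsum xs)"
    using cosh_le_exp_square[of "c * x"] Cons by (intro mult_mono rad_nonneg) auto
  finally show ?case
    by (simp add: power_mult_distrib distrib_left exp_add)
qed simp

text \<open>
  After scaling to \<open>\<sigma> = 1\<close>, the function \<open>\<bar>s\<bar> powr q\<close> is dominated by \<open>exp s + exp (- s)\<close> up to
  the factor \<open>q powr q\<close>.
\<close>

lemma Khintchine_upper_real:
  fixes xs :: "real list"
  assumes "0 < q"
  shows "rad xs (\<lambda>s. \<bar>s\<bar> powr q) \<le> 2 * exp 1 * q powr q * sqsum xs powr (q / 2)"
proof (cases "sqsum xs = 0")
  case True
  then have "\<forall>x\<in>set xs. x = 0"
    by (induction xs) (auto simp: add_nonneg_eq_0_iff)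
  then have "rad xs F = F 0" for F
    by (induction xs arbitrary: F) auto
  then show ?thesis using True by simp
next
  case False
  then have pos: "0 < sqsum xs" using sqsum_nonneg[of xs] by linarith
  define c where "c = 1 / sqrt (sqsum xs)"
  have c: "0 < c" "c\<^sup>2 * sqsum xs = 1" using pos by (auto simp: c_def power_divide)
  have "c powr q * sqsum xs powr (q / 2) = 1"
    using pos by (simp add: c_def powr_divide powr_half_sqrt[symmetric] powr_powr)
  have *: "(c powr q) * \<bar>s\<bar> powr q \<le> q powr q * (exp (c * s) + exp ((- c) * s))" for s
  proof -
    define t where "t = c * \<bar>s\<bar>"
    have t: "0 \<le> t" using c by (simp add: t_def)
    have "(t / q) powr q \<le> exp (t / q) powr q"
    proof (intro powr_mono2)
      show "t / q \<le> exp (t / q)"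
        using exp_ge_add_one_self[of "t / q"] by linarith
    qed (use t assms in auto)
    also have "\<dots> = exp t"
      using assms by (simp add: powr_def)
    finally have "t powr q \<le> q powr q * exp t"
      using t assms by (simp add: powr_divide field_simps)
    also have "exp t \<le> exp (c * s) + exp ((- c) * s)"
      by (cases "0 \<le> s") (auto simp: t_def)
    finally show ?thesis
      using c assms by (simp add: t_def powr_mult)
  qed
  have "c powr q * rad xs (\<lambda>s. \<bar>s\<bar> powr q) \<le> rad xs (\<lambda>s. q powr q * (exp (c * s) + exp ((- c) * s)))"
    unfolding rad_cmult[symmetric] by (rule rad_mono_UNIV[OF *])
  also have "\<dots> = q powr q * (rad xs (\<lambda>s. exp (c * s)) + rad xs (\<lambda>s. exp ((- c) * s)))"
    by (simp only: rad_add rad_cmult)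
  also have "\<dots> \<le> q powr q * (exp 1 + exp 1)"
    using rad_exp_le[of xs c] rad_exp_le[of xs "- c"] c by (intro mult_left_mono add_mono) auto
  finally have "sqsum xs powr (q / 2) * (c powr q * rad xs (\<lambda>s. \<bar>s\<bar> powr q)) \<le>
      sqsum xs powr (q / 2) * (q powr q * (exp 1 + exp 1))"
    by (intro mult_left_mono) auto
  moreover have "sqsum xs powr (q / 2) * (c powr q * rad xs (\<lambda>s. \<bar>s\<bar> powr q)) =
      (c powr q * sqsum xs powr (q / 2)) * rad xs (\<lambda>s. \<bar>s\<bar> powr q)"
    by (simp only: mult_ac)
  moreover have "sqsum xs powr (q / 2) * (q powr q * (exp 1 + exp 1)) = 2 * exp 1 * q powr q * sqsum xs powr (q / 2)"
    by (simp only: mult_2 distrib_left distrib_right mult_ac)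
  ultimately show ?thesis
    unfolding \<open>c powr q * sqsum xs powr (q / 2) = 1\<close> by (simp only: mult_1)
qed

lemma sum_powr_le:
  fixes f :: "'i \<Rightarrow> real"
  assumes "finite I" "0 < q" "\<And>i. i \<in> I \<Longrightarrow> 0 \<le> f i"
  shows "(\<Sum>i\<in>I. f i) powr q \<le> real (card I) powr q * (\<Sum>i\<in>I. f i powr q)"
proof (cases "I = {}")
  case False
  define M where "M = Max (f ` I)"
  have M: "f i \<le> M" if "i \<in> I" for i
    using that assms(1) by (simp add: M_def)
  obtain j where j: "j \<in> I" "M = f j"
  proof -
    have "M \<in> f ` I"
      unfolding M_def using False assms(1) by (intro Max_in) auto
    then show ?thesis using that by blast
  qed
  have "(\<Sum>i\<in>I. f i) \<le> real (card I) * M"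
    using sum_bounded_above[of I f M] M by simp
  then have "(\<Sum>i\<in>I. f i) powr q \<le> (real (card I) * M) powr q"
    using assms by (intro powr_mono2 sum_nonneg) auto
  also have "\<dots> = real (card I) powr q * f j powr q"
    using j assms(3)[OF j(1)] by (simp add: powr_mult)
  also have "f j powr q \<le> (\<Sum>i\<in>I. f i powr q)"
    using assms j by (intro member_le_sum) auto
  finally show ?thesis by (simp add: mult_left_mono)
qed simp

text \<open>
  Reduction to the real case through the real coordinates of the vectors.
\<close>

lemma Khintchine_upper:
  assumes "0 < q"
  shows "\<exists>C>0. \<forall>xs :: 'v::euclidean_space list. rad xs (\<lambda>s. norm s powr q) \<le> C * sqsum xs powr (q / 2)"
proof (intro exI conjI allI)
  let ?d = "real DIM('v)"
  let ?K = "2 * exp 1 * q powr q :: real"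
  show "0 < ?d powr q * (?d * ?K)"
    using assms by simp
  fix xs :: "'v list"
  have comp: "rad xs (\<lambda>s. \<bar>inner s b\<bar> powr q) \<le> ?K * sqsum xs powr (q / 2)" if b: "b \<in> Basis" for b
  proof -
    have "rad xs (\<lambda>s. \<bar>inner s b\<bar> powr q) = rad (map (\<lambda>x. inner x b) xs) (\<lambda>s. \<bar>s\<bar> powr q)"
      by (rule rad_map[of UNIV, symmetric]) (auto simp: add_subgroup_def inner_add_left inner_diff_left)
    also have "\<dots> \<le> ?K * sqsum (map (\<lambda>x. inner x b) xs) powr (q / 2)"
      by (rule Khintchine_upper_real[OF assms])
    also have "sqsum (map (\<lambda>x. inner x b) xs) \<le> sqsum xs"
    proof (induction xs)
      case (Cons x xs)
      have "\<bar>inner x b\<bar> \<le> norm x" using b by (rule Basis_le_norm)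
      then have "(norm (inner x b))\<^sup>2 \<le> (norm x)\<^sup>2" by (intro power_mono) auto
      with Cons show ?case by simp
    qed simp
    then have "?K * sqsum (map (\<lambda>x. inner x b) xs) powr (q / 2) \<le> ?K * sqsum xs powr (q / 2)"
      using assms by (intro mult_left_mono powr_mono2) auto
    finally show ?thesis .
  qed
  have "norm s powr q \<le> ?d powr q * (\<Sum>b\<in>Basis. \<bar>inner s b\<bar> powr q)" for s :: 'v
  proof -
    have "norm s powr q \<le> (\<Sum>b\<in>Basis. \<bar>inner s b\<bar>) powr q"
      using assms by (intro powr_mono2 norm_le_l1) auto
    also have "\<dots> \<le> ?d powr q * (\<Sum>b\<in>Basis. \<bar>inner s b\<bar> powr q)"
      using assms by (intro sum_powr_le) auto
    finally show ?thesis .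
  qed
  then have "rad xs (\<lambda>s. norm s powr q) \<le> rad xs (\<lambda>s. ?d powr q * (\<Sum>b\<in>Basis. \<bar>inner s b\<bar> powr q))"
    by (rule rad_mono_UNIV)
  also have "\<dots> = ?d powr q * (\<Sum>b\<in>Basis. rad xs (\<lambda>s. \<bar>inner s b\<bar> powr q))"
    by (simp only: rad_cmult rad_sum)
  also have "\<dots> \<le> ?d powr q * (\<Sum>b\<in>(Basis::'v set). ?K * sqsum xs powr (q / 2))"
    by (intro mult_left_mono sum_mono comp) auto
  also have "\<dots> = ?d powr q * (?d * ?K) * sqsum xs powr (q / 2)"
    by simp
  finally show "rad xs (\<lambda>s. norm s powr q) \<le> ?d powr q * (?d * ?K) * sqsum xs powr (q / 2)" .
qed

section \<open>Maurey's extension theorem by weights\<close>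

text \<open>
  The tangent inequality for the convex function \<open>t powr r\<close> at \<open>u\<close>. It is used both for the
  first-order condition at a minimum and to bound the resulting functional.
\<close>

lemma Young_powr:
  fixes u a r :: real
  assumes "1 < r" "0 \<le> u" "0 \<le> a"
  shows "r * (u powr (r - 1) * a) \<le> (r - 1) * u powr r + a powr r"
proof -
  define r' where "r' = r / (r - 1)"
  have r': "1 < r'" "1 / r' + 1 / r = 1" "(r - 1) * r' = r" "r / r' = r - 1"
    using assms(1) by (auto simp: r'_def field_simps)
  have "u powr (r - 1) * a \<le> (u powr (r - 1)) powr r' / r' + a powr r / r"
    using assms r' by (intro Youngs_inequality) auto
  also have "(u powr (r - 1)) powr r' = u powr r"
    using r'(3) by (simp add: powr_powr)
  finally have "r * (u powr (r - 1) * a) \<le> r * (u powr r / r' + a powr r / r)"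
    using assms(1) by (intro mult_left_mono) auto
  also have "\<dots> = (r / r') * u powr r + a powr r"
    using assms(1) by (simp add: distrib_left)
  finally show ?thesis
    unfolding r'(4) .
qed

lemma convergent_coordinates_subsequence:
  fixes b :: "nat \<Rightarrow> 'i \<Rightarrow> real"
  assumes "finite J" "\<And>n l. l \<in> J \<Longrightarrow> \<bar>b n l\<bar> \<le> M"
  shows "\<exists>s L. strict_mono (s :: nat \<Rightarrow> nat) \<and> (\<forall>l\<in>J. (\<lambda>n. b (s n) l) \<longlonglongrightarrow> L l)"
  using assms
proof (induction J)
  case empty
  show ?case by (rule exI[of _ id]) (auto simp: strict_mono_def)
next
  case (insert a J)
  then obtain s L where s: "strict_mono (s :: nat \<Rightarrow> nat)" "\<And>l. l \<in> J \<Longrightarrow> (\<lambda>n. b (s n) l) \<longlonglongrightarrow> L l"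
    by blast
  have "bounded (range (\<lambda>n. b (s n) a))"
    using insert.prems by (intro boundedI[of _ M]) auto
  then obtain r l where r: "strict_mono (r :: nat \<Rightarrow> nat)" "((\<lambda>n. b (s n) a) \<circ> r) \<longlonglongrightarrow> l"
    using bounded_imp_convergent_subsequence by blast
  have "strict_mono (s \<circ> r)"
    using s(1) r(1) by (rule strict_mono_o)
  moreover have "(\<lambda>n. b ((s \<circ> r) n) i) \<longlonglongrightarrow> (L(a := l)) i" if "i \<in> insert a J" for i
  proof (cases "i = a")
    case True
    then show ?thesis using r(2) by (simp add: o_def)
  next
    case False
    then show ?thesis
      using LIMSEQ_subseq_LIMSEQ[OF s(2) r(1), of i] that by (simp add: o_def)
  qed
  ultimately show ?case by blast
qed

text \<open>
  Let \<open>L\<close> be a point of smallest \<open>\<ell>\<^sub>r\<close> norm in the closure of the convex set \<open>B\<close>. The gradient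
  \<open>L powr (r - 1)\<close> of the \<open>r\<close>-th power of the norm is, after normalisation, at least \<open>1\<close> on \<open>B\<close>
  because \<open>L\<close> is a minimum, and at most \<open>1\<close> on the ball of radius \<open>c powr (1 / r)\<close> by duality.
\<close>

lemma supporting_weights:
  fixes B :: "('i \<Rightarrow> real) set"
  assumes J: "finite J" and "B \<noteq> {}" "1 \<le> r" "0 < c"
    and nonneg: "\<And>b l. b \<in> B \<Longrightarrow> l \<in> J \<Longrightarrow> 0 \<le> b l"
    and conv: "\<And>b b' t. b \<in> B \<Longrightarrow> b' \<in> B \<Longrightarrow> 0 \<le> t \<Longrightarrow> t \<le> 1 \<Longrightarrow> (\<lambda>l. (1 - t) * b l + t * b' l) \<in> B"
    and lower: "\<And>b. b \<in> B \<Longrightarrow> c \<le> (\<Sum>l\<in>J. b l powr r)"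
  shows "\<exists>h. (\<forall>l. 0 \<le> h l) \<and> (\<forall>b\<in>B. 1 \<le> (\<Sum>l\<in>J. h l * b l)) \<and>
    (\<forall>w. (\<forall>l\<in>J. 0 \<le> w l) \<and> (\<Sum>l\<in>J. w l powr r) \<le> c \<longrightarrow> (\<Sum>l\<in>J. h l * w l) \<le> 1)"
proof (cases "r = 1")
  case True
  show ?thesis
  proof (intro exI[of _ "\<lambda>_. 1 / c"] conjI ballI allI impI)
    fix b assume b: "b \<in> B"
    have "c \<le> (\<Sum>l\<in>J. b l)"
      using lower[OF b] nonneg[OF b] True by simp
    then show "1 \<le> (\<Sum>l\<in>J. 1 / c * b l)"
      using \<open>0 < c\<close> by (simp flip: sum_divide_distrib)
  next
    fix w :: "'i \<Rightarrow> real" assume w: "(\<forall>l\<in>J. 0 \<le> w l) \<and> (\<Sum>l\<in>J. w l powr r) \<le> c"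
    moreover have "(\<Sum>l\<in>J. w l powr r) = (\<Sum>l\<in>J. w l)"
      using True w by (intro sum.cong) auto
    ultimately have "(\<Sum>l\<in>J. w l) \<le> c"
      by simp
    then show "(\<Sum>l\<in>J. 1 / c * w l) \<le> 1"
      using \<open>0 < c\<close> by (simp flip: sum_divide_distrib)
  qed (use \<open>0 < c\<close> in auto)
next
  case False
  then have r: "1 < r" using assms by simp
  define N where "N = (\<lambda>b. \<Sum>l\<in>J. b l powr r)"
  define m where "m = (INF b\<in>B. N b)"
  have bdd: "bdd_below (N ` B)"
    using lower by (intro bdd_belowI2[of _ c]) (auto simp: N_def)
  have m_le: "m \<le> N b" if "b \<in> B" for b
    unfolding m_def using bdd that by (rule cINF_lower)
  \<comment> \<open>This is what makes the ball of radius \<open>c powr (1 / r)\<close> lie within the one that the weights bound.\<close>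
  have cm: "c \<le> m"
    unfolding m_def using \<open>B \<noteq> {}\<close> lower by (intro cINF_greatest) (auto simp: N_def)
  have "\<exists>b\<in>B. N b < m + 1 / real (Suc n)" for n
    unfolding m_def using \<open>B \<noteq> {}\<close> bdd by (subst cINF_less_iff[symmetric]) auto
  then obtain b where b: "\<And>n. b n \<in> B" "\<And>n. N (b n) < m + 1 / real (Suc n)" by metis
  have "\<bar>b n l\<bar> \<le> (m + 1) powr (1 / r)" if l: "l \<in> J" for n l
  proof -
    have "b n l powr r \<le> N (b n)"
      unfolding N_def using J l by (intro member_le_sum) auto
    also have "\<dots> \<le> m + 1"
      using b(2)[of n] by (smt (verit) divide_le_eq_1_pos of_nat_0_less_iff of_nat_Suc of_nat_0_le_iff zero_less_Suc)
    finally have "(b n l powr r) powr (1 / r) \<le> (m + 1) powr (1 / r)"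
      using r by (intro powr_mono2) auto
    then show ?thesis
      using r nonneg[OF b(1) l, of n] by (simp add: powr_powr)
  qed
  then obtain s L where s: "strict_mono (s :: nat \<Rightarrow> nat)" "\<And>l. l \<in> J \<Longrightarrow> (\<lambda>n. b (s n) l) \<longlonglongrightarrow> L l"
    using convergent_coordinates_subsequence[OF J, of b "(m + 1) powr (1 / r)"] by blast
  have L0: "0 \<le> L l" if "l \<in> J" for l
    using s(2)[OF that] nonneg[OF b(1) that] by (intro LIMSEQ_le_const) auto
  have lim: "(\<lambda>n. N (\<lambda>l. (1 - t) * b (s n) l + t * b' l)) \<longlonglongrightarrow> N (\<lambda>l. (1 - t) * L l + t * b' l)"
    if "0 \<le> t" "t \<le> 1" "\<And>l. l \<in> J \<Longrightarrow> 0 \<le> b' l" for t b'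
    unfolding N_def using that s(2) nonneg[OF b(1)] r
    by (intro tendsto_sum tendsto_powr2 tendsto_intros always_eventually) auto
  have NL: "N L = m"
  proof (rule LIMSEQ_unique)
    show "(\<lambda>n. N (b (s n))) \<longlonglongrightarrow> N L"
      using lim[of 0 "\<lambda>_. 0"] by simp
    have "(\<lambda>n. m + 1 / real (Suc n)) \<longlonglongrightarrow> m + 0"
      by (intro tendsto_intros LIMSEQ_Suc lim_1_over_n)
    then have "(\<lambda>n. N (b n)) \<longlonglongrightarrow> m"
      using m_le b by (intro tendsto_sandwich[of "\<lambda>_. m" "\<lambda>n. N (b n)" _ "\<lambda>n. m + 1 / real (Suc n)"])
         (auto intro!: always_eventually less_imp_le)
    then show "(\<lambda>n. N (b (s n))) \<longlonglongrightarrow> m"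
      using LIMSEQ_subseq_LIMSEQ[OF _ s(1)] by (auto simp: o_def)
  qed
  have main: "m \<le> (\<Sum>l\<in>J. L l powr (r - 1) * b' l)" if b': "b' \<in> B" for b'
  proof -
    define u where "u = (\<lambda>t l. (1 - t) * L l + t * b' l)"
    \<comment> \<open>The first-order condition at \<open>L\<close> is the limit for \<open>t \<rightarrow> 0\<close> of the conditions at the points \<open>u t\<close>.\<close>
    have step: "0 \<le> (\<Sum>l\<in>J. u t l powr (r - 1) * (b' l - L l))" if t: "0 < t" "t \<le> 1" for t
    proof -
      have u0: "0 \<le> u t l" if "l \<in> J" for l
        using t L0[OF that] nonneg[OF b' that] by (simp add: u_def)
      have "m \<le> N (u t)"
        unfolding u_def using lim[of t b'] t nonneg[OF b'] m_le conv[OF b(1) b', of t]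
        by (intro LIMSEQ_le_const[OF lim]) auto
      then have "0 \<le> (\<Sum>l\<in>J. u t l powr r - L l powr r)"
        unfolding sum_subtractf using NL by (simp add: N_def)
      also have "\<dots> \<le> (\<Sum>l\<in>J. r * t * (u t l powr (r - 1) * (b' l - L l)))"
      proof (rule sum_mono)
        fix l assume l: "l \<in> J"
        have "u t l powr r = u t l powr (r - 1) * u t l"
          using u0[OF l] r by (cases "u t l = 0") (auto simp: powr_diff)
        then have "u t l powr r - L l powr r \<le> r * (u t l powr (r - 1) * (u t l - L l))"
          using Young_powr[OF r u0[OF l] L0[OF l]] by (simp add: algebra_simps)
        also have "u t l - L l = t * (b' l - L l)"
          by (simp add: u_def algebra_simps)
        finally show "u t l powr r - L l powr r \<le> r * t * (u t l powr (r - 1) * (b' l - L l))"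
          by (simp add: mult_ac)
      qed
      also have "\<dots> = r * t * (\<Sum>l\<in>J. u t l powr (r - 1) * (b' l - L l))"
        by (simp add: sum_distrib_left)
      finally have "0 \<le> r * t * (\<Sum>l\<in>J. u t l powr (r - 1) * (b' l - L l))" .
      moreover have "0 < r * t" using r t by simp
      ultimately show ?thesis
        using iffD1[OF zero_le_mult_iff] by fastforce
    qed
    have "(\<lambda>n. \<Sum>l\<in>J. u (1 / real (Suc n)) l powr (r - 1) * (b' l - L l)) \<longlonglongrightarrow>
        (\<Sum>l\<in>J. ((1 - 0) * L l + 0 * b' l) powr (r - 1) * (b' l - L l))"
      unfolding u_def using L0 nonneg[OF b'] r
      by (intro tendsto_sum tendsto_mult tendsto_powr2 tendsto_intros LIMSEQ_Suc lim_1_over_n always_eventually allI)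
         (auto intro!: add_nonneg_nonneg mult_nonneg_nonneg simp: divide_le_eq)
    then have "0 \<le> (\<Sum>l\<in>J. ((1 - 0) * L l + 0 * b' l) powr (r - 1) * (b' l - L l))"
      by (rule LIMSEQ_le_const) (auto intro!: step)
    also have "\<dots> = (\<Sum>l\<in>J. L l powr (r - 1) * b' l - L l powr r)"
    proof (rule sum.cong[OF refl])
      fix l assume "l \<in> J"
      then show "((1 - 0) * L l + 0 * b' l) powr (r - 1) * (b' l - L l) = L l powr (r - 1) * b' l - L l powr r"
        using L0[of l] r by (cases "L l = 0") (auto simp: powr_diff field_simps)
    qed
    finally show ?thesis
      using NL by (simp add: sum_subtractf N_def)
  qed
  have m0: "0 < m" using cm \<open>0 < c\<close> by simp
  show ?thesis
  proof (intro exI[of _ "\<lambda>l. L l powr (r - 1) / m"] conjI ballI allI impI)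
    show "1 \<le> (\<Sum>l\<in>J. L l powr (r - 1) / m * b' l)" if "b' \<in> B" for b'
      using main[OF that] m0 by (simp flip: sum_divide_distrib)
  next
    fix w :: "'i \<Rightarrow> real" assume w: "(\<forall>l\<in>J. 0 \<le> w l) \<and> (\<Sum>l\<in>J. w l powr r) \<le> c"
    have "r * (\<Sum>l\<in>J. L l powr (r - 1) * w l) \<le> (\<Sum>l\<in>J. (r - 1) * L l powr r + w l powr r)"
      unfolding sum_distrib_left using Young_powr[OF r L0] w by (intro sum_mono) auto
    also have "\<dots> = (r - 1) * N L + (\<Sum>l\<in>J. w l powr r)"
      by (simp add: N_def sum.distrib sum_distrib_left)
    also have "\<dots> \<le> (r - 1) * m + m"
      using w cm NL by simp
    also have "\<dots> = r * m" by (simp add: algebra_simps)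
    finally have "(\<Sum>l\<in>J. L l powr (r - 1) * w l) \<le> m"
      using r by simp
    then show "(\<Sum>l\<in>J. L l powr (r - 1) / m * w l) \<le> 1"
      using m0 by (simp flip: sum_divide_distrib)
  qed (use m0 in auto)
qed

definition linear_on :: "(nat \<Rightarrow> 'k::{real_normed_field, euclidean_space}) set \<Rightarrow> ((nat \<Rightarrow> 'k) \<Rightarrow> nat \<Rightarrow> 'k) \<Rightarrow> bool" where
  "linear_on E X \<longleftrightarrow> (\<forall>x\<in>E. \<forall>y\<in>E. X (x + y) = X x + X y) \<and>
     (\<forall>c. \<forall>x\<in>E. X (seq_scale c x) = seq_scale c (X x))"

lemma subspace_add_subgroup: "seq.subspace E \<Longrightarrow> add_subgroup E"
  unfolding add_subgroup_def
  by (intro conjI ballI seq.subspace_0 seq.subspace_add seq.subspace_diff)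

lemma linear_onD:
  assumes "linear_on E X"
  shows "x \<in> E \<Longrightarrow> y \<in> E \<Longrightarrow> X (x + y) = X x + X y"
    and "x \<in> E \<Longrightarrow> X (seq_scale c x) = seq_scale c (X x)"
  using assms unfolding linear_on_def by blast+

lemma linear_on_diff:
  assumes "linear_on E X" "seq.subspace E" "x \<in> E" "y \<in> E"
  shows "X (x - y) = X x - X y"
  unfolding minus_eq_seq_scale
  unfolding linear_onD(1)[OF assms(1,3) seq.subspace_scale[OF assms(2,4)]] linear_onD(2)[OF assms(1,4)] ..

lemma linear_on_zero:
  assumes "linear_on E X" "seq.subspace E"
  shows "X 0 = 0"
  using linear_on_diff[OF assms seq.subspace_0[OF assms(2)] seq.subspace_0[OF assms(2)]] by simp

lemma rad_coordinate:
  assumes "linear_on E X" "seq.subspace E" "set xs \<subseteq> E"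
  shows "rad (map (\<lambda>x. X x i) xs) F = rad xs (\<lambda>s. F (X s i))"
proof (rule rad_map[OF subspace_add_subgroup[OF assms(2)] assms(3)])
  show "X 0 i = 0" unfolding linear_on_zero[OF assms(1,2)] by simp
  show "X (x + y) i = X x i + X y i" if "x \<in> E" "y \<in> E" for x y
    unfolding linear_onD(1)[OF assms(1) that] by simp
  show "X (x - y) i = X x i - X y i" if "x \<in> E" "y \<in> E" for x y
    unfolding linear_on_diff[OF assms(1,2) that] by simp
qed

lemma sqsum_coordinate_scale:
  assumes "linear_on E X" "set xs \<subseteq> E"
  shows "sqsum (map (\<lambda>x. X x i) (map (seq_scale c) xs)) = (norm c)\<^sup>2 * sqsum (map (\<lambda>x. X x i) xs)"
  using assms(2)
proof (induction xs)
  case (Cons x xs)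
  then have "X (seq_scale c x) i = c * X x i"
    using linear_onD(2)[OF assms(1), of x c] by (simp add: seq_scale_def)
  with Cons show ?case
    by (simp add: norm_mult power_mult_distrib distrib_left)
qed simp

text \<open>
  Khintchine's inequalities exchange square functions and averages over signs, and the hypothesis
  is applied to each signed sum. This is the combination of cotype 2 on the side of \<open>X\<close> and type 2
  on the side of \<open>Z\<close>.
\<close>

lemma square_function_inequality:
  fixes X Z :: "(nat \<Rightarrow> 'k::{real_normed_field, euclidean_space}) \<Rightarrow> nat \<Rightarrow> 'k"
  assumes "0 < p" "p \<le> 2" "p \<le> q" "0 \<le> D" "0 \<le> C"
    and upper: "\<And>xs :: 'k list. rad xs (\<lambda>s. norm s powr q) \<le> C * sqsum xs powr (q / 2)"
    and E: "seq.subspace E" "linear_on E X" "linear_on E Z" "set xs \<subseteq> E"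
    and le: "\<And>x. x \<in> E \<Longrightarrow> (\<Sum>i\<in>I. norm (X x i) powr p) \<le> D * (\<Sum>l\<in>J. norm (Z x l) powr q) powr (p / q)"
  shows "(\<Sum>i\<in>I. sqsum (map (\<lambda>x. X x i) xs) powr (p / 2)) \<le>
    4 * D * (C * (\<Sum>l\<in>J. sqsum (map (\<lambda>x. Z x l) xs) powr (q / 2))) powr (p / q)"
proof -
  have "(\<Sum>i\<in>I. sqsum (map (\<lambda>x. X x i) xs) powr (p / 2)) \<le>
      (\<Sum>i\<in>I. 4 * rad xs (\<lambda>s. norm (X s i) powr p))"
    using assms rad_coordinate[OF E(2,1,4), of _ "\<lambda>s. norm s powr p"]
      Khintchine_lower[of p "map (\<lambda>x. X x _) xs"] by (intro sum_mono) simp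
  also have "\<dots> = 4 * rad xs (\<lambda>s. \<Sum>i\<in>I. norm (X s i) powr p)"
    by (simp only: rad_sum sum_distrib_left)
  also have "\<dots> \<le> 4 * rad xs (\<lambda>s. D * (\<Sum>l\<in>J. norm (Z s l) powr q) powr (p / q))"
    using rad_mono[OF subspace_add_subgroup[OF E(1)] E(4) le] by simp
  also have "\<dots> = 4 * D * rad xs (\<lambda>s. (\<Sum>l\<in>J. norm (Z s l) powr q) powr (p / q))"
    by (simp only: rad_cmult mult.assoc)
  also have "\<dots> \<le> 4 * D * rad xs (\<lambda>s. \<Sum>l\<in>J. norm (Z s l) powr q) powr (p / q)"
    using assms by (intro mult_left_mono rad_powr_le sum_nonneg) auto
  also have "rad xs (\<lambda>s. \<Sum>l\<in>J. norm (Z s l) powr q) = (\<Sum>l\<in>J. rad (map (\<lambda>x. Z x l) xs) (\<lambda>s. norm s powr q))"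
    unfolding rad_coordinate[OF E(3,1,4)] by (simp only: rad_sum)
  also have "4 * D * (\<Sum>l\<in>J. rad (map (\<lambda>x. Z x l) xs) (\<lambda>s. norm s powr q)) powr (p / q) \<le>
      4 * D * (\<Sum>l\<in>J. C * sqsum (map (\<lambda>x. Z x l) xs) powr (q / 2)) powr (p / q)"
    using assms by (intro mult_left_mono powr_mono2 sum_mono upper sum_nonneg rad_nonneg) auto
  finally show ?thesis
    by (simp only: sum_distrib_left)
qed

text \<open>
  If \<open>Z\<close> dominates \<open>X\<close> on \<open>E\<close> from \<open>\<ell>\<^sub>q\<close> to \<open>\<ell>\<^sub>p\<close>, then the passage from \<open>Z x\<close> to \<open>X x\<close> factors
  through multiplication by \<open>sqrt h\<close>, which maps all of \<open>\<ell>\<^sub>q\<close> to \<open>\<ell>\<^sub>2\<close>. What matters is that \<open>c\<close>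
  depends neither on the index sets nor on the dimension of \<open>E\<close>. The weights support the set of
  squared square functions of \<open>Z\<close> over all finite families in \<open>E\<close> whose square function under \<open>X\<close>
  is not small. That set is convex because families may be scaled and concatenated and because
  \<open>t powr (p / 2)\<close> is concave.
\<close>

lemma Maurey_weights:
  fixes p q D :: real
  assumes "0 < p" "p \<le> 2" "2 \<le> q" "0 < D"
  obtains c where "0 < c"
    and "\<And>(E :: (nat \<Rightarrow> 'k::{real_normed_field, euclidean_space}) set) X Z I J.
      seq.subspace E \<Longrightarrow> linear_on E X \<Longrightarrow> linear_on E Z \<Longrightarrow> finite J \<Longrightarrow>
      (\<And>x. x \<in> E \<Longrightarrow> (\<Sum>i\<in>I. norm (X x i) powr p) \<le> D * (\<Sum>l\<in>J. norm (Z x l) powr q) powr (p / q)) \<Longrightarrow>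
      \<exists>h. (\<forall>l. 0 \<le> h l) \<and>
        (\<forall>x\<in>E. (\<Sum>i\<in>I. norm (X x i) powr p) powr (2 / p) \<le> (\<Sum>l\<in>J. h l * (norm (Z x l))\<^sup>2)) \<and>
        (\<forall>z :: nat \<Rightarrow> 'k. (\<Sum>l\<in>J. h l * (norm (z l))\<^sup>2) \<le> c * (\<Sum>l\<in>J. norm (z l) powr q) powr (2 / q))"
proof -
  have q: "0 < q" "p \<le> q" using assms by auto
  obtain C where C: "0 < C" "\<And>xs :: 'k list. rad xs (\<lambda>s. norm s powr q) \<le> C * sqsum xs powr (q / 2)"
    using Khintchine_upper[OF q(1), where 'v='k] by blast
  define c0 where "c0 = (1 / (4 * D)) powr (q / p) / C"
  have c0: "0 < c0" using C assms by (simp add: c0_def)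
  show ?thesis
  proof (rule that[of "(1 / c0) powr (2 / q)"])
    show "0 < (1 / c0) powr (2 / q)" using c0 by simp
    fix E :: "(nat \<Rightarrow> 'k) set" and X Z :: "(nat \<Rightarrow> 'k) \<Rightarrow> nat \<Rightarrow> 'k" and I J :: "nat set"
    assume E: "seq.subspace E" and X: "linear_on E X" and Z: "linear_on E Z" and J: "finite J"
      and le: "\<And>x. x \<in> E \<Longrightarrow> (\<Sum>i\<in>I. norm (X x i) powr p) \<le> D * (\<Sum>l\<in>J. norm (Z x l) powr q) powr (p / q)"
    define \<beta> where "\<beta> = (\<lambda>xs l. sqsum (map (\<lambda>x. Z x l) xs))"
    define \<alpha> where "\<alpha> = (\<lambda>xs. \<Sum>i\<in>I. sqsum (map (\<lambda>x. X x i) xs) powr (p / 2))"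
    define B where "B = \<beta> ` {xs. set xs \<subseteq> E \<and> 1 \<le> \<alpha> xs}"
    have lower: "c0 \<le> (\<Sum>l\<in>J. b l powr (q / 2))" if "b \<in> B" for b
    proof -
      obtain xs where xs: "set xs \<subseteq> E" "1 \<le> \<alpha> xs" "b = \<beta> xs"
        using \<open>b \<in> B\<close> by (auto simp: B_def)
      define S where "S = (\<Sum>l\<in>J. b l powr (q / 2))"
      have "1 \<le> 4 * D * (C * S) powr (p / q)"
        using square_function_inequality[OF _ _ q(2) _ _ C(2) E X Z xs(1) le] assms C xs
        by (simp add: \<alpha>_def \<beta>_def S_def)
      then have "1 / (4 * D) \<le> (C * S) powr (p / q)"
        using assms by (simp add: field_simps)
      then have "(1 / (4 * D)) powr (q / p) \<le> ((C * S) powr (p / q)) powr (q / p)"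
        using assms q by (intro powr_mono2) auto
      moreover have "0 \<le> C * S" using C by (simp add: S_def sum_nonneg)
      ultimately have "(1 / (4 * D)) powr (q / p) \<le> C * S"
        using assms q by (simp add: powr_powr)
      then show ?thesis
        using C by (simp add: c0_def S_def field_simps)
    qed
    have conv: "(\<lambda>l. (1 - t) * b l + t * b' l) \<in> B" if b: "b \<in> B" "b' \<in> B" and t: "0 \<le> t" "t \<le> 1" for b b' t
    proof -
      obtain xs ys where xs: "set xs \<subseteq> E" "1 \<le> \<alpha> xs" "b = \<beta> xs" and ys: "set ys \<subseteq> E" "1 \<le> \<alpha> ys" "b' = \<beta> ys"
        using b by (auto simp: B_def)
      \<comment> \<open>The factors are square roots since square functions are quadratic.\<close>
      define zs where "zs = map (seq_scale (of_real (sqrt (1 - t)))) xs @ map (seq_scale (of_real (sqrt t))) ys"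
      have zs: "set zs \<subseteq> E"
        unfolding zs_def using xs(1) ys(1) seq.subspace_scale[OF E] by auto
      have comb: "sqsum (map (\<lambda>x. L x i) zs) = (1 - t) * sqsum (map (\<lambda>x. L x i) xs) + t * sqsum (map (\<lambda>x. L x i) ys)"
        if "linear_on E L" for L i
        unfolding zs_def map_append sqsum_simps sqsum_coordinate_scale[OF that xs(1)]
          sqsum_coordinate_scale[OF that ys(1)] using t by simp
      have "1 \<le> (1 - t) * \<alpha> xs + t * \<alpha> ys"
        using mult_left_mono[OF xs(2), of "1 - t"] mult_left_mono[OF ys(2), of t] t by simp
      also have "\<dots> \<le> \<alpha> zs"
        unfolding \<alpha>_def comb[OF X] sum_distrib_left sum.distrib[symmetric]
        using assms t by (intro sum_mono powr_concave_comb) auto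
      finally have "\<beta> zs \<in> B"
        using zs by (simp add: B_def)
      moreover have "\<beta> zs = (\<lambda>l. (1 - t) * b l + t * b' l)"
        unfolding \<beta>_def comb[OF Z] xs(3) ys(3) ..
      ultimately show ?thesis by simp
    qed
    obtain h where weights: "(\<forall>l. 0 \<le> h l) \<and> (\<forall>b\<in>B. 1 \<le> (\<Sum>l\<in>J. h l * b l)) \<and>
        (\<forall>w. (\<forall>l\<in>J. 0 \<le> w l) \<and> (\<Sum>l\<in>J. w l powr (q / 2)) \<le> c0 \<longrightarrow> (\<Sum>l\<in>J. h l * w l) \<le> 1)"
    proof (cases "B = {}")
      case True
      then show ?thesis by (intro that[of "\<lambda>_. 0"]) auto
    next
      case False
      have "1 \<le> q / 2" using assms by simp
      moreover have "0 \<le> b l" if "b \<in> B" for b l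
        using that by (auto simp: B_def \<beta>_def)
      ultimately show ?thesis
        using supporting_weights[OF J False _ c0 _ conv lower] that by blast
    qed
    have h: "\<And>l. 0 \<le> h l" "\<And>b. b \<in> B \<Longrightarrow> 1 \<le> (\<Sum>l\<in>J. h l * b l)"
      "\<And>w. (\<And>l. l \<in> J \<Longrightarrow> 0 \<le> w l) \<Longrightarrow> (\<Sum>l\<in>J. w l powr (q / 2)) \<le> c0 \<Longrightarrow> (\<Sum>l\<in>J. h l * w l) \<le> 1"
      for l b w
      using weights by (simp_all only: ball_simps) simp
    have dom: "(\<Sum>i\<in>I. norm (X x i) powr p) powr (2 / p) \<le> (\<Sum>l\<in>J. h l * (norm (Z x l))\<^sup>2)" if x: "x \<in> E" for x
    proof -
      define S where "S = (\<Sum>i\<in>I. norm (X x i) powr p)"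
      show ?thesis
      proof (cases "S = 0")
        case True
        then show ?thesis using h(1) by (simp add: S_def sum_nonneg)
      next
        case False
        then have S: "0 < S" by (simp add: S_def sum_nonneg order_less_le)
        define y where "y = seq_scale (of_real (S powr (- 1 / p))) x"
        have y: "y \<in> E" using seq.subspace_scale[OF E x] by (simp add: y_def)
        have ny: "norm (L y i) = S powr (- 1 / p) * norm (L x i)" if "linear_on E L" for L i
          unfolding y_def linear_onD(2)[OF that x] by (simp add: seq_scale_def norm_mult)
        have sq: "((norm u)\<^sup>2) powr (p / 2) = norm u powr p" for u :: 'k
        proof -
          have "(norm u)\<^sup>2 = norm u powr 2" by (simp add: powr_numeral)
          then show ?thesis by (simp only: powr_powr) simp
        qed
        have "\<alpha> [y] = (\<Sum>i\<in>I. norm (X y i) powr p)"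
          by (simp add: \<alpha>_def sq)
        also have "\<dots> = (S powr (- 1 / p)) powr p * S"
          unfolding ny[OF X] by (simp add: powr_mult S_def sum_distrib_left)
        also have "(S powr (- 1 / p)) powr p = 1 / S"
          using S assms by (simp only: powr_powr) (simp add: powr_neg_one)
        also have "1 / S * S = 1"
          using S by simp
        finally have "\<beta> [y] \<in> B" using y by (simp add: B_def)
        then have "1 \<le> (\<Sum>l\<in>J. h l * (norm (Z y l))\<^sup>2)"
          using h(2)[of "\<beta> [y]"] by (simp add: \<beta>_def)
        also have "\<dots> = (S powr (- 1 / p))\<^sup>2 * (\<Sum>l\<in>J. h l * (norm (Z x l))\<^sup>2)"
          unfolding ny[OF Z] by (simp add: power_mult_distrib sum_distrib_left mult_ac)
        also have "(S powr (- 1 / p))\<^sup>2 = S powr (- (2 / p))"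
          by (simp add: power2_eq_square flip: powr_add)
        finally show ?thesis
          using S by (simp add: S_def[symmetric] powr_minus field_simps)
      qed
    qed
    have bound: "(\<Sum>l\<in>J. h l * (norm (z l))\<^sup>2) \<le> (1 / c0) powr (2 / q) * (\<Sum>l\<in>J. norm (z l) powr q) powr (2 / q)"
      for z :: "nat \<Rightarrow> 'k"
    proof -
      define S where "S = (\<Sum>l\<in>J. norm (z l) powr q)"
      show ?thesis
      proof (cases "S = 0")
        case True
        then have "norm (z l) powr q = 0" if "l \<in> J" for l
          unfolding S_def using J that by (subst (asm) sum_nonneg_eq_0_iff) auto
        then show ?thesis using True by (simp add: S_def[symmetric])
      next
        case False
        then have S: "0 < S" by (simp add: S_def sum_nonneg order_less_le)
        define a where "a = (c0 / S) powr (2 / q)"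
        have a: "0 < a" using S c0 by (simp add: a_def)
        have sq: "((norm u)\<^sup>2) powr (q / 2) = norm u powr q" for u :: 'k
        proof -
          have "(norm u)\<^sup>2 = norm u powr 2" by (simp add: powr_numeral)
          then show ?thesis by (simp only: powr_powr) simp
        qed
        have "(\<Sum>l\<in>J. (a * (norm (z l))\<^sup>2) powr (q / 2)) = a powr (q / 2) * S"
          using a by (simp add: powr_mult sq S_def sum_distrib_left)
        also have "\<dots> = c0"
          using q S c0 by (simp add: a_def powr_powr)
        finally have "(\<Sum>l\<in>J. h l * (a * (norm (z l))\<^sup>2)) \<le> 1"
          using a by (intro h(3)) auto
        then have "a * (\<Sum>l\<in>J. h l * (norm (z l))\<^sup>2) \<le> 1"
          by (simp add: sum_distrib_left mult_ac)
        then have "(\<Sum>l\<in>J. h l * (norm (z l))\<^sup>2) \<le> 1 / a"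
          using a by (simp add: field_simps)
        also have "1 / a = (1 / c0) powr (2 / q) * S powr (2 / q)"
          using S c0 by (simp add: a_def powr_divide)
        finally show ?thesis by (simp add: S_def)
      qed
    qed
    show "\<exists>h. (\<forall>l. 0 \<le> h l) \<and>
        (\<forall>x\<in>E. (\<Sum>i\<in>I. norm (X x i) powr p) powr (2 / p) \<le> (\<Sum>l\<in>J. h l * (norm (Z x l))\<^sup>2)) \<and>
        (\<forall>z :: nat \<Rightarrow> 'k. (\<Sum>l\<in>J. h l * (norm (z l))\<^sup>2) \<le>
          (1 / c0) powr (2 / q) * (\<Sum>l\<in>J. norm (z l) powr q) powr (2 / q))"
      using h(1) dom bound by blast
  qed
qed

section \<open>Hilbertian copies inside an operator that is not finitely strictly singular\<close>

definition wform :: "(nat \<Rightarrow> real) \<Rightarrow> nat set \<Rightarrow> (nat \<Rightarrow> 'k::{real_normed_field, euclidean_space}) \<Rightarrow> (nat \<Rightarrow> 'k) \<Rightarrow> 'k" where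
  "wform h J u v = (\<Sum>l\<in>J. of_real (h l) * (u l * conjg (v l)))"

lemma wform_add: "wform h J (u + u') v = wform h J u v + wform h J u' v"
  by (simp add: wform_def distrib_left distrib_right sum.distrib)

lemma wform_scale: "wform h J (seq_scale c u) v = c * wform h J u v"
  by (simp add: wform_def seq_scale_def sum_distrib_left mult_ac)

lemma wform_herm: "wform h J v u = conjg (wform h J u v)"
  by (simp add: wform_def conjg_sum conjg_mult mult_ac)

lemma wform_diag: "wform h J u u = of_real (\<Sum>l\<in>J. h l * (norm (u l))\<^sup>2)"
  by (simp add: wform_def mult_conjg)

lemma wform_sum: "wform h J (\<Sum>i\<in>A. seq_scale (c i) (e i)) v = (\<Sum>i\<in>A. c i * wform h J (e i) v)"
proof -
  have "wform h J (\<Sum>i\<in>A. seq_scale (c i) (e i)) v =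
      (\<Sum>l\<in>J. \<Sum>i\<in>A. c i * (of_real (h l) * (e i l * conjg (v l))))"
    by (simp add: wform_def sum_fun_apply seq_scale_def sum_distrib_left sum_distrib_right mult_ac)
  also have "\<dots> = (\<Sum>i\<in>A. \<Sum>l\<in>J. c i * (of_real (h l) * (e i l * conjg (v l))))"
    by (rule sum.swap)
  finally show ?thesis
    by (simp add: wform_def sum_distrib_left)
qed

lemma wform_Pythagoras:
  fixes y :: "nat \<Rightarrow> 'k::{real_normed_field, euclidean_space}"
  assumes ortho: "\<And>i j. i < M \<Longrightarrow> j < M \<Longrightarrow> wform h J (e i) (e j) = (if i = j then 1 else 0)"
  shows "(\<Sum>l\<in>J. h l * (norm ((\<Sum>j<M. seq_scale (y j) (e j)) l))\<^sup>2) = (\<Sum>j<M. (norm (y j))\<^sup>2)"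
proof -
  define s where "s = (\<Sum>j<M. seq_scale (y j) (e j))"
  have se: "wform h J s (e i) = y i" if "i < M" for i
    unfolding s_def wform_sum by (rule sum_Kronecker[OF that]) (rule ortho[OF _ that])
  have "(of_real (\<Sum>l\<in>J. h l * (norm (s l))\<^sup>2) :: 'k) = (\<Sum>i<M. y i * wform h J (e i) s)"
    unfolding wform_diag[symmetric] by (subst (2) s_def) (rule wform_sum)
  also have "\<dots> = (\<Sum>i<M. y i * conjg (y i))"
    by (intro sum.cong refl arg_cong2[where f="(*)"]) (subst wform_herm, simp add: se)
  also have "\<dots> = of_real (\<Sum>i<M. (norm (y i))\<^sup>2)"
    by (simp add: mult_conjg)
  finally show ?thesis
    by (simp only: of_real_eq_iff s_def)
qed

text \<open>
  The vector \<open>z\<close> is the orthogonal sum of its projection \<open>s\<close> and a remainder \<open>w\<close>.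
\<close>

lemma wform_Bessel:
  fixes z :: "nat \<Rightarrow> 'k::{real_normed_field, euclidean_space}" and e :: "nat \<Rightarrow> nat \<Rightarrow> 'k"
  assumes ortho: "\<And>i j. i < M \<Longrightarrow> j < M \<Longrightarrow> wform h J (e i) (e j) = (if i = j then 1 else 0)"
    and h: "\<And>l. 0 \<le> h l"
  shows "(\<Sum>j<M. (norm (wform h J z (e j)))\<^sup>2) \<le> (\<Sum>l\<in>J. h l * (norm (z l))\<^sup>2)"
proof -
  define A where "A = (\<lambda>j. wform h J z (e j))"
  define s where "s = (\<Sum>j<M. seq_scale (A j) (e j))"
  define w where "w = z - s"
  have z: "z = s + w" by (simp add: w_def)
  have se: "wform h J s (e i) = A i" if "i < M" for i
    unfolding s_def wform_sum by (rule sum_Kronecker[OF that]) (rule ortho[OF _ that])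
  have we: "wform h J w (e i) = 0" if "i < M" for i
    using wform_add[of h J s w "e i"] se[OF that] unfolding z[symmetric] by (simp add: A_def)
  have "wform h J s w = (\<Sum>j<M. A j * wform h J (e j) w)"
    unfolding s_def by (rule wform_sum)
  also have "\<dots> = 0"
    by (intro sum.neutral ballI) (subst wform_herm, simp add: we)
  finally have sw: "wform h J s w = 0" .
  have ws: "wform h J w s = 0"
    by (subst wform_herm) (simp add: sw)
  have "wform h J z z = wform h J s z + wform h J w z"
    by (subst (1) z) (rule wform_add)
  also have "wform h J s z = conjg (wform h J s s + wform h J w s)"
    by (subst wform_herm, subst (1) z, subst wform_add) (rule refl)
  also have "\<dots> = wform h J s s"
    unfolding ws by (simp add: wform_diag flip: of_real_sum of_real_mult)
  also have "wform h J w z = conjg (wform h J s w + wform h J w w)"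
    by (subst wform_herm, subst (1) z, subst wform_add) (rule refl)
  also have "\<dots> = wform h J w w"
    unfolding sw by (simp add: wform_diag flip: of_real_sum of_real_mult)
  finally have "(\<Sum>l\<in>J. h l * (norm (z l))\<^sup>2) = (\<Sum>l\<in>J. h l * (norm (s l))\<^sup>2) + (\<Sum>l\<in>J. h l * (norm (w l))\<^sup>2)"
    unfolding wform_diag by (simp only: of_real_eq_iff of_real_add[symmetric])
  also have "(\<Sum>l\<in>J. h l * (norm (s l))\<^sup>2) = (\<Sum>j<M. (norm (A j))\<^sup>2)"
    unfolding s_def by (rule wform_Pythagoras[OF ortho])
  finally show ?thesis
    using h by (simp add: A_def sum_nonneg)
qed

lemma not_finitely_strictly_singularD:
  assumes R: "R \<in> lp_ops p q" and "0 < p" "0 < q" and "\<not> finitely_strictly_singular p q R"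
  obtains e where "0 < e"
    and "\<And>n. 0 < n \<Longrightarrow> \<exists>E. E \<subseteq> lp_space p \<and> seq.subspace E \<and> dim_at_least n E \<and>
           (\<forall>x\<in>E. e * lp_norm p x \<le> lp_norm q (R x))"
proof -
  obtain e where e: "0 < e" "\<And>n. 0 < n \<Longrightarrow> \<exists>E. (E \<subseteq> lp_space p \<and> seq.subspace E \<and> seq.dim E = n) \<and>
      \<not> (INF x\<in>{x \<in> E. lp_norm p x = 1}. lp_norm q (R x)) < e"
    using assms(4) unfolding finitely_strictly_singular_def by blast
  show ?thesis
  proof (rule that[OF e(1)])
    fix n :: nat assume "0 < n"
    from e(2)[OF this] obtain E where E: "E \<subseteq> lp_space p" "seq.subspace E" "seq.dim E = n"
      and inf: "e \<le> (INF x\<in>{x \<in> E. lp_norm p x = 1}. lp_norm q (R x))"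
      by (auto simp: not_less)
    have "e * lp_norm p x \<le> lp_norm q (R x)" if x: "x \<in> E" for x
    proof (cases "lp_norm p x = 0")
      case False
      then have n0: "0 < lp_norm p x" using lp_norm_nonneg[of p x] by linarith
      define y where "y = seq_scale (of_real (1 / lp_norm p x)) x"
      have xl: "x \<in> lp_space p" using x E by blast
      have ny: "lp_norm p y = 1"
        using lp_scale(2)[OF \<open>0 < p\<close> xl, of "of_real (1 / lp_norm p x)"] n0
        unfolding y_def norm_of_real by simp
      have yE: "y \<in> E" unfolding y_def using seq.subspace_scale[OF E(2) x] .
      have Ry: "R y = seq_scale (of_real (1 / lp_norm p x)) (R x)"
        unfolding y_def by (rule lp_opsD(4)[OF R xl])
      have "e \<le> lp_norm q (R y)"
      proof (rule order_trans[OF inf])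
        show "(INF x\<in>{x \<in> E. lp_norm p x = 1}. lp_norm q (R x)) \<le> lp_norm q (R y)"
          using yE ny by (intro cINF_lower bdd_belowI2[of _ 0]) auto
      qed
      also have "\<dots> = lp_norm q (R x) / lp_norm p x"
        unfolding Ry lp_scale(2)[OF \<open>0 < q\<close> lp_opsD(1)[OF R xl]] norm_of_real using n0 by simp
      finally show ?thesis using n0 by (simp add: field_simps)
    qed simp
    then show "\<exists>E. E \<subseteq> lp_space p \<and> seq.subspace E \<and> dim_at_least n E \<and>
        (\<forall>x\<in>E. e * lp_norm p x \<le> lp_norm q (R x))"
      using E dim_at_least_dim[of E] by blast
  qed
qed

lemma dim_at_least_mono: "dim_at_least n E \<Longrightarrow> m \<le> n \<Longrightarrow> dim_at_least m E"
  unfolding dim_at_least_def by (meson less_le_trans)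

text \<open>
  The coordinates \<open>k\<close> act as dual functionals, which gives linear independence and the expansion
  of a vector.
\<close>

lemma echelon_span:
  fixes x :: "nat \<Rightarrow> nat \<Rightarrow> 'k::{real_normed_field, euclidean_space}"
  assumes xk: "\<And>i j. i < M \<Longrightarrow> j < M \<Longrightarrow> x i (k j) = (if i = j then 1 else 0)"
  shows "dim_at_least M (seq.span (x ` {..<M}))"
    and "v \<in> seq.span (x ` {..<M}) \<Longrightarrow> v = (\<Sum>j<M. seq_scale (v (k j)) (x j))"
proof -
  have inj: "inj_on x {..<M}"
  proof (rule inj_onI)
    fix i j assume ij: "i \<in> {..<M}" "j \<in> {..<M}" "x i = x j"
    then have "x i (k j) = 1" using xk[of j j] by simp
    then show "i = j" using xk[of i j] ij by (simp split: if_splits)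
  qed
  have indep: "seq.independent (x ` {..<M})"
  proof
    assume "seq.dependent (x ` {..<M})"
    then obtain t u w where t: "finite t" "t \<subseteq> x ` {..<M}" "(\<Sum>v\<in>t. seq_scale (u v) v) = 0" and w: "w \<in> t" "u w \<noteq> 0"
      unfolding seq.dependent_explicit by blast
    obtain j where j: "j < M" "w = x j" using w t by blast
    have "0 = (\<Sum>v\<in>t. seq_scale (u v) v) (k j)"
      by (simp only: t(3) zero_fun_apply)
    also have "\<dots> = (\<Sum>v\<in>t. u v * v (k j))"
      by (simp add: sum_fun_apply seq_scale_def)
    also have "\<dots> = (\<Sum>v\<in>t. if v = w then u v else 0)"
    proof (rule sum.cong[OF refl])
      fix v assume "v \<in> t"
      then obtain i where i: "i < M" "v = x i" using t by blast
      have "v = w \<longleftrightarrow> i = j" using inj i j by (auto simp: inj_on_def)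
      then show "u v * v (k j) = (if v = w then u v else 0)"
        using xk[OF i(1) j(1)] i(2) by simp
    qed
    also have "\<dots> = u w" using t(1) w(1) by simp
    finally show False using w(2) by simp
  qed
  show "dim_at_least M (seq.span (x ` {..<M}))"
    unfolding dim_at_least_def
  proof (intro allI impI notI)
    fix W assume W: "finite W \<and> card W < M" "seq.span (x ` {..<M}) \<subseteq> seq.span W"
    have "x ` {..<M} \<subseteq> seq.span W"
      using W(2) seq.span_superset[of "x ` {..<M}"] by blast
    then have "card (x ` {..<M}) \<le> card W"
      using seq.independent_span_bound[OF _ indep] W(1) by blast
    then show False
      using W(1) card_image[OF inj] by simp
  qed
  have sub: "seq.subspace {v. v = (\<Sum>j<M. seq_scale (v (k j)) (x j))}"
  proof (rule seq.subspaceI)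
    show "0 \<in> {v. v = (\<Sum>j<M. seq_scale (v (k j)) (x j))}"
      by (simp add: fun_eq_iff sum_fun_apply seq_scale_def)
  next
    fix v w assume "v \<in> {v. v = (\<Sum>j<M. seq_scale (v (k j)) (x j))}" "w \<in> {v. v = (\<Sum>j<M. seq_scale (v (k j)) (x j))}"
    then have "v l = (\<Sum>j<M. v (k j) * x j l)" "w l = (\<Sum>j<M. w (k j) * x j l)" for l
      unfolding mem_Collect_eq fun_eq_iff sum_fun_apply seq_scale_def by blast+
    note vw = this
    have "(v + w) l = (\<Sum>j<M. (v + w) (k j) * x j l)" for l
    proof -
      have "(v + w) l = (\<Sum>j<M. v (k j) * x j l) + (\<Sum>j<M. w (k j) * x j l)"
        unfolding plus_fun_apply by (rule arg_cong2[where f="(+)", OF vw])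
      then show ?thesis
        by (simp only: plus_fun_apply distrib_right sum.distrib)
    qed
    then show "v + w \<in> {v. v = (\<Sum>j<M. seq_scale (v (k j)) (x j))}"
      unfolding mem_Collect_eq fun_eq_iff sum_fun_apply seq_scale_def by blast
  next
    fix c v assume "v \<in> {v. v = (\<Sum>j<M. seq_scale (v (k j)) (x j))}"
    then have v: "v l = (\<Sum>j<M. v (k j) * x j l)" for l
      unfolding mem_Collect_eq fun_eq_iff sum_fun_apply seq_scale_def by blast
    have "c * v l = (\<Sum>j<M. c * v (k j) * x j l)" for l
      unfolding mult.assoc sum_distrib_left[symmetric] by (rule arg_cong[where f="(*) c", OF v])
    then show "seq_scale c v \<in> {v. v = (\<Sum>j<M. seq_scale (v (k j)) (x j))}"
      unfolding mem_Collect_eq fun_eq_iff sum_fun_apply seq_scale_def by blast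
  qed
  have "x ` {..<M} \<subseteq> {v. v = (\<Sum>j<M. seq_scale (v (k j)) (x j))}"
  proof
    fix v assume "v \<in> x ` {..<M}"
    then obtain i where i: "i < M" "v = x i" by blast
    have "x i l = (\<Sum>j<M. x j l * x i (k j))" for l
      using i(1) xk[OF i(1)] by (intro sum_Kronecker[symmetric]) auto
    then show "v \<in> {v. v = (\<Sum>j<M. seq_scale (v (k j)) (x j))}"
      unfolding mem_Collect_eq fun_eq_iff sum_fun_apply seq_scale_def i(2) mult.commute[of "x i (k _)"] by blast
  qed
  then show "v = (\<Sum>j<M. seq_scale (v (k j)) (x j))" if "v \<in> seq.span (x ` {..<M})"
    using seq.span_minimal[OF _ sub] that by blast
qed

text \<open>
  The tails of the finitely many vectors \<open>y\<close> are small simultaneously, so those of their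
  combinations are small uniformly in bounded coefficients.
\<close>

lemma finite_system_tail_small:
  fixes y :: "nat \<Rightarrow> nat \<Rightarrow> 'k::{real_normed_field, euclidean_space}"
  assumes "1 \<le> r" "\<And>j. j < M \<Longrightarrow> y j \<in> lp_space r" "0 < d"
  shows "\<exists>m0. \<forall>m\<ge>m0. \<forall>c B. 0 \<le> B \<longrightarrow> (\<forall>j<M. norm (c j) \<le> B) \<longrightarrow>
    lp_norm r (cut {m..} (\<Sum>j<M. seq_scale (c j) (y j))) \<le> d * B"
proof -
  have r: "0 < r" using assms by simp
  have "(\<lambda>m. \<Sum>j<M. lp_norm r (cut {m..} (y j))) \<longlonglongrightarrow> (\<Sum>j<M. 0)"
    using assms(2) by (intro tendsto_sum lp_tail_tendsto_0 r) auto
  then have "eventually (\<lambda>m. (\<Sum>j<M. lp_norm r (cut {m..} (y j))) < d) sequentially"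
    using \<open>0 < d\<close> by (intro order_tendstoD(2)[of _ 0]) auto
  then obtain m0 where m0: "\<And>m. m \<ge> m0 \<Longrightarrow> (\<Sum>j<M. lp_norm r (cut {m..} (y j))) < d"
    unfolding eventually_sequentially by blast
  have "lp_norm r (cut {m..} (\<Sum>j<M. seq_scale (c j) (y j))) \<le> d * B"
    if m: "m0 \<le> m" and B: "0 \<le> B" and c: "\<And>j. j < M \<Longrightarrow> norm (c j) \<le> B" for m c B
  proof -
    have l: "cut {m..} (y j) \<in> lp_space r" if "j < M" for j
      using lp_cut(1)[OF r assms(2)[OF that]] .
    have "cut {m..} (\<Sum>j<M. seq_scale (c j) (y j)) = (\<Sum>j<M. seq_scale (c j) (cut {m..} (y j)))"
      by (simp add: cut_sum)
    then have "lp_norm r (cut {m..} (\<Sum>j<M. seq_scale (c j) (y j))) \<le>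
        (\<Sum>j<M. lp_norm r (seq_scale (c j) (cut {m..} (y j))))"
      using lp_sum[OF assms(1), of "{..<M}" "\<lambda>j. seq_scale (c j) (cut {m..} (y j))"] lp_scale(1)[OF r l]
      by simp
    also have "\<dots> \<le> (\<Sum>j<M. B * lp_norm r (cut {m..} (y j)))"
      using lp_scale(2)[OF r l] c by (intro sum_mono) (auto intro: mult_right_mono)
    also have "\<dots> = B * (\<Sum>j<M. lp_norm r (cut {m..} (y j)))"
      by (simp add: sum_distrib_left)
    also have "\<dots> \<le> B * d"
      using m0[OF m] B by (intro mult_left_mono) auto
    finally show ?thesis by (simp add: mult.commute)
  qed
  then show ?thesis by blast
qed

lemma linear_on_sum:
  assumes "linear_on UNIV L"
  shows "L (\<Sum>i\<in>A. seq_scale (c i) (e i)) = (\<Sum>i\<in>A. seq_scale (c i) (L (e i)))"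
proof (induction A rule: infinite_finite_induct)
  case (insert a A)
  have "L (seq_scale (c a) (e a) + (\<Sum>i\<in>A. seq_scale (c i) (e i))) =
      seq_scale (c a) (L (e a)) + (\<Sum>i\<in>A. seq_scale (c i) (L (e i)))"
    unfolding linear_onD(1)[OF assms UNIV_I UNIV_I] linear_onD(2)[OF assms UNIV_I] insert.IH ..
  then show ?case
    unfolding sum.insert[OF insert.hyps] .
next
  case empty
  show ?case unfolding sum.empty by (rule linear_on_zero[OF assms seq.subspace_UNIV])
next
  case (infinite A)
  show ?case unfolding sum.infinite[OF infinite(1)] by (rule linear_on_zero[OF assms seq.subspace_UNIV])
qed

lemma linear_on_subset: "linear_on UNIV L \<Longrightarrow> linear_on E L"
  by (auto simp: linear_on_def)

lemma lp_norm_2_cut: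
  "(lp_norm 2 (cut {..<M} y))\<^sup>2 = (\<Sum>j<M. (norm (y j))\<^sup>2)"
proof -
  have "(lp_norm 2 (cut {..<M} y)) powr 2 = (\<Sum>j<M. norm (y j) powr 2)"
    by (rule lp_cut_finite) auto
  then show ?thesis
    by (simp add: powr_numeral)
qed

text \<open>
  Intersecting with finitely many kernels makes \<open>x\<close> and \<open>R x\<close> vanish below \<open>N\<close> exactly. Above, the
  tails of \<open>x\<close> and \<open>R x\<close> are uniformly small on the span of an echelon system, so that cutting
  them off costs at most half of the lower bound.
\<close>

lemma bounded_below_block:
  fixes R :: "(nat \<Rightarrow> 'k::{real_normed_field, euclidean_space}) \<Rightarrow> nat \<Rightarrow> 'k"
  assumes R: "R \<in> lp_ops p q" and "1 \<le> p" "1 \<le> q"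
    and e: "0 < e" "\<exists>E. E \<subseteq> lp_space p \<and> seq.subspace E \<and> dim_at_least (M + N + N) E \<and>
           (\<forall>x\<in>E. e * lp_norm p x \<le> lp_norm q (R x))"
  shows "\<exists>N'\<ge>N. \<exists>F. seq.subspace F \<and> dim_at_least M F \<and>
    (\<forall>x\<in>F. x \<noteq> 0 \<longrightarrow> cut {N..<N'} x \<noteq> 0) \<and>
    (\<forall>x\<in>F. e / 2 * lp_norm p (cut {N..<N'} x) \<le> lp_norm q (cut {N..<N'} (R (cut {N..<N'} x))))"
proof -
  have p: "0 < p" "0 < q" using assms by auto
  obtain K where K: "0 < K" "\<And>x. x \<in> lp_space p \<Longrightarrow> lp_norm q (R x) \<le> K * lp_norm p x"
    using lp_ops_bound[OF R] by blast
  obtain E0 where E0: "E0 \<subseteq> lp_space p" "seq.subspace E0" "dim_at_least (M + N + N) E0"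
    and below: "\<And>x. x \<in> E0 \<Longrightarrow> e * lp_norm p x \<le> lp_norm q (R x)"
    using e(2) by blast
  define E1 where "E1 = {x \<in> E0. \<forall>l<N. x l = 0}"
  have E1: "seq.subspace E1 \<and> dim_at_least (M + N) E1"
    unfolding E1_def by (rule dim_at_least_kernels[OF E0(2,3), of "\<lambda>x. x"]) (rule refl)+
  define E where "E = {x \<in> E1. \<forall>l<N. R x l = 0}"
  have E: "seq.subspace E \<and> dim_at_least M E"
    unfolding E_def
  proof (rule dim_at_least_kernels)
    show "R (x + y) = R x + R y" if "x \<in> E1" "y \<in> E1" for x y
      using that E0(1) by (intro lp_opsD(3)[OF R]) (auto simp: E1_def)
    show "R (seq_scale c x) = seq_scale c (R x)" if "x \<in> E1" for c x
      using that E0(1) by (intro lp_opsD(4)[OF R]) (auto simp: E1_def)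
  qed (use E1 in auto)
  obtain x k where x: "\<And>i. i < M \<Longrightarrow> x i \<in> E"
    and xk: "\<And>i j. i < M \<Longrightarrow> j < M \<Longrightarrow> x i (k j) = (if i = j then 1 else 0)"
    using echelon_system[of E M] E by blast
  define F where "F = seq.span (x ` {..<M})"
  have F: "seq.subspace F" "dim_at_least M F"
    unfolding F_def using echelon_span(1)[of M x k] xk by auto
  have FE: "F \<subseteq> E"
    unfolding F_def using x E by (intro seq.span_minimal) auto
  have rep: "v = (\<Sum>j<M. seq_scale (v (k j)) (x j))" if "v \<in> F" for v
    using echelon_span(2)[of M x k v] xk that by (simp add: F_def)
  have xl: "x j \<in> lp_space p" if "j < M" for j
    using x[OF that] E0(1) by (auto simp: E_def E1_def)
  \<comment> \<open>The bound \<open>1 / 2\<close> keeps the truncated vectors nonzero.\<close>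
  define d where "d = min (1 / 2) (e / (2 * (K + 1)))"
  have d: "0 < d" "d \<le> 1 / 2" "(K + 1) * d \<le> e / 2"
  proof -
    show "0 < d" using e K by (simp add: d_def)
    show "d \<le> 1 / 2" unfolding d_def by (rule min.cobounded1)
    have "(K + 1) * d \<le> (K + 1) * (e / (2 * (K + 1)))"
      using K unfolding d_def by (intro mult_left_mono min.cobounded2) auto
    also have "\<dots> = e / 2" using K by (simp add: field_simps)
    finally show "(K + 1) * d \<le> e / 2" .
  qed
  obtain m1 where m1: "\<forall>m\<ge>m1. \<forall>c B. 0 \<le> B \<longrightarrow> (\<forall>j<M. norm (c j) \<le> B) \<longrightarrow>
      lp_norm p (cut {m..} (\<Sum>j<M. seq_scale (c j) (x j))) \<le> d * B"
    using finite_system_tail_small[OF \<open>1 \<le> p\<close> xl d(1)] by (rule exE)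
  obtain m2 where m2: "\<forall>m\<ge>m2. \<forall>c B. 0 \<le> B \<longrightarrow> (\<forall>j<M. norm (c j) \<le> B) \<longrightarrow>
      lp_norm q (cut {m..} (\<Sum>j<M. seq_scale (c j) (R (x j)))) \<le> d * B"
    using finite_system_tail_small[OF \<open>1 \<le> q\<close> lp_opsD(1)[OF R xl] d(1)] by (rule exE)
  define N' where "N' = max N (max m1 m2)"
  have N': "N \<le> N'" "m1 \<le> N'" "m2 \<le> N'" by (auto simp: N'_def)
  define L where "L = {N..<N'}"
  have facts: "lp_norm p v \<le> lp_norm p (cut L v) + d * lp_norm p v \<and>
      e / 2 * lp_norm p (cut L v) \<le> lp_norm q (cut L (R (cut L v)))" if v: "v \<in> F" for v
  proof -
    have vE: "v \<in> E" "v \<in> E0" using v FE by (auto simp: E_def E1_def)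
    then have vl: "v \<in> lp_space p" using E0(1) by blast
    have cv: "norm (v (k j)) \<le> lp_norm p v" for j
      by (rule lp_norm_component_le[OF p(1) vl])
    have "lp_norm p (cut {N'..} (\<Sum>j<M. seq_scale (v (k j)) (x j))) \<le> d * lp_norm p v"
      by (intro m1[rule_format, OF N'(2)] lp_norm_nonneg cv)
    then have t1: "lp_norm p (cut {N'..} v) \<le> d * lp_norm p v"
      unfolding rep[OF v, symmetric] .
    have "R v = R (\<Sum>j<M. seq_scale (v (k j)) (x j))"
      by (rule arg_cong[OF rep[OF v]])
    also have "\<dots> = (\<Sum>j<M. R (seq_scale (v (k j)) (x j)))"
      using lp_scale(1)[OF p(1) xl] by (intro lp_ops_sum[OF R \<open>1 \<le> p\<close>]) auto
    also have "\<dots> = (\<Sum>j<M. seq_scale (v (k j)) (R (x j)))"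
      using lp_opsD(4)[OF R xl] by (intro sum.cong) auto
    finally have Rv: "R v = (\<Sum>j<M. seq_scale (v (k j)) (R (x j)))" .
    have t2: "lp_norm q (cut {N'..} (R v)) \<le> d * lp_norm p v"
      unfolding Rv using cv by (intro m2[rule_format, OF N'(3)]) auto
    have v0: "v l = 0" "R v l = 0" if "l < N" for l
      using vE that unfolding E_def E1_def by blast+
    have splitv: "v = cut L v + cut {N'..} v"
      using v0(1) N'(1) by (auto simp: cut_def L_def fun_eq_iff not_le not_less)
    have splitR: "R v = cut L (R v) + cut {N'..} (R v)"
      using v0(2) N'(1) by (auto simp: cut_def L_def fun_eq_iff not_le not_less)
    have l: "cut L v \<in> lp_space p" "cut {N'..} v \<in> lp_space p"
      using lp_cut(1)[OF p(1) vl] by auto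
    have Rl: "R v \<in> lp_space q" "R (cut L v) \<in> lp_space q" "R (cut {N'..} v) \<in> lp_space q"
      using lp_opsD(1)[OF R] l vl by auto
    have Rcl: "cut L (R (cut L v)) \<in> lp_space q" "cut L (R (cut {N'..} v)) \<in> lp_space q"
      "cut L (R v) \<in> lp_space q" "cut {N'..} (R v) \<in> lp_space q"
      using lp_cut(1)[OF p(2)] Rl by auto
    have a: "lp_norm p v \<le> lp_norm p (cut L v) + d * lp_norm p v"
      using lp_add(2)[OF \<open>1 \<le> p\<close> l] t1 unfolding splitv[symmetric] by linarith
    have "R v = R (cut L v) + R (cut {N'..} v)"
      using lp_opsD(3)[OF R l] unfolding splitv[symmetric] .
    then have "cut L (R v) = cut L (R (cut L v)) + cut L (R (cut {N'..} v))"
      by (simp only: cut_linear)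
    then have "lp_norm q (cut L (R v)) \<le> lp_norm q (cut L (R (cut L v))) + lp_norm q (cut L (R (cut {N'..} v)))"
      using lp_add(2)[OF \<open>1 \<le> q\<close> Rcl(1,2)] by simp
    moreover have "lp_norm q (cut L (R (cut {N'..} v))) \<le> K * (d * lp_norm p v)"
      using lp_cut(2)[OF p(2) Rl(3), of L] K(2)[OF l(2)] mult_left_mono[OF t1, of K] K(1) by linarith
    moreover have "lp_norm q (R v) \<le> lp_norm q (cut L (R v)) + d * lp_norm p v"
      using lp_add(2)[OF \<open>1 \<le> q\<close> Rcl(3,4)] t2 unfolding splitR[symmetric] by linarith
    moreover have "e * lp_norm p v \<le> lp_norm q (R v)"
      by (rule below[OF vE(2)])
    moreover have "(K + 1) * d * lp_norm p v \<le> e / 2 * lp_norm p v"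
      using d(3) by (intro mult_right_mono) auto
    ultimately have "e / 2 * lp_norm p v \<le> lp_norm q (cut L (R (cut L v)))"
      by (simp add: algebra_simps)
    moreover have "e / 2 * lp_norm p (cut L v) \<le> e / 2 * lp_norm p v"
      using lp_cut(2)[OF p(1) vl] e by (intro mult_left_mono) auto
    ultimately show ?thesis using a by linarith
  qed
  have "cut L v \<noteq> 0" if v: "v \<in> F" "v \<noteq> 0" for v
  proof
    assume "cut L v = 0"
    then have "lp_norm p (cut L v) = 0" by simp
    then have "lp_norm p v \<le> d * lp_norm p v" using facts[OF v(1)] by simp
    also have "\<dots> \<le> 1 / 2 * lp_norm p v" using d by (intro mult_right_mono) auto
    finally have "lp_norm p v = 0" using lp_norm_nonneg[of p v] by linarith
    moreover have "v \<in> lp_space p" using v(1) FE E0(1) by (auto simp: E_def E1_def)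
    ultimately show False using lp_norm_eq_0[OF p(1)] v(2) by blast
  qed
  then show ?thesis
    using N'(1) F facts unfolding L_def by blast
qed

text \<open>
  A factorisation of the identity of \<open>\<ell>\<^sub>2\<^sup>M\<close> through \<open>R\<close>, where \<open>\<ell>\<^sub>2\<^sup>M\<close> is the space of the first
  \<open>M\<close> coordinates of \<open>\<ell>\<^sub>2\<close>. Both maps see only the coordinates in \<open>L\<close>.
\<close>

definition l2_copy ::
    "real \<Rightarrow> real \<Rightarrow> ((nat \<Rightarrow> 'k::{real_normed_field, euclidean_space}) \<Rightarrow> nat \<Rightarrow> 'k) \<Rightarrow> real \<Rightarrow> nat \<Rightarrow> nat set
      \<Rightarrow> ((nat \<Rightarrow> 'k) \<Rightarrow> nat \<Rightarrow> 'k) \<Rightarrow> ((nat \<Rightarrow> 'k) \<Rightarrow> nat \<Rightarrow> 'k) \<Rightarrow> bool" where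
  "l2_copy p q R C M L \<alpha> \<beta> \<longleftrightarrow> linear_on UNIV \<alpha> \<and> linear_on UNIV \<beta> \<and>
     (\<forall>y. cut L (\<beta> y) = \<beta> y) \<and> (\<forall>y. lp_norm p (\<beta> y) \<le> lp_norm 2 (cut {..<M} y)) \<and>
     (\<forall>z. \<alpha> z \<in> lp_space 2 \<and> lp_norm 2 (\<alpha> z) \<le> C * lp_norm q (cut L z)) \<and>
     (\<forall>y. \<alpha> (R (\<beta> y)) = cut {..<M} y)"

text \<open>
  Apply the weights to the compression \<open>Z\<close> of \<open>R\<close> to a block on which it is bounded below, and let
  \<open>f\<close> be orthonormal for the weighted form of the vectors \<open>Z x\<close>. Then \<open>\<beta>\<close> sends the unit vectors
  to the truncated \<open>f\<close>, which is contractive because the weighted form of \<open>Z\<close> dominates the norm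
  of \<open>\<ell>\<^sub>p\<close>, and \<open>\<alpha>\<close> takes the coefficients with respect to the vectors \<open>Z f\<close>, which is bounded by
  Bessel's inequality because the norm of \<open>\<ell>\<^sub>q\<close> dominates the weighted form.
\<close>

lemma Hilbert_copies:
  fixes R :: "(nat \<Rightarrow> 'k::{real_normed_field, euclidean_space}) \<Rightarrow> nat \<Rightarrow> 'k"
  assumes R: "R \<in> lp_ops p q" and "1 \<le> p" "p \<le> 2" "2 \<le> q" and "\<not> finitely_strictly_singular p q R"
  shows "\<exists>C>0. \<forall>M N. \<exists>N'\<ge>N. \<exists>\<alpha> \<beta>. l2_copy p q R C M {N..<N'} \<alpha> \<beta>"
proof -
  have p: "0 < p" "0 < q" "1 \<le> q" using assms by auto
  obtain e where e: "0 < e" and big: "\<And>n. 0 < n \<Longrightarrow> \<exists>E. E \<subseteq> lp_space p \<and> seq.subspace E \<and> dim_at_least n E \<and>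
           (\<forall>x\<in>E. e * lp_norm p x \<le> lp_norm q (R x))"
    using not_finitely_strictly_singularD[OF R p(1,2) assms(5)] by blast
  define D where "D = (2 / e) powr p"
  have D: "0 < D" using e by (simp add: D_def)
  show ?thesis
  proof (rule Maurey_weights[OF p(1) \<open>p \<le> 2\<close> \<open>2 \<le> q\<close> D, where 'k='k])
    fix c :: real
    assume c: "0 < c"
      and weights: "\<And>(E :: (nat \<Rightarrow> 'k) set) X Z I J.
        seq.subspace E \<Longrightarrow> linear_on E X \<Longrightarrow> linear_on E Z \<Longrightarrow> finite J \<Longrightarrow>
        (\<And>x. x \<in> E \<Longrightarrow> (\<Sum>i\<in>I. norm (X x i) powr p) \<le> D * (\<Sum>l\<in>J. norm (Z x l) powr q) powr (p / q)) \<Longrightarrow>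
        \<exists>h. (\<forall>l. 0 \<le> h l) \<and>
          (\<forall>x\<in>E. (\<Sum>i\<in>I. norm (X x i) powr p) powr (2 / p) \<le> (\<Sum>l\<in>J. h l * (norm (Z x l))\<^sup>2)) \<and>
          (\<forall>z :: nat \<Rightarrow> 'k. (\<Sum>l\<in>J. h l * (norm (z l))\<^sup>2) \<le> c * (\<Sum>l\<in>J. norm (z l) powr q) powr (2 / q))"
    show ?thesis
    proof (intro exI[of _ "sqrt c"] conjI allI)
      show "0 < sqrt c" using c by simp
      fix M N :: nat
      obtain E where E: "E \<subseteq> lp_space p" "seq.subspace E" "dim_at_least (Suc (M + N + N)) E"
          "\<forall>x\<in>E. e * lp_norm p x \<le> lp_norm q (R x)"
        using big[OF zero_less_Suc] by blast
      have "\<exists>E. E \<subseteq> lp_space p \<and> seq.subspace E \<and> dim_at_least (M + N + N) E \<and>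
             (\<forall>x\<in>E. e * lp_norm p x \<le> lp_norm q (R x))"
        by (rule exI[of _ E], intro conjI E dim_at_least_mono[OF E(3)]) simp
      from bounded_below_block[OF R \<open>1 \<le> p\<close> p(3) e this]
      obtain N' where N'F: "N \<le> N' \<and> (\<exists>F. seq.subspace F \<and> dim_at_least M F \<and>
          (\<forall>x\<in>F. x \<noteq> 0 \<longrightarrow> cut {N..<N'} x \<noteq> 0) \<and>
          (\<forall>x\<in>F. e / 2 * lp_norm p (cut {N..<N'} x) \<le> lp_norm q (cut {N..<N'} (R (cut {N..<N'} x)))))"
        by (rule exE)
      note N' = N'F[THEN conjunct1]
      from N'F[THEN conjunct2] obtain F where F0: "seq.subspace F \<and> dim_at_least M F \<and>
          (\<forall>x\<in>F. x \<noteq> 0 \<longrightarrow> cut {N..<N'} x \<noteq> 0) \<and>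
          (\<forall>x\<in>F. e / 2 * lp_norm p (cut {N..<N'} x) \<le> lp_norm q (cut {N..<N'} (R (cut {N..<N'} x))))"
        by (rule exE)
      note F = F0[THEN conjunct1] F0[THEN conjunct2, THEN conjunct1]
      note nz = F0[THEN conjunct2, THEN conjunct2, THEN conjunct1, THEN bspec, THEN mp]
      note below = F0[THEN conjunct2, THEN conjunct2, THEN conjunct2, THEN bspec]
      define L where "L = {N..<N'}"
      have finL: "finite L" by (simp add: L_def)
      define Z where "Z = (\<lambda>x. cut L (R (cut L x)))"
      have cutl: "cut L x \<in> lp_space r" if "0 < r" for r and x :: "nat \<Rightarrow> 'k"
        using lp_cut_finite(1)[OF that finL] .
      have normcut: "lp_norm r (cut L x) powr r = (\<Sum>i\<in>L. norm (x i) powr r)" if "0 < r" for r and x :: "nat \<Rightarrow> 'k"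
        using lp_cut_finite(2)[OF that finL] .
      have X: "linear_on UNIV (cut L :: (nat \<Rightarrow> 'k) \<Rightarrow> _)"
        by (simp add: linear_on_def)
      have Z: "linear_on UNIV Z"
        unfolding linear_on_def Z_def cut_linear
        using lp_opsD(3)[OF R cutl[OF p(1)] cutl[OF p(1)]] lp_opsD(4)[OF R cutl[OF p(1)]]
        by (simp only: cut_linear) blast
      obtain h where hh: "(\<forall>l. 0 \<le> h l) \<and>
          (\<forall>x\<in>F. (\<Sum>i\<in>L. norm (cut L x i) powr p) powr (2 / p) \<le> (\<Sum>l\<in>L. h l * (norm (Z x l))\<^sup>2)) \<and>
          (\<forall>z :: nat \<Rightarrow> 'k. (\<Sum>l\<in>L. h l * (norm (z l))\<^sup>2) \<le> c * (\<Sum>l\<in>L. norm (z l) powr q) powr (2 / q))"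
      proof (rule exE[OF weights[OF F(1) linear_on_subset[OF X] linear_on_subset[OF Z] finL]])
        fix x assume x: "x \<in> F"
        have ZZ: "cut L (Z x) = Z x" by (simp add: Z_def)
        have "lp_norm p (cut L x) \<le> 2 / e * lp_norm q (Z x)"
          using below[OF x] e by (simp add: Z_def L_def field_simps)
        then have "lp_norm p (cut L x) powr p \<le> (2 / e * lp_norm q (Z x)) powr p"
          using p by (intro powr_mono2) auto
        also have "\<dots> = D * lp_norm q (Z x) powr p"
          unfolding D_def by (rule powr_mult)
        also have "lp_norm q (Z x) powr p = (lp_norm q (Z x) powr q) powr (p / q)"
          using p by (simp add: powr_powr)
        also have "lp_norm q (Z x) powr q = (\<Sum>l\<in>L. norm (Z x l) powr q)"
          using normcut[OF p(2), of "Z x"] unfolding ZZ .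
        finally show "(\<Sum>i\<in>L. norm (cut L x i) powr p) \<le> D * (\<Sum>l\<in>L. norm (Z x l) powr q) powr (p / q)"
          unfolding normcut[OF p(1)] by (simp add: cut_def)
      qed
      have h: "0 \<le> h l" for l
        by (rule spec[OF hh[THEN conjunct1]])
      have dom: "(\<Sum>i\<in>L. norm (cut L x i) powr p) powr (2 / p) \<le> (\<Sum>l\<in>L. h l * (norm (Z x l))\<^sup>2)" if "x \<in> F" for x
        by (rule bspec[OF hh[THEN conjunct2, THEN conjunct1] that])
      have bnd: "(\<Sum>l\<in>L. h l * (norm (z l))\<^sup>2) \<le> c * (\<Sum>l\<in>L. norm (z l) powr q) powr (2 / q)" for z :: "nat \<Rightarrow> 'k"
        by (rule spec[OF hh[THEN conjunct2, THEN conjunct2]])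
      have dom': "(lp_norm p (cut L x))\<^sup>2 \<le> (\<Sum>l\<in>L. h l * (norm (Z x l))\<^sup>2)" if "x \<in> F" for x
      proof -
        have "(\<Sum>i\<in>L. norm (cut L x i) powr p) = lp_norm p (cut L x) powr p"
          unfolding normcut[OF p(1)] by (simp add: cut_def)
        then have "(\<Sum>i\<in>L. norm (cut L x i) powr p) powr (2 / p) = lp_norm p (cut L x) powr 2"
          using p by (simp add: powr_powr)
        then show ?thesis
          using dom[OF that] by (simp add: powr_numeral)
      qed
      have bnd': "(\<Sum>l\<in>L. h l * (norm (z l))\<^sup>2) \<le> c * (lp_norm q (cut L z))\<^sup>2" for z :: "nat \<Rightarrow> 'k"
      proof -
        have "(\<Sum>l\<in>L. norm (z l) powr q) powr (2 / q) = lp_norm q (cut L z) powr 2"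
          unfolding normcut[OF p(2), of z, symmetric] powr_powr using p by simp
        then show ?thesis
          using bnd[of z] by (simp add: powr_numeral)
      qed
      have "\<exists>f. \<forall>i<M. f i \<in> F \<and> (\<forall>j<M. wform h L (Z (f i)) (Z (f j)) = (if i = j then 1 else 0))"
      proof (rule Gram_Schmidt[OF F])
        show "wform h L (Z (x + y)) (Z z) = wform h L (Z x) (Z z) + wform h L (Z y) (Z z)" for x y z
          unfolding linear_onD(1)[OF Z UNIV_I UNIV_I] by (rule wform_add)
        show "wform h L (Z (seq_scale a x)) (Z z) = a * wform h L (Z x) (Z z)" for a x z
          unfolding linear_onD(2)[OF Z UNIV_I] by (rule wform_scale)
        show "wform h L (Z z) (Z x) = conjg (wform h L (Z x) (Z z))" for x z
          by (rule wform_herm)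
        fix x assume x: "x \<in> F" "x \<noteq> 0"
        have "lp_norm p (cut L x) \<noteq> 0"
          using nz[OF x] lp_norm_eq_0[OF p(1) cutl[OF p(1)], of x] unfolding L_def by blast
        then have "0 < (lp_norm p (cut L x))\<^sup>2" by simp
        also have "\<dots> \<le> (\<Sum>l\<in>L. h l * (norm (Z x l))\<^sup>2)" by (rule dom'[OF x(1)])
        finally show "\<exists>r>0. wform h L (Z x) (Z x) = of_real r"
          using wform_diag by blast
      qed
      then obtain f where f: "\<And>i. i < M \<Longrightarrow> f i \<in> F"
        and ortho: "\<And>i j. i < M \<Longrightarrow> j < M \<Longrightarrow> wform h L (Z (f i)) (Z (f j)) = (if i = j then 1 else 0)"
        by blast
      define \<alpha> where "\<alpha> = (\<lambda>z j. if j < M then wform h L z (Z (f j)) else 0)"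
      define \<beta> where "\<beta> = (\<lambda>y :: nat \<Rightarrow> 'k. \<Sum>j<M. seq_scale (y j) (cut L (f j)))"
      have \<beta>_eq: "\<beta> y = cut L (\<Sum>j<M. seq_scale (y j) (f j))" for y
        by (simp add: \<beta>_def cut_sum)
      have 1: "linear_on UNIV \<alpha>"
        unfolding linear_on_def \<alpha>_def wform_add wform_scale
        by (auto simp: fun_eq_iff seq_scale_def)
      have 2: "linear_on UNIV \<beta>"
        unfolding linear_on_def \<beta>_def
        by (simp add: fun_eq_iff sum_fun_apply seq_scale_def distrib_right sum.distrib sum_distrib_left mult.assoc)
      have 3: "cut L (\<beta> y) = \<beta> y" for y
        unfolding \<beta>_eq by simp
      have 4: "lp_norm p (\<beta> y) \<le> lp_norm 2 (cut {..<M} y)" for y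
      proof -
        define s where "s = (\<Sum>j<M. seq_scale (y j) (f j))"
        have sF: "s \<in> F" unfolding s_def using f by (intro sum_scale_in_subspace F) auto
        have Zs: "Z s = (\<Sum>j<M. seq_scale (y j) (Z (f j)))"
          unfolding s_def by (rule linear_on_sum[OF Z])
        have "(lp_norm p (\<beta> y))\<^sup>2 \<le> (\<Sum>l\<in>L. h l * (norm (Z s l))\<^sup>2)"
          using dom'[OF sF] unfolding \<beta>_eq s_def .
        also have "\<dots> = (\<Sum>j<M. (norm (y j))\<^sup>2)"
          unfolding Zs by (rule wform_Pythagoras[OF ortho])
        also have "\<dots> = (lp_norm 2 (cut {..<M} y))\<^sup>2"
          by (rule lp_norm_2_cut[symmetric])
        finally show ?thesis
          by (rule power2_le_imp_le) simp
      qed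
      have 5: "\<alpha> z \<in> lp_space 2 \<and> lp_norm 2 (\<alpha> z) \<le> sqrt c * lp_norm q (cut L z)" for z
      proof
        have cut\<alpha>: "cut {..<M} (\<alpha> z) = \<alpha> z" by (auto simp: cut_def \<alpha>_def)
        show "\<alpha> z \<in> lp_space 2"
          using lp_cut_finite(1)[of 2 "{..<M}" "\<alpha> z"] unfolding cut\<alpha> by simp
        have "(lp_norm 2 (\<alpha> z))\<^sup>2 = (\<Sum>j<M. (norm (wform h L z (Z (f j))))\<^sup>2)"
          using lp_norm_2_cut[of M "\<alpha> z"] unfolding cut\<alpha> by (simp add: \<alpha>_def)
        also have "\<dots> \<le> (\<Sum>l\<in>L. h l * (norm (z l))\<^sup>2)"
          by (rule wform_Bessel[OF ortho h])
        also have "\<dots> \<le> c * (lp_norm q (cut L z))\<^sup>2"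
          by (rule bnd')
        also have "\<dots> = (sqrt c * lp_norm q (cut L z))\<^sup>2"
          using c by (simp add: power_mult_distrib)
        finally show "lp_norm 2 (\<alpha> z) \<le> sqrt c * lp_norm q (cut L z)"
          by (rule power2_le_imp_le) (use c in simp)
      qed
      have 6: "\<alpha> (R (\<beta> y)) = cut {..<M} y" for y
      proof (rule ext)
        fix i
        show "\<alpha> (R (\<beta> y)) i = cut {..<M} y i"
        proof (cases "i < M")
          case True
          define s where "s = (\<Sum>j<M. seq_scale (y j) (f j))"
          have Zs: "Z s = (\<Sum>j<M. seq_scale (y j) (Z (f j)))"
            unfolding s_def by (rule linear_on_sum[OF Z])
          have "wform h L (R (\<beta> y)) v = wform h L (Z s) v" for v
            unfolding wform_def \<beta>_eq Z_def s_def by (intro sum.cong refl) (simp add: cut_def)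
          then have "\<alpha> (R (\<beta> y)) i = (\<Sum>j<M. y j * wform h L (Z (f j)) (Z (f i)))"
            using True by (simp add: \<alpha>_def Zs wform_sum)
          also have "\<dots> = y i"
            by (rule sum_Kronecker[OF True]) (rule ortho[OF _ True])
          finally show ?thesis using True by (simp add: cut_def)
        qed (simp add: \<alpha>_def cut_def)
      qed
      have "l2_copy p q R (sqrt c) M L \<alpha> \<beta>"
        unfolding l2_copy_def by (intro conjI allI 1 2 3 4 6 conjunct1[OF 5] conjunct2[OF 5])
      then show "\<exists>N'\<ge>N. \<exists>\<alpha> \<beta>. l2_copy p q R (sqrt c) M {N..<N'} \<alpha> \<beta>"
        using N' unfolding L_def by blast
    qed
  qed
qed

section \<open>Block operators and tails\<close>

text \<open>
  The sum of all \<open>D i\<close>, provided that \<open>D i\<close> has values supported on \<open>J i\<close>: only those blocks are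
  added that can contribute to the coordinate \<open>l\<close>, which makes the sum finite.
\<close>

definition block_op ::
    "real \<Rightarrow> (nat \<Rightarrow> nat set) \<Rightarrow> (nat \<Rightarrow> (nat \<Rightarrow> 'k::{real_normed_field, euclidean_space}) \<Rightarrow> nat \<Rightarrow> 'k)
      \<Rightarrow> (nat \<Rightarrow> 'k) \<Rightarrow> nat \<Rightarrow> 'k" where
  "block_op r J D x = (if x \<in> lp_space r then (\<lambda>l. \<Sum>i | l \<in> J i. D i x l) else 0)"

text \<open>
  The inputs of different blocks are disjoint parts of \<open>x\<close>, whose norms add up in the \<open>r\<close>-th
  power. In every coordinate at most \<open>K\<close> outputs overlap, which costs the factor \<open>K\<close>.
\<close>

lemma block_op_bound:
  fixes D :: "nat \<Rightarrow> (nat \<Rightarrow> 'k::{real_normed_field, euclidean_space}) \<Rightarrow> nat \<Rightarrow> 'k"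
  assumes r: "1 \<le> r" and C: "0 \<le> C"
    and mem: "\<And>i. D i x \<in> lp_space r"
    and bound: "\<And>i. lp_norm r (D i x) \<le> C * lp_norm r (cut (L i) x)"
    and L: "\<And>i. finite (L i)" "disjoint_family L"
    and J: "\<And>l. finite {i. l \<in> J i}" "\<And>l. card {i. l \<in> J i} \<le> K"
    and x: "x \<in> lp_space r"
  shows "block_op r J D x \<in> lp_space r" "lp_norm r (block_op r J D x) \<le> real K * C * lp_norm r x"
proof -
  have r0: "0 < r" using r by simp
  have *: "(\<Sum>l<n. norm (block_op r J D x l) powr r) \<le> (real K * C * lp_norm r x) powr r" for n
  proof -
    have "finite (\<Union>l<n. {i. l \<in> J i})" using J(1) by blast
    then obtain m where m: "\<And>l i. l < n \<Longrightarrow> l \<in> J i \<Longrightarrow> i < m"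
      unfolding finite_nat_set_iff_bounded by blast
    have "norm (block_op r J D x l) powr r \<le> real K powr r * (\<Sum>i<m. norm (D i x l) powr r)" if l: "l < n" for l
    proof -
      have "norm (block_op r J D x l) \<le> (\<Sum>i | l \<in> J i. norm (D i x l))"
        using x by (simp add: block_op_def norm_sum)
      then have "norm (block_op r J D x l) powr r \<le> (\<Sum>i | l \<in> J i. norm (D i x l)) powr r"
        using r0 by (intro powr_mono2) auto
      also have "\<dots> \<le> real (card {i. l \<in> J i}) powr r * (\<Sum>i | l \<in> J i. norm (D i x l) powr r)"
        using J(1) r0 by (intro sum_powr_le) auto
      also have "\<dots> \<le> real K powr r * (\<Sum>i<m. norm (D i x l) powr r)"
        using J(2)[of l] r0 m[OF l]
        by (intro mult_mono powr_mono2 sum_mono2) (auto intro: sum_nonneg)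
      finally show ?thesis .
    qed
    then have "(\<Sum>l<n. norm (block_op r J D x l) powr r) \<le> (\<Sum>l<n. real K powr r * (\<Sum>i<m. norm (D i x l) powr r))"
      by (intro sum_mono) auto
    also have "\<dots> = real K powr r * (\<Sum>i<m. \<Sum>l<n. norm (D i x l) powr r)"
      unfolding sum_distrib_left[symmetric] by (subst sum.swap) (rule refl)
    also have "\<dots> \<le> real K powr r * (\<Sum>i<m. (C * lp_norm r (cut (L i) x)) powr r)"
    proof (intro mult_left_mono sum_mono)
      fix i
      have "(\<Sum>l<n. norm (D i x l) powr r) \<le> lp_norm r (D i x) powr r"
        by (intro lp_sum_le r0 mem) auto
      also have "\<dots> \<le> (C * lp_norm r (cut (L i) x)) powr r"
        using r0 bound by (intro powr_mono2) auto
      finally show "(\<Sum>l<n. norm (D i x l) powr r) \<le> (C * lp_norm r (cut (L i) x)) powr r" .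
    qed simp
    also have "(\<Sum>i<m. (C * lp_norm r (cut (L i) x)) powr r) = C powr r * (\<Sum>i<m. \<Sum>l\<in>L i. norm (x l) powr r)"
      unfolding powr_mult lp_cut_finite(2)[OF r0 L(1)] sum_distrib_left ..
    also have "(\<Sum>i<m. \<Sum>l\<in>L i. norm (x l) powr r) = (\<Sum>l\<in>(\<Union>i<m. L i). norm (x l) powr r)"
      using L by (intro sum.UNION_disjoint[symmetric]) (auto simp: disjoint_family_on_def)
    also have "real K powr r * (C powr r * (\<Sum>l\<in>(\<Union>i<m. L i). norm (x l) powr r)) \<le>
        real K powr r * (C powr r * lp_norm r x powr r)"
      using L by (intro mult_left_mono lp_sum_le r0 x) auto
    also have "\<dots> = (real K * C * lp_norm r x) powr r"
      unfolding powr_mult by (simp only: mult.assoc)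
    finally show ?thesis .
  qed
  show "block_op r J D x \<in> lp_space r" "lp_norm r (block_op r J D x) \<le> real K * C * lp_norm r x"
    using lp_bounded_sums[OF r0 _ *] C by auto
qed

lemma block_op_lp_ops:
  fixes D :: "nat \<Rightarrow> (nat \<Rightarrow> 'k::{real_normed_field, euclidean_space}) \<Rightarrow> nat \<Rightarrow> 'k"
  assumes r: "1 \<le> r" and C: "0 \<le> C"
    and lin: "\<And>i. linear_on (lp_space r) (D i)"
    and mem: "\<And>i x. x \<in> lp_space r \<Longrightarrow> D i x \<in> lp_space r"
    and bound: "\<And>i x. x \<in> lp_space r \<Longrightarrow> lp_norm r (D i x) \<le> C * lp_norm r (cut (L i) x)"
    and L: "\<And>i. finite (L i)" "disjoint_family L"
    and J: "\<And>l. finite {i. l \<in> J i}" "\<And>l. card {i. l \<in> J i} \<le> K"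
  shows "block_op r J D \<in> lp_ops r r"
proof (rule lp_opsI[where C="real K * C"])
  fix x :: "nat \<Rightarrow> 'k" assume x: "x \<in> lp_space r"
  note b = block_op_bound[where D=D and x=x, OF r C mem[OF x] bound[OF x] L J x]
  show "block_op r J D x \<in> lp_space r" by (rule b(1))
  show "lp_norm r (block_op r J D x) \<le> real K * C * lp_norm r x" by (rule b(2))
  show "block_op r J D (seq_scale c x) = seq_scale c (block_op r J D x)" for c
  proof
    fix l
    have "D i (seq_scale c x) l = c * D i x l" for i
      unfolding linear_onD(2)[OF lin x] by (simp add: seq_scale_def)
    then show "block_op r J D (seq_scale c x) l = seq_scale c (block_op r J D x) l"
      using x lp_scale(1)[OF _ x, of c] r by (simp add: block_op_def sum_distrib_left) (simp add: seq_scale_def sum_distrib_left)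
  qed
  fix y :: "nat \<Rightarrow> 'k" assume y: "y \<in> lp_space r"
  show "block_op r J D (x + y) = block_op r J D x + block_op r J D y"
  proof
    fix l
    have "D i (x + y) l = D i x l + D i y l" for i
      unfolding linear_onD(1)[OF lin x y] by simp
    then show "block_op r J D (x + y) l = (block_op r J D x + block_op r J D y) l"
      using x y lp_add(1)[OF r x y] by (simp add: block_op_def sum.distrib)
  qed
qed (simp add: block_op_def)

lemma card_disjoint_family:
  assumes "disjoint_family L"
  shows "finite {i::nat. l \<in> L i}" "card {i. l \<in> L i} \<le> 1"
proof -
  have "i = j" if "l \<in> L i" "l \<in> L j" for i j
    using assms that by (auto simp: disjoint_family_on_def)
  then have "\<exists>i0. {i. l \<in> L i} \<subseteq> {i0}" by blast
  then obtain i0 where i0: "{i. l \<in> L i} \<subseteq> {i0}" ..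
  show "finite {i. l \<in> L i}" using i0 by (rule finite_subset) simp
  show "card {i. l \<in> L i} \<le> 1" using card_mono[OF _ i0] by simp
qed

text \<open>
  If \<open>l\<close> lies in the intervals for \<open>i\<close> and \<open>j\<close>, then \<open>i\<close> and \<open>j\<close> differ by at most \<open>2\<close>.
\<close>

lemma card_overlapping_intervals:
  assumes "strict_mono (n :: nat \<Rightarrow> nat)"
  shows "finite {i. l \<in> {n (i - 1)..<n (i + 2)}}" "card {i. l \<in> {n (i - 1)..<n (i + 2)}} \<le> 3"
proof -
  let ?s = "{i. l \<in> {n (i - 1)..<n (i + 2)}}"
  show fin: "finite ?s"
  proof (rule finite_subset[of _ "{..l + 1}"])
    show "?s \<subseteq> {..l + 1}"
    proof
      fix i assume "i \<in> ?s"
      then have "i - 1 \<le> l" using strict_mono_imp_increasing[OF assms, of "i - 1"] by simp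
      then show "i \<in> {..l + 1}" by simp
    qed
  qed simp
  show "card ?s \<le> 3"
  proof (cases "?s = {}")
    case True
    show ?thesis unfolding True by simp
  next
    case False
    define i0 where "i0 = Min ?s"
    have i0: "i0 \<in> ?s" unfolding i0_def using fin False by (rule Min_in)
    have "?s \<subseteq> {i0..i0 + 2}"
    proof
      fix i assume i: "i \<in> ?s"
      then have "n (i - 1) < n (i0 + 2)" using i0 by simp
      then have "i - 1 < i0 + 2" using strict_mono_less[OF assms] by blast
      moreover have "i0 \<le> i" unfolding i0_def using fin i by (rule Min_le)
      ultimately show "i \<in> {i0..i0 + 2}" by simp
    qed
    then have "card ?s \<le> card {i0..i0 + 2}" by (intro card_mono) auto
    then show ?thesis by simp
  qed
qed

text \<open>
  The last two claims say that no interval contains a point between \<open>a i\<close> and \<open>N (Suc i)\<close>.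
\<close>

lemma disjoint_intervals:
  fixes N a :: "nat \<Rightarrow> nat"
  assumes "\<And>i. N i \<le> a i" "\<And>i. a i \<le> N (Suc i)"
  shows "disjoint_family (\<lambda>i. {N i..<a i})"
    and "l \<in> {N j..<a j} \<Longrightarrow> l < N (Suc i) \<Longrightarrow> l < a i"
    and "l \<in> {N j..<a j} \<Longrightarrow> a i \<le> l \<Longrightarrow> N (Suc i) \<le> l"
proof -
  have mono: "N i \<le> N j" "a i \<le> a j" if "i \<le> j" for i j
  proof -
    show "N i \<le> N j" using that by (rule lift_Suc_mono_le[rotated]) (meson assms le_trans)
    show "a i \<le> a j" using that by (rule lift_Suc_mono_le[rotated]) (meson assms le_trans)
  qed
  have sep: "a i \<le> N j" if "i < j" for i j
    using mono(1)[of "Suc i" j] assms(2)[of i] that by simp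
  show "disjoint_family (\<lambda>i. {N i..<a i})"
    unfolding disjoint_family_on_def
  proof (intro ballI impI)
    fix i j :: nat assume "i \<noteq> j"
    then consider "i < j" | "j < i" by linarith
    then show "{N i..<a i} \<inter> {N j..<a j} = {}"
      using sep by cases fastforce+
  qed
  show "l < a i" if "l \<in> {N j..<a j}" "l < N (Suc i)"
  proof -
    have "j < Suc i" using that mono(1)[of "Suc i" j] by (cases "j < Suc i") auto
    then show ?thesis using mono(2)[of j i] that by simp
  qed
  show "N (Suc i) \<le> l" if "l \<in> {N j..<a j}" "a i \<le> l"
  proof -
    have "i < j" using that mono(2)[of j i] by (cases "i < j") auto
    then show ?thesis using mono(1)[of "Suc i" j] that by simp
  qed
qed

text \<open>
  Up to \<open>d\<close>, the operator \<open>T\<close> connects no coordinate below \<open>a\<close> to one from \<open>b\<close> on, in either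
  direction.
\<close>

definition gap ::
    "real \<Rightarrow> real \<Rightarrow> ((nat \<Rightarrow> 'k::{real_normed_field, euclidean_space}) \<Rightarrow> nat \<Rightarrow> 'k) \<Rightarrow> real \<Rightarrow> nat \<Rightarrow> nat \<Rightarrow> bool" where
  "gap p q T d a b \<longleftrightarrow> a < b \<and>
     (\<forall>x\<in>lp_space p. lp_norm q (cut {b..} (T (cut {..<a} x))) \<le> d * lp_norm p x) \<and>
     (\<forall>x\<in>lp_space p. lp_norm q (cut {..<a} (T (cut {b..} x))) \<le> d * lp_norm p x)"

lemma gapD:
  assumes "gap p q T d a b"
  shows "a < b"
    and "x \<in> lp_space p \<Longrightarrow> lp_norm q (cut {b..} (T (cut {..<a} x))) \<le> d * lp_norm p x"
    and "x \<in> lp_space p \<Longrightarrow> lp_norm q (cut {..<a} (T (cut {b..} x))) \<le> d * lp_norm p x"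
  using assms unfolding gap_def by simp_all

lemma tail_gap:
  assumes T: "T \<in> lp_ops p q" and "1 < p" "1 \<le> q" "0 < d"
  shows "\<exists>b. gap p q T d a b"
proof -
  obtain m1 where m1: "\<forall>m'\<ge>m1. \<forall>x\<in>lp_space p. lp_norm q (cut {m'..} (T (cut {..<a} x))) \<le> d * lp_norm p x"
    using column_tail_small[OF T _ \<open>1 \<le> q\<close> \<open>0 < d\<close>, of a] \<open>1 < p\<close> by (auto simp only: less_imp_le)
  obtain m2 where m2: "\<forall>m'\<ge>m2. \<forall>x\<in>lp_space p. lp_norm q (cut {..<a} (T (cut {m'..} x))) \<le> d * lp_norm p x"
    using row_tail_small[OF T \<open>1 < p\<close> \<open>1 \<le> q\<close> \<open>0 < d\<close>, of a] by (rule exE)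
  let ?b = "max (Suc a) (max m1 m2)"
  have "gap p q T d a ?b"
    unfolding gap_def
  proof (intro conjI)
    show "a < ?b" by simp
    show "\<forall>x\<in>lp_space p. lp_norm q (cut {?b..} (T (cut {..<a} x))) \<le> d * lp_norm p x"
      by (rule m1[THEN spec, THEN mp]) simp
    show "\<forall>x\<in>lp_space p. lp_norm q (cut {..<a} (T (cut {?b..} x))) \<le> d * lp_norm p x"
      by (rule m2[THEN spec, THEN mp]) simp
  qed
  then show ?thesis by (rule exI)
qed

lemma lp_ops_minus:
  assumes S: "S \<in> lp_ops p q" and T: "T \<in> lp_ops p q" and "1 \<le> q"
  shows "(\<lambda>x. S x - T x) \<in> lp_ops p q"
proof -
  obtain C where C: "\<And>x. x \<in> lp_space p \<Longrightarrow> lp_norm q (S x) \<le> C * lp_norm p x"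
    using lp_ops_bound[OF S] by metis
  obtain D where D: "\<And>x. x \<in> lp_space p \<Longrightarrow> lp_norm q (T x) \<le> D * lp_norm p x"
    using lp_ops_bound[OF T] by metis
  show ?thesis
  proof (rule lp_opsI[where C="C + D"])
    fix x :: "nat \<Rightarrow> 'a" assume x: "x \<in> lp_space p"
    note l = lp_opsD(1)[OF S x] lp_opsD(1)[OF T x]
    show "S x - T x \<in> lp_space q"
      by (rule lp_diff(1)[OF \<open>1 \<le> q\<close> l])
    show "lp_norm q (S x - T x) \<le> (C + D) * lp_norm p x"
      using lp_diff(2)[OF \<open>1 \<le> q\<close> l] C[OF x] D[OF x] by (simp add: distrib_right)
    show "S (seq_scale c x) - T (seq_scale c x) = seq_scale c (S x - T x)" for c
      unfolding lp_opsD(4)[OF S x] lp_opsD(4)[OF T x] by (simp add: fun_eq_iff seq_scale_def right_diff_distrib)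
    fix y :: "nat \<Rightarrow> 'a" assume y: "y \<in> lp_space p"
    show "S (x + y) - T (x + y) = S x - T x + (S y - T y)"
      unfolding lp_opsD(3)[OF S x y] lp_opsD(3)[OF T x y] by simp
  next
    fix x :: "nat \<Rightarrow> 'a" assume x: "x \<notin> lp_space p"
    show "S x - T x = 0"
      unfolding lp_opsD(2)[OF S x] lp_opsD(2)[OF T x] by simp
  qed
qed

section \<open>Approximating an operator through a Hilbert space\<close>

lemma gap_choice:
  assumes T: "T \<in> lp_ops p q" and "1 < p" "1 \<le> q" "\<And>i. 0 < d i"
  shows "\<exists>g. \<forall>i a. gap p q T (d i) a (g i a)"
proof -
  have "\<exists>b. gap p q T (d i) a b" for i a
    by (rule tail_gap[OF assms(1-3) assms(4)])
  then show ?thesis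
    by (intro exI[of _ "\<lambda>i a. SOME b. gap p q T (d i) a b"] allI) (rule someI_ex)
qed

lemma cut_initial_eq_sum:
  fixes x :: "nat \<Rightarrow> 'k::{real_normed_field, euclidean_space}"
  assumes "n 0 = 0" "\<And>i. n i \<le> n (Suc i)"
  shows "cut {..<n k} x = (\<Sum>i<k. cut {n i..<n (Suc i)} x)"
proof (induction k)
  case 0
  show ?case using assms(1) by (simp add: cut_def fun_eq_iff)
next
  case (Suc k)
  have split: "{..<n (Suc k)} = {..<n k} \<union> {n k..<n (Suc k)}" using assms(2)[of k] by auto
  have "{..<n k} \<inter> {n k..<n (Suc k)} = {}" by auto
  then have "cut {..<n (Suc k)} x = cut {..<n k} x + cut {n k..<n (Suc k)} x"
    unfolding split by (rule cut_split)
  then show ?case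
    unfolding Suc.IH sum.lessThan_Suc .
qed

lemma l2_copyD:
  assumes "l2_copy p q R C M L \<alpha> \<beta>"
  shows "linear_on UNIV \<alpha>" "linear_on UNIV \<beta>" "cut L (\<beta> y) = \<beta> y"
    "lp_norm p (\<beta> y) \<le> lp_norm 2 (cut {..<M} y)" "\<alpha> z \<in> lp_space 2"
    "lp_norm 2 (\<alpha> z) \<le> C * lp_norm q (cut L z)" "\<alpha> (R (\<beta> y)) = cut {..<M} y"
  using assms unfolding l2_copy_def by simp_all

text \<open>
  The image of the block \<open>[n i, n (i + 1))\<close> below \<open>n (i - 1)\<close> is controlled by the gap at \<open>i - 1\<close>,
  and its image beyond \<open>n (i + 2)\<close> by the gap at \<open>i + 1\<close>.
\<close>

lemma block_approximation_error:
  fixes S :: "(nat \<Rightarrow> 'k::{real_normed_field, euclidean_space}) \<Rightarrow> nat \<Rightarrow> 'k" and i :: nat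
  assumes S: "S \<in> lp_ops p q" and "1 \<le> p" "1 \<le> q" "0 \<le> d"
    and n: "n 0 = 0" "\<And>i. gap p q S (d * (1/2)^i) (n i) (n (Suc i))"
    and x: "x \<in> lp_space p"
  defines "y \<equiv> S (cut {n i..<n (Suc i)} x)"
  shows "lp_norm q (y - cut {n (i - 1)..<n (i + 2)} y) \<le> 3 * d * (1/2)^i * lp_norm p x"
proof -
  have pq: "0 < p" "0 < q" using \<open>1 \<le> p\<close> \<open>1 \<le> q\<close> by auto
  define u where "u = cut {n i..<n (Suc i)} x"
  have u: "u \<in> lp_space p" "lp_norm p u \<le> lp_norm p x"
    unfolding u_def using lp_cut[OF pq(1) x] by auto
  have y: "y \<in> lp_space q" "y = S u" unfolding y_def u_def[symmetric] using lp_opsD(1)[OF S u(1)] by auto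
  have nmono: "n j < n (Suc j)" for j by (rule gapD(1)[OF n(2)])
  have upper: "lp_norm q (cut {n (i + 2)..} y) \<le> d * (1/2)^i * lp_norm p x"
  proof -
    have "cut {..<n (Suc i)} u = u" unfolding u_def by (auto simp: cut_def)
    then have "lp_norm q (cut {n (i + 2)..} y) \<le> d * (1/2)^(Suc i) * lp_norm p u"
      using gapD(2)[OF n(2)[of "Suc i"] u(1)] unfolding y(2) by simp
    also have "\<dots> \<le> d * (1/2)^i * lp_norm p x"
      using u(2) \<open>0 \<le> d\<close> by (intro mult_mono) auto
    finally show ?thesis .
  qed
  have lower: "lp_norm q (cut {..<n (i - 1)} y) \<le> 2 * d * (1/2)^i * lp_norm p x"
  proof (cases i)
    case 0
    have "cut {..<n (i - 1)} y = 0" using 0 n(1) by (simp add: cut_def fun_eq_iff)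
    then show ?thesis using \<open>0 \<le> d\<close> by simp
  next
    case (Suc j)
    have "cut {n (Suc j)..} u = u" unfolding u_def Suc by (auto simp: cut_def)
    then have "lp_norm q (cut {..<n (i - 1)} y) \<le> d * (1/2)^j * lp_norm p u"
      using gapD(3)[OF n(2)[of j] u(1)] unfolding y(2) Suc by simp
    also have "\<dots> \<le> d * (1/2)^j * lp_norm p x"
      using u(2) \<open>0 \<le> d\<close> by (intro mult_left_mono) auto
    also have "d * (1/2)^j = 2 * d * (1/2)^i" by (simp add: Suc)
    finally show ?thesis .
  qed
  have mono: "n (i - 1) \<le> n (i + 2)"
    using lift_Suc_mono_le[of n "i - 1" "i + 2"] nmono by (simp add: less_imp_le)
  have "y - cut {n (i - 1)..<n (i + 2)} y = cut {..<n (i - 1)} y + cut {n (i + 2)..} y"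
    using mono by (auto simp: cut_def fun_eq_iff)
  then have "lp_norm q (y - cut {n (i - 1)..<n (i + 2)} y) \<le>
      lp_norm q (cut {..<n (i - 1)} y) + lp_norm q (cut {n (i + 2)..} y)"
    using lp_add(2)[OF \<open>1 \<le> q\<close> lp_cut(1)[OF pq(2) y(1)] lp_cut(1)[OF pq(2) y(1)]] by simp
  then show ?thesis
    using upper lower by (simp add: algebra_simps)
qed

text \<open>
  On its own block, \<open>v\<close> equals \<open>\<beta> y\<close>, which \<open>\<alpha> \<circ> R\<close> maps to the truncation of \<open>y\<close>. The rest of \<open>v\<close>
  lives on earlier and later blocks, from which \<open>R\<close> leads to the present block only with small
  norm, by the gaps before and after it.
\<close>

lemma diagonal_block_error:
  fixes R :: "(nat \<Rightarrow> 'k::{real_normed_field, euclidean_space}) \<Rightarrow> nat \<Rightarrow> 'k"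
  assumes R: "R \<in> lp_ops p q" and "1 \<le> p" "1 \<le> q" "0 \<le> d" "0 \<le> C"
    and N: "N 0 = 0" "\<And>i. N i \<le> a i" "\<And>i. gap p q R (d * (1/2)^i) (a i) (N (Suc i))"
    and copy: "l2_copy p q R C M {N i..<a i} \<alpha> \<beta>"
    and v: "v \<in> lp_space p" "\<And>l. v l \<noteq> 0 \<Longrightarrow> \<exists>j. l \<in> {N j..<a j}"
    and block: "cut {N i..<a i} v = \<beta> y"
  shows "lp_norm 2 (\<alpha> (R v) - cut {..<M} y) \<le> C * (3 * d * (1/2)^i * lp_norm p v)"
proof -
  have pq: "0 < p" "0 < q" using \<open>1 \<le> p\<close> \<open>1 \<le> q\<close> by auto
  have aN: "a j \<le> N (Suc j)" for j
    using gapD(1)[OF N(3)] by (rule less_imp_le)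
  define L where "L = {N i..<a i}"
  define e1 where "e1 = cut {..<N i} v"
  define e2 where "e2 = cut {a i..} v"
  have e: "e1 \<in> lp_space p" "e2 \<in> lp_space p" "\<beta> y \<in> lp_space p"
    unfolding e1_def e2_def block[symmetric] using lp_cut(1)[OF pq(1) v(1)] by auto
  have e12: "e1 + e2 \<in> lp_space p" by (rule lp_add(1)[OF \<open>1 \<le> p\<close> e(1,2)])
  have "v = cut L v + (e1 + e2)"
    using N(2)[of i] by (auto simp: L_def e1_def e2_def cut_def fun_eq_iff)
  then have "v = \<beta> y + (e1 + e2)"
    unfolding L_def block .
  then have "R v = R (\<beta> y) + (R e1 + R e2)"
    using lp_opsD(3)[OF R e(3) e12] lp_opsD(3)[OF R e(1,2)] by simp
  then have "\<alpha> (R v) = \<alpha> (R (\<beta> y)) + (\<alpha> (R e1) + \<alpha> (R e2))"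
    using linear_onD(1)[OF l2_copyD(1)[OF copy] UNIV_I UNIV_I] by simp
  then have diff: "\<alpha> (R v) - cut {..<M} y = \<alpha> (R e1) + \<alpha> (R e2)"
    unfolding l2_copyD(7)[OF copy] by simp
  have Rcut: "R (cut A v) \<in> lp_space q" for A
    using lp_opsD(1)[OF R lp_cut(1)[OF pq(1) v(1)]] .
  have b2: "lp_norm q (cut L (R e2)) \<le> d * (1/2)^i * lp_norm p v"
  proof -
    have "e2 = cut {N (Suc i)..} v"
    proof
      fix l
      show "e2 l = cut {N (Suc i)..} v l"
        using v(2)[of l] disjoint_intervals(3)[where N=N and a=a and l=l and i=i, OF N(2) aN] aN[of i]
        by (auto simp: e2_def cut_def)
    qed
    then have "lp_norm q (cut L (R e2)) \<le> lp_norm q (cut {..<a i} (R (cut {N (Suc i)..} v)))"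
      using lp_cut_mono[OF pq(2) Rcut, of L "{..<a i}"] by (simp add: L_def subset_eq)
    also have "\<dots> \<le> d * (1/2)^i * lp_norm p v"
      by (rule gapD(3)[OF N(3) v(1)])
    finally show ?thesis .
  qed
  have b1: "lp_norm q (cut L (R e1)) \<le> 2 * d * (1/2)^i * lp_norm p v"
  proof (cases i)
    case 0
    have "e1 = 0" using 0 N(1) by (simp add: e1_def cut_def fun_eq_iff)
    then have "cut L (R e1) = 0" using lp_ops_zero[OF R] by simp
    then show ?thesis using \<open>0 \<le> d\<close> by simp
  next
    case (Suc j)
    have "e1 = cut {..<a j} v"
    proof
      fix l
      show "e1 l = cut {..<a j} v l"
        using v(2)[of l] disjoint_intervals(2)[where N=N and a=a and l=l and i=j, OF N(2) aN] aN[of j]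
        by (auto simp: e1_def cut_def Suc)
    qed
    then have "lp_norm q (cut L (R e1)) \<le> lp_norm q (cut {N (Suc j)..} (R (cut {..<a j} v)))"
      using lp_cut_mono[OF pq(2) Rcut, of L "{N (Suc j)..}"] by (simp add: L_def Suc subset_eq)
    also have "\<dots> \<le> d * (1/2)^j * lp_norm p v"
      by (rule gapD(2)[OF N(3) v(1)])
    also have "d * (1/2)^j = 2 * d * (1/2)^i" by (simp add: Suc)
    finally show ?thesis .
  qed
  have "lp_norm 2 (\<alpha> (R v) - cut {..<M} y) \<le> lp_norm 2 (\<alpha> (R e1)) + lp_norm 2 (\<alpha> (R e2))"
    unfolding diff by (rule lp_add(2)[OF _ l2_copyD(5)[OF copy] l2_copyD(5)[OF copy]]) simp
  also have "\<dots> \<le> C * lp_norm q (cut L (R e1)) + C * lp_norm q (cut L (R e2))"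
    unfolding L_def by (intro add_mono l2_copyD(6)[OF copy])
  also have "\<dots> \<le> C * (2 * d * (1/2)^i * lp_norm p v) + C * (d * (1/2)^i * lp_norm p v)"
    using b1 b2 \<open>0 \<le> C\<close> by (intro add_mono mult_left_mono)
  also have "\<dots> = C * (3 * d * (1/2)^i * lp_norm p v)"
    by (simp add: algebra_simps)
  finally show ?thesis .
qed

lemma sum_half_powers_le: "(\<Sum>i<m. (1/2)^i) \<le> (2::real)"
proof -
  have "(\<Sum>i<m. (1/2)^i) = 2 - 2 * (1/2 :: real)^m"
    by (induction m) auto
  then show ?thesis by simp
qed

text \<open>
  All errors in the \<open>i\<close>-th block are at most a fixed multiple \<open>D\<close> of \<open>d / 2^i\<close>, and \<open>d\<close> is chosen
  such that they sum to at most \<open>e\<close>. The operator \<open>V\<close> sums \<open>\<beta> i (B (cut (I i) x))\<close> and \<open>U\<close> sums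
  \<open>cut (J i) (A (\<alpha> i z))\<close>, so that on the block \<open>L i\<close> the copy of \<open>\<ell>\<^sub>2\<^sup>M\<close> inside \<open>R\<close> passes \<open>B\<close> on
  to \<open>A\<close>.
\<close>

lemma factorization_through_l2_approximation:
  fixes R :: "(nat \<Rightarrow> 'k::{real_normed_field, euclidean_space}) \<Rightarrow> nat \<Rightarrow> 'k"
  assumes "1 < p" "p \<le> 2" "2 \<le> q" and R: "R \<in> lp_ops p q" and nF: "\<not> finitely_strictly_singular p q R"
    and A: "A \<in> lp_ops 2 q" and B: "B \<in> lp_ops p 2" and "0 < e"
  shows "\<exists>U\<in>lp_ops q q. \<exists>V\<in>lp_ops p p. \<forall>x\<in>lp_space p. lp_norm q (A (B x) - U (R (V x))) \<le> e * lp_norm p x"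
proof -
  have pq: "0 < p" "1 \<le> p" "0 < q" "1 \<le> q" using \<open>1 < p\<close> \<open>2 \<le> q\<close> by auto
  define S where "S = A \<circ> B"
  have S: "S \<in> lp_ops p q" unfolding S_def by (rule lp_ops_comp[OF A B])
  obtain CA where CA: "0 < CA" "\<And>x. x \<in> lp_space 2 \<Longrightarrow> lp_norm q (A x) \<le> CA * lp_norm 2 x"
    using lp_ops_bound[OF A] by metis
  obtain CB where CB: "0 < CB" "\<And>x. x \<in> lp_space p \<Longrightarrow> lp_norm 2 (B x) \<le> CB * lp_norm p x"
    using lp_ops_bound[OF B] by metis
  obtain C where C0: "0 < C \<and> (\<forall>M N. \<exists>N'\<ge>N. \<exists>\<alpha> \<beta>. l2_copy p q R C M {N..<N'} \<alpha> \<beta>)"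
    using Hilbert_copies[OF R pq(2) \<open>p \<le> 2\<close> \<open>2 \<le> q\<close> nF] by (rule exE)
  note C = C0[THEN conjunct1]
  \<comment> \<open>The three terms come from cutting off the image of a block, from truncating in \<open>\<ell>\<^sub>2\<close>, and from the off-diagonal part of \<open>R\<close>.\<close>
  define D where "D = 3 + CA + CA * (C * (3 * CB))"
  have D: "0 < D" using CA CB C by (auto simp: D_def intro!: add_pos_pos)
  define d where "d = e / (2 * D)"
  have d: "0 < d" "D * d = e / 2" using D \<open>0 < e\<close> by (auto simp: d_def)
  have d': "0 < d * (1/2)^i" for i :: nat using d by simp
  obtain g where g: "\<forall>i a. gap p q S (d * (1/2)^i) a (g i a)"
    using gap_choice[of S p q "\<lambda>i. d * (1/2)^i", OF S \<open>1 < p\<close> pq(4) d'] by (rule exE)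
  define n where "n = rec_nat 0 g"
  have n: "n 0 = 0" "\<And>i. gap p q S (d * (1/2)^i) (n i) (n (Suc i))"
    using g by (auto simp: n_def)
  have nmono: "strict_mono n"
    unfolding strict_mono_Suc_iff using gapD(1)[OF n(2)] by blast
  define I where "I = (\<lambda>i. {n i..<n (Suc i)})"
  define J where "J = (\<lambda>i. {n (i - 1)..<n (i + 2)})"
  have "\<exists>m. \<forall>x\<in>lp_space p. lp_norm 2 (cut {m..} (B (cut {..<n (Suc i)} x))) \<le> d * (1/2)^i * lp_norm p x" for i
  proof -
    have "(1::real) \<le> 2" by simp
    from column_tail_small[OF B pq(2) this d'[of i], of "n (Suc i)"]
    obtain m where m: "\<forall>m'\<ge>m. \<forall>x\<in>lp_space p.
        lp_norm 2 (cut {m'..} (B (cut {..<n (Suc i)} x))) \<le> d * (1/2)^i * lp_norm p x"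
      by (rule exE)
    show ?thesis
      by (rule exI[of _ m]) (rule m[THEN spec, THEN mp, OF order_refl])
  qed
  then have "\<forall>i. \<exists>m. \<forall>x\<in>lp_space p. lp_norm 2 (cut {m..} (B (cut {..<n (Suc i)} x))) \<le> d * (1/2)^i * lp_norm p x"
    by (rule allI)
  from choice[OF this] obtain M where M': "\<forall>i. \<forall>x\<in>lp_space p.
      lp_norm 2 (cut {M i..} (B (cut {..<n (Suc i)} x))) \<le> d * (1/2)^i * lp_norm p x"
    by (rule exE)
  note M = M'[THEN spec, THEN bspec]
  define good where "good = (\<lambda>M N t. N \<le> fst t \<and> l2_copy p q R C M {N..<fst t} (fst (snd t)) (snd (snd t)))"
  define t where "t = (\<lambda>M N. SOME t. good M N t)"
  have t: "good M N (t M N)" for M N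
  proof -
    from C0[THEN conjunct2, THEN spec, THEN spec, of N M]
    obtain N' \<alpha> \<beta> where "N \<le> N'" "l2_copy p q R C M {N..<N'} \<alpha> \<beta>"
      by (elim exE conjE)
    then have "good M N (N', \<alpha>, \<beta>)" by (simp add: good_def)
    then show ?thesis unfolding t_def by (rule someI)
  qed
  obtain h where h: "\<forall>i a. gap p q R (d * (1/2)^i) a (h i a)"
    using gap_choice[of R p q "\<lambda>i. d * (1/2)^i", OF R \<open>1 < p\<close> pq(4) d'] by (rule exE)
  \<comment> \<open>Each copy begins beyond the gap of \<open>R\<close> that follows the end \<open>fst (t (M i) b)\<close> of its predecessor.\<close>
  define N where "N = rec_nat 0 (\<lambda>i b. h i (fst (t (M i) b)))"
  define a where "a = (\<lambda>i. fst (t (M i) (N i)))"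
  define \<alpha> where "\<alpha> = (\<lambda>i. fst (snd (t (M i) (N i))))"
  define \<beta> where "\<beta> = (\<lambda>i. snd (snd (t (M i) (N i))))"
  have N: "N 0 = 0" "\<And>i. N i \<le> a i" "\<And>i. gap p q R (d * (1/2)^i) (a i) (N (Suc i))"
    using h t by (simp_all add: N_def a_def good_def)
  have copy: "l2_copy p q R C (M i) {N i..<a i} (\<alpha> i) (\<beta> i)" for i
    using t[of "M i" "N i"] unfolding good_def a_def \<alpha>_def \<beta>_def by (rule conjunct2)
  define L where "L = (\<lambda>i. {N i..<a i})"
  have aN: "a i \<le> N (Suc i)" for i
    using gapD(1)[OF N(3)] by (rule less_imp_le)
  have Ldisj: "disjoint_family L"
    unfolding L_def by (rule disjoint_intervals(1)[where N=N and a=a, OF N(2) aN])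
  have Idisj: "disjoint_family I"
    unfolding I_def
    by (rule disjoint_intervals(1)[where N=n and a="\<lambda>i. n (Suc i)"])
       (rule less_imp_le[OF gapD(1)[OF n(2)]] order_refl)+
  have finLI: "finite (L i)" "finite (I i)" for i by (auto simp: L_def I_def)
  define DB where "DB = (\<lambda>i x. \<beta> i (B (cut (I i) x)))"
  define V where "V = block_op p L DB"
  define DA where "DA = (\<lambda>i z. cut (J i) (A (\<alpha> i z)))"
  define U where "U = block_op q J DA"
  have cutI: "cut (I i) x \<in> lp_space p" if "x \<in> lp_space p" for i x
    by (rule lp_cut(1)[OF pq(1) that])
  have BI: "B (cut (I i) x) \<in> lp_space 2" if "x \<in> lp_space p" for i x
    by (rule lp_opsD(1)[OF B cutI[OF that]])
  have A\<alpha>: "A (\<alpha> i z) \<in> lp_space q" for i z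
    by (rule lp_opsD(1)[OF A l2_copyD(5)[OF copy]])
  have DBmem: "DB i x \<in> lp_space p" for i x
    unfolding DB_def using lp_cut_finite(1)[OF pq(1) finLI(1)[of i], of "\<beta> i (B (cut (I i) x))"]
      l2_copyD(3)[OF copy, of i] by (simp add: L_def)
  have DBsupp: "cut (L i) (DB i x) = DB i x" for i x
    unfolding DB_def L_def by (rule l2_copyD(3)[OF copy])
  have DBbound: "lp_norm p (DB i x) \<le> CB * lp_norm p (cut (I i) x)" if "x \<in> lp_space p" for i x
  proof -
    have "lp_norm p (DB i x) \<le> lp_norm 2 (cut {..<M i} (B (cut (I i) x)))"
      unfolding DB_def by (rule l2_copyD(4)[OF copy])
    also have "\<dots> \<le> lp_norm 2 (B (cut (I i) x))"
      by (rule lp_cut(2)[OF _ BI[OF that]]) simp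
    also have "\<dots> \<le> CB * lp_norm p (cut (I i) x)"
      by (rule CB(2)[OF cutI[OF that]])
    finally show ?thesis .
  qed
  have DBlin: "linear_on (lp_space p) (DB i)" for i
    unfolding linear_on_def
  proof (intro conjI ballI allI)
    fix x y :: "nat \<Rightarrow> 'k" and c :: 'k assume x: "x \<in> lp_space p"
    show "DB i (seq_scale c x) = seq_scale c (DB i x)"
      unfolding DB_def cut_linear lp_opsD(4)[OF B cutI[OF x]] linear_onD(2)[OF l2_copyD(2)[OF copy] UNIV_I] ..
    assume y: "y \<in> lp_space p"
    show "DB i (x + y) = DB i x + DB i y"
      unfolding DB_def cut_linear lp_opsD(3)[OF B cutI[OF x] cutI[OF y]]
        linear_onD(1)[OF l2_copyD(2)[OF copy] UNIV_I UNIV_I] ..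
  qed
  have DAmem: "DA i z \<in> lp_space q" for i z
    unfolding DA_def by (rule lp_cut(1)[OF pq(3) A\<alpha>])
  have DAbound: "lp_norm q (DA i z) \<le> CA * C * lp_norm q (cut (L i) z)" for i z
  proof -
    have "lp_norm q (DA i z) \<le> lp_norm q (A (\<alpha> i z))"
      unfolding DA_def by (rule lp_cut(2)[OF pq(3) A\<alpha>])
    also have "\<dots> \<le> CA * lp_norm 2 (\<alpha> i z)"
      by (rule CA(2)[OF l2_copyD(5)[OF copy]])
    also have "\<dots> \<le> CA * (C * lp_norm q (cut (L i) z))"
      unfolding L_def using CA(1) by (intro mult_left_mono l2_copyD(6)[OF copy]) auto
    finally show ?thesis by (simp add: mult.assoc)
  qed
  have DAlin: "linear_on (lp_space q) (DA i)" for i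
    unfolding linear_on_def DA_def linear_onD(1)[OF l2_copyD(1)[OF copy] UNIV_I UNIV_I]
      linear_onD(2)[OF l2_copyD(1)[OF copy] UNIV_I]
      lp_opsD(3)[OF A l2_copyD(5)[OF copy] l2_copyD(5)[OF copy]] lp_opsD(4)[OF A l2_copyD(5)[OF copy]] cut_linear
    by simp
  have V: "V \<in> lp_ops p p"
    unfolding V_def using CB(1) card_disjoint_family[OF Ldisj]
    by (intro block_op_lp_ops[where C=CB and L=I and K=1, OF pq(2) _ DBlin DBmem DBbound finLI(2) Idisj]) auto
  have U: "U \<in> lp_ops q q"
    unfolding U_def using CA(1) C card_overlapping_intervals[OF nmono]
    by (intro block_op_lp_ops[where C="CA * C" and L=L and K=3, OF pq(4) _ DAlin DAmem DAbound finLI(1) Ldisj])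
       (auto simp: J_def)
  have VU: "(\<lambda>x. U (R (V x))) \<in> lp_ops p q"
    using lp_ops_comp[OF U lp_ops_comp[OF R V]] by (simp add: o_def)
  have Vnorm: "lp_norm p (V x) \<le> CB * lp_norm p x" if x: "x \<in> lp_space p" for x
    unfolding V_def using CB(1) card_disjoint_family[OF Ldisj]
      block_op_bound(2)[where C=CB and L=I and K=1 and D=DB and x=x, OF pq(2) _ DBmem DBbound[OF x] finLI(2) Idisj _ _ x]
    by simp
  have fin: "lp_norm q (S x - U (R (V x))) \<le> e * lp_norm p x"
    if x: "x \<in> lp_space p" and xk: "cut {..<k} x = x" for x k
  proof -
    have Vx: "V x \<in> lp_space p" by (rule lp_opsD(1)[OF V x])
    have Vl: "V x l = DB i x l" if "l \<in> L i" for l i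
    proof -
      have "{j. l \<in> L j} = {i}"
        using Ldisj that by (auto simp: disjoint_family_on_def)
      then show ?thesis using x by (simp add: V_def block_op_def)
    qed
    have Vsupp: "\<exists>j. l \<in> {N j..<a j}" if "V x l \<noteq> 0" for l
    proof (rule ccontr)
      assume "\<nexists>j. l \<in> {N j..<a j}"
      then have "{j. l \<in> L j} = {}" by (simp add: L_def)
      then show False using that x by (simp add: V_def block_op_def)
    qed
    have Vblock: "cut {N i..<a i} (V x) = \<beta> i (B (cut (I i) x))" for i
    proof -
      have "cut (L i) (V x) = cut (L i) (DB i x)"
        using Vl[of _ i] by (simp add: cut_def fun_eq_iff)
      then show ?thesis unfolding DBsupp by (simp add: L_def DB_def)
    qed
    \<comment> \<open>The error is treated block by block. It is an infinite sum: although \<open>x\<close> has finite support, \<open>R (V x)\<close> need not.\<close>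
    define w where "w = (\<lambda>i. S (cut (I i) x) - cut (J i) (A (\<alpha> i (R (V x)))))"
    have w: "w i \<in> lp_space q \<and> lp_norm q (w i) \<le> D * d * (1/2)^i * lp_norm p x" for i
    proof -
      define y where "y = B (cut (I i) x)"
      have y: "y \<in> lp_space 2" unfolding y_def by (rule BI[OF x])
      have yM: "cut {..<M i} y \<in> lp_space 2" "cut {M i..} y \<in> lp_space 2"
        using lp_cut(1)[OF _ y] by auto
      have \<alpha>y: "\<alpha> i (R (V x)) \<in> lp_space 2" by (rule l2_copyD(5)[OF copy])
      define u where "u = \<alpha> i (R (V x)) - cut {..<M i} y"
      have ul: "u \<in> lp_space 2" unfolding u_def by (rule lp_diff(1)[OF _ \<alpha>y yM(1)]) simp
      have un: "lp_norm 2 u \<le> C * (3 * d * (1/2)^i * (CB * lp_norm p x))"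
      proof -
        have "lp_norm 2 u \<le> C * (3 * d * (1/2)^i * lp_norm p (V x))"
          unfolding u_def y_def
          using C d by (intro diagonal_block_error[OF R pq(2,4) _ _ N copy Vx Vsupp Vblock]) auto
        also have "\<dots> \<le> C * (3 * d * (1/2)^i * (CB * lp_norm p x))"
          using Vnorm[OF x] C d by (intro mult_left_mono) auto
        finally show ?thesis .
      qed
      have yn: "lp_norm 2 (cut {M i..} y) \<le> d * (1/2)^i * lp_norm p x"
      proof -
        have "cut {..<n (Suc i)} (cut (I i) x) = cut (I i) x" by (auto simp: cut_def I_def)
        then have "lp_norm 2 (cut {M i..} y) \<le> d * (1/2)^i * lp_norm p (cut (I i) x)"
          unfolding y_def using M[OF cutI[OF x], of i i] by simp
        also have "\<dots> \<le> d * (1/2)^i * lp_norm p x"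
          using lp_cut(2)[OF pq(1) x] d' by (intro mult_left_mono) (auto intro: less_imp_le)
        finally show ?thesis .
      qed
      have Ay: "S (cut (I i) x) = A y" by (simp add: S_def y_def)
      have Al: "A y \<in> lp_space q" "A (cut {M i..} y) \<in> lp_space q" "A u \<in> lp_space q"
        using lp_opsD(1)[OF A] y yM ul by auto
      have AJ: "cut (J i) (A (cut {M i..} y)) \<in> lp_space q" "cut (J i) (A u) \<in> lp_space q"
        "cut (J i) (A y) \<in> lp_space q"
        using lp_cut(1)[OF pq(3)] Al by auto
      have "A y = A (cut {..<M i} y) + A (cut {M i..} y)"
        using lp_opsD(3)[OF A yM] unfolding cut_lessThan_atLeast[symmetric] .
      moreover have "A u = A (\<alpha> i (R (V x))) - A (cut {..<M i} y)"
        unfolding u_def by (rule lp_ops_diff[OF A _ \<alpha>y yM(1)]) simp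
      ultimately have "A (\<alpha> i (R (V x))) = A y - A (cut {M i..} y) + A u"
        by simp
      then have w_eq: "w i = (A y - cut (J i) (A y)) + (cut (J i) (A (cut {M i..} y)) - cut (J i) (A u))"
        unfolding w_def Ay by simp
      have first: "A y - cut (J i) (A y) \<in> lp_space q"
        by (rule lp_diff(1)[OF pq(4) Al(1) AJ(3)])
      have second: "cut (J i) (A (cut {M i..} y)) - cut (J i) (A u) \<in> lp_space q"
        by (rule lp_diff(1)[OF pq(4) AJ(1,2)])
      have "lp_norm q (A y - cut (J i) (A y)) \<le> 3 * d * (1/2)^i * lp_norm p x"
        using block_approximation_error[OF S pq(2,4) _ n x, of i] d unfolding Ay[symmetric] I_def J_def by simp
      moreover have "lp_norm q (cut (J i) (A (cut {M i..} y))) \<le> CA * (d * (1/2)^i * lp_norm p x)"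
        using lp_cut(2)[OF pq(3) Al(2), of "J i"] CA(2)[OF yM(2)] mult_left_mono[OF yn, of CA] CA(1) by linarith
      moreover have "lp_norm q (cut (J i) (A u)) \<le> CA * (C * (3 * d * (1/2)^i * (CB * lp_norm p x)))"
        using lp_cut(2)[OF pq(3) Al(3), of "J i"] CA(2)[OF ul] mult_left_mono[OF un, of CA] CA(1) by linarith
      moreover have "lp_norm q (w i) \<le> lp_norm q (A y - cut (J i) (A y)) +
          (lp_norm q (cut (J i) (A (cut {M i..} y))) + lp_norm q (cut (J i) (A u)))"
        unfolding w_eq using lp_add(2)[OF pq(4) first second] lp_diff(2)[OF pq(4) AJ(1,2)] by linarith
      ultimately have "lp_norm q (w i) \<le> 3 * d * (1/2)^i * lp_norm p x + (CA * (d * (1/2)^i * lp_norm p x) +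
          CA * (C * (3 * d * (1/2)^i * (CB * lp_norm p x))))"
        by linarith
      also have "\<dots> = D * d * (1/2)^i * lp_norm p x"
        by (simp add: D_def algebra_simps)
      finally show ?thesis
        unfolding w_eq using lp_add(1)[OF pq(4) first second] by blast
    qed
    have sums: "sum w {..<m} \<in> lp_space q" "lp_norm q (sum w {..<m}) \<le> e * lp_norm p x" for m
    proof -
      have 1: "sum w {..<m} \<in> lp_space q \<and> lp_norm q (sum w {..<m}) \<le> (\<Sum>i<m. lp_norm q (w i))"
        using w by (intro lp_sum[OF pq(4)]) blast
      then show "sum w {..<m} \<in> lp_space q" ..
      have "lp_norm q (sum w {..<m}) \<le> (\<Sum>i<m. lp_norm q (w i))" using 1 ..
      also have "\<dots> \<le> (\<Sum>i<m. D * d * (1/2)^i * lp_norm p x)"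
        using w by (intro sum_mono) blast
      also have "\<dots> = D * d * lp_norm p x * (\<Sum>i<m. (1/2)^i)"
        by (simp add: sum_distrib_left mult_ac)
      also have "\<dots> \<le> D * d * lp_norm p x * 2"
        using D d(1) by (intro mult_left_mono sum_half_powers_le) auto
      also have "\<dots> = e * lp_norm p x"
        using d(2) by simp
      finally show "lp_norm q (sum w {..<m}) \<le> e * lp_norm p x" .
    qed
    show ?thesis
    proof (rule lp_norm_pointwise_limit(2)[OF pq(3) _ sums])
      show "0 \<le> e * lp_norm p x" using \<open>0 < e\<close> by simp
      fix l
      have xsum: "x = cut {..<n m} x" if "k \<le> m" for m
      proof -
        have "m \<le> n m" by (rule strict_mono_imp_increasing[OF nmono])
        then have "{..<k} \<inter> {..<n m} = {..<k}" using that by auto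
        then show ?thesis
          using cut_cut[of "{..<n m}" "{..<k}" x] unfolding xk by (simp add: Int_commute xk)
      qed
      have "finite {i. l \<in> J i}"
        unfolding J_def by (rule card_overlapping_intervals(1)[OF nmono])
      then obtain m0 where m0: "\<And>i. l \<in> J i \<Longrightarrow> i < m0"
        unfolding finite_nat_set_iff_bounded by blast
      have "sum w {..<m} l = (S x - U (R (V x))) l" if m: "max k m0 \<le> m" for m
      proof -
        have "x = (\<Sum>i<m. cut (I i) x)"
          unfolding I_def
        proof (rule trans[OF xsum])
          show "k \<le> m" using m by simp
          show "cut {..<n m} x = (\<Sum>i<m. cut {n i..<n (Suc i)} x)"
            by (rule cut_initial_eq_sum[where n=n, OF n(1) less_imp_le[OF gapD(1)[OF n(2)]]])
        qed
        then have "S x = S (\<Sum>i<m. cut (I i) x)" by (rule arg_cong)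
        also have "\<dots> = (\<Sum>i<m. S (cut (I i) x))"
          by (rule lp_ops_sum[OF S pq(2) cutI[OF x]])
        finally have Sx: "S x l = (\<Sum>i<m. S (cut (I i) x) l)"
          by (simp add: sum_fun_apply)
        have "U (R (V x)) l = (\<Sum>i | l \<in> J i. cut (J i) (A (\<alpha> i (R (V x)))) l)"
          using lp_opsD(1)[OF R Vx] by (simp add: U_def block_op_def DA_def)
        also have "\<dots> = (\<Sum>i<m. cut (J i) (A (\<alpha> i (R (V x)))) l)"
          using m0 m by (intro sum.mono_neutral_left) (auto simp: cut_def intro: less_le_trans)
        finally show ?thesis
          using Sx by (simp add: sum_fun_apply w_def sum_subtractf)
      qed
      then show "(\<lambda>m. sum w {..<m} l) \<longlonglongrightarrow> (S x - U (R (V x))) l"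
        by (intro tendsto_eventually eventually_sequentiallyI[of "max k m0"])
    qed
  qed
  have "lp_norm q (S x - U (R (V x))) \<le> e * lp_norm p x" if x: "x \<in> lp_space p" for x
  proof (rule lp_ops_dense_bound[OF lp_ops_minus[OF S VU pq(4)] pq(2,4) _ _ x])
    show "0 \<le> e" using \<open>0 < e\<close> by simp
    fix x :: "nat \<Rightarrow> 'k" and k assume x: "x \<in> lp_space p"
    have "lp_norm q (S (cut {..<k} x) - U (R (V (cut {..<k} x)))) \<le> e * lp_norm p (cut {..<k} x)"
      by (rule fin[of _ k]) (simp_all add: lp_cut(1)[OF pq(1) x])
    also have "\<dots> \<le> e * lp_norm p x"
      using lp_cut(2)[OF pq(1) x] \<open>0 < e\<close> by (intro mult_left_mono) auto
    finally show "lp_norm q (S (cut {..<k} x) - U (R (V (cut {..<k} x)))) \<le> e * lp_norm p x" .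
  qed
  then show ?thesis
    using U V unfolding S_def o_def by blast
qed

theorem corollary4p12:
  fixes p q :: real
    and R :: "(nat \<Rightarrow> 'k::{real_normed_field, euclidean_space}) \<Rightarrow> nat \<Rightarrow> 'k"
  assumes "1 < p" and "p \<le> 2" and "2 \<le> q" and "p < q"
    and "R \<in> lp_ops p q"
    and "\<not> finitely_strictly_singular p q R"
  shows "l2_ideal p q \<subseteq> generated_ideal p q R"
  unfolding generated_ideal_def
proof (intro subsetI InterI)
  fix T :: "(nat \<Rightarrow> 'k) \<Rightarrow> nat \<Rightarrow> 'k" and J
  assume T: "T \<in> l2_ideal p q" and "J \<in> {J. closed_op_ideal p q J \<and> R \<in> J}"
  then have closed: "op_closure p q J \<subseteq> J" and ideal: "op_ideal p q J" and RJ: "R \<in> J"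
    by (auto simp: closed_op_ideal_def)
  have "S \<in> J" if S: "S \<in> lp_ops p q" "A \<in> lp_ops 2 q" "B \<in> lp_ops p 2" "S = A \<circ> B" for S A B
  proof -
    have "\<exists>S'\<in>J. op_norm p q (S - S') < e" if e: "0 < e" for e
    proof -
      have "0 < e / 2" using e by simp
      from factorization_through_l2_approximation[OF assms(1-3,5,6) S(2,3) this]
      obtain U V where U: "U \<in> lp_ops q q" and V: "V \<in> lp_ops p p"
        and approx: "\<forall>x\<in>lp_space p. lp_norm q (A (B x) - U (R (V x))) \<le> e / 2 * lp_norm p x"
        by (elim bexE)
      have "U \<circ> R \<circ> V \<in> J"
        using ideal U V RJ unfolding op_ideal_def by blast
      moreover have "op_norm p q (S - (U \<circ> R \<circ> V)) \<le> e / 2"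
        using e approx by (intro op_norm_le) (auto simp: S(4))
      ultimately show ?thesis using e by (intro bexI[of _ "U \<circ> R \<circ> V"]) auto
    qed
    then have "S \<in> op_closure p q J"
      using S(1) by (simp add: op_closure_def)
    then show "S \<in> J" using closed by blast
  qed
  then have sub: "{S \<in> lp_ops p q. \<exists>A\<in>lp_ops 2 q. \<exists>B\<in>lp_ops p 2. S = A \<circ> B} \<subseteq> J"
    by blast
  have "T \<in> op_closure p q J"
    using T sub unfolding l2_ideal_def op_closure_def by blast
  then show "T \<in> J" using closed by blast
qed

end
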